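(* Let $(\alpha_n)_n$ and $(\beta_n)_n$ be sequences of positive numbers converging to $\alpha>0$ and $\beta>0$ respectively, let $(m_n)_n$ be a sequence in the Wiener amalgam space $W(C_0,\ell^1)(\mathbb{R}^{2d})$ converging to $m$ in the corresponding norm, and let $(S_n)_n$ be a sequence of trace-class operators on $L^2(\mathbb{R}^d)$ converging to $S$ in $\mathcal{S}^1$. Then for the associated mixed-state Gabor multipliers $$G^{S_n}_{m_n,\alpha_n,\beta_n}\to G^S_{m,\alpha,\beta}\quad\text{in }\mathcal{S}^1\text{ as }n\to\infty .$$
   Context: For $z=(x,\omega)\in\mathbb{R}^{2d}$, $\pi(z)\psi(t)=e^{2\pi i\omega\cdot t}\psi(t-x)$ on $L^2(\mathbb{R}^d)$. $\mathcal{S}^1$ is the space of trace-class operators with trace norm. For $\alpha,\beta>0$ let $\Lambda_{\alpha,\beta}=\alpha\mathbb{Z}^d\times\beta\mathbb{Z}^d$. The mixed-state Gabor multiplier (with lattice normalization) is $$G^S_{m,\alpha,\beta}=\mu^m_{\alpha,\beta}\star S=\alpha^d\beta^d\sum_{\lambda\in\Lambda_{\alpha,\beta}}m(\lambda)\,\pi(\lambda)S\pi(\lambda)^*,\qquad \mu^m_{\alpha,\beta}=\alpha^d\beta^d\sum_{\lambda\in\Lambda_{\alpha,\beta}}m(\lambda)\delta_\lambda .$$ $W(C_0,\ell^1)(\mathbb{R}^{2d})$ is the space of continuous functions $m:\mathbb{R}^{2d}\to\mathbb{C}$ with $\|m\|_{W(C_0,\ell^1)}=\sum_{k\in\mathbb{Z}^{2d}}\sup_{z\in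 k+[0,1]^{2d}}|m(z)|<\infty$ (other bounded uniform partitions of unity give equivalent norms). *)

theory Defs
  imports "HOL-Analysis.Analysis"
begin

section \<open>The Hilbert space of square-integrable functions\<close>

definition square_integrable :: "(real^'d \<Rightarrow> complex) \<Rightarrow> bool" where
  "square_integrable f \<longleftrightarrow>
     f \<in> borel_measurable lborel \<and> integrable lborel (\<lambda>t. (cmod (f t))\<^sup>2)"

lemma square_integrable_zero: "square_integrable (\<lambda>_. 0)"
  by (simp add: square_integrable_def)

lemma square_integrable_mult_const:
  assumes "square_integrable f"
  shows "square_integrable (\<lambda>t. c * f t)"
  using assms by (auto simp: square_integrable_def norm_mult power_mult_distrib)

lemma square_integrable_add:
  assumes f: "square_integrable f" and g: "square_integrable g"
  shows "square_integrable (\<lambda>t. f t + g t)"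
proof -
  have [measurable]: "f \<in> borel_measurable lborel" "g \<in> borel_measurable lborel"
    using assms by (auto simp: square_integrable_def)
  have "integrable lborel (\<lambda>t. 2 * (cmod (f t))\<^sup>2 + 2 * (cmod (g t))\<^sup>2)"
    using assms by (auto simp: square_integrable_def)
  then have "integrable lborel (\<lambda>t. (cmod (f t + g t))\<^sup>2)"
  proof (rule Bochner_Integration.integrable_bound)
    show "AE t in lborel. norm ((cmod (f t + g t))\<^sup>2)
        \<le> norm (2 * (cmod (f t))\<^sup>2 + 2 * (cmod (g t))\<^sup>2)"
    proof (rule AE_I2)
      fix t
      have "(cmod (f t + g t))\<^sup>2 \<le> (cmod (f t) + cmod (g t))\<^sup>2"
        by (intro power_mono norm_triangle_ineq norm_ge_zero)
      also have "\<dots> \<le> 2 * (cmod (f t))\<^sup>2 + 2 * (cmod (g t))\<^sup>2"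
        using zero_le_power2[of "cmod (f t) - cmod (g t)"]
        by (simp add: power2_eq_square algebra_simps)
      finally show "norm ((cmod (f t + g t))\<^sup>2)
          \<le> norm (2 * (cmod (f t))\<^sup>2 + 2 * (cmod (g t))\<^sup>2)"
        by simp
    qed
  qed measurable
  then show ?thesis
    by (auto simp: square_integrable_def)
qed

lemma borel_measurable_cnj [measurable]: "cnj \<in> borel_measurable borel"
  by (intro borel_measurable_continuous_onI continuous_intros)

lemma square_integrable_mult_cnj:
  assumes f: "square_integrable f" and g: "square_integrable g"
  shows "integrable lborel (\<lambda>t. f t * cnj (g t))"
proof -
  have [measurable]: "f \<in> borel_measurable lborel" "g \<in> borel_measurable lborel"
    using assms by (auto simp: square_integrable_def)
  have "integrable lborel (\<lambda>t. (cmod (f t))\<^sup>2 + (cmod (g t))\<^sup>2)"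
    using assms by (auto simp: square_integrable_def)
  then show ?thesis
  proof (rule Bochner_Integration.integrable_bound)
    show "AE t in lborel. norm (f t * cnj (g t)) \<le> norm ((cmod (f t))\<^sup>2 + (cmod (g t))\<^sup>2)"
    proof (rule AE_I2)
      fix t
      have "0 \<le> (cmod (f t) - cmod (g t))\<^sup>2 + (cmod (f t))\<^sup>2 + (cmod (g t))\<^sup>2"
        by simp
      then show "norm (f t * cnj (g t)) \<le> norm ((cmod (f t))\<^sup>2 + (cmod (g t))\<^sup>2)"
        by (simp add: norm_mult power2_eq_square algebra_simps)
    qed
  qed measurable
qed

lemma lborel_distr_minus_const:
  fixes x :: "'a::euclidean_space"
  shows "distr lborel lborel (\<lambda>t. t - x) = lborel"
proof -
  have "distr lborel lborel (\<lambda>t. t - x) = distr lborel borel ((+) (- x))"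
    by (intro distr_cong) auto
  then show ?thesis
    by (simp add: lborel_distr_plus)
qed

text \<open>
  The functions \<open>t \<mapsto> exp (2 \<pi> i \<omega> \<bullet> t) f (t - x)\<close>, before passing to almost-everywhere classes.
\<close>

definition tf_shift_fun :: "(real^'d) \<times> (real^'d) \<Rightarrow> (real^'d \<Rightarrow> complex) \<Rightarrow> real^'d \<Rightarrow> complex"
  where "tf_shift_fun z f t =
    (case z of (x, \<omega>) \<Rightarrow> exp (2 * of_real pi * \<i> * of_real (\<omega> \<bullet> t)) * f (t - x))"

lemma cmod_tf_shift_fun: "cmod (tf_shift_fun z f t) = cmod (f (t - fst z))"
  by (simp add: tf_shift_fun_def norm_mult split: prod.split)

lemma measurable_tf_shift_fun [measurable]:
  assumes [measurable]: "f \<in> borel_measurable lborel"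
  shows "tf_shift_fun z f \<in> borel_measurable lborel"
proof -
  have [measurable]: "f \<in> borel_measurable borel"
    using assms by simp
  show ?thesis
    by (cases z) (simp add: tf_shift_fun_def[abs_def])
qed

lemma square_integrable_tf_shift_fun:
  assumes "square_integrable f"
  shows "square_integrable (tf_shift_fun z f)"
    and "(LINT t|lborel. (cmod (tf_shift_fun z f t))\<^sup>2) = (LINT t|lborel. (cmod (f t))\<^sup>2)"
proof -
  have [measurable]: "f \<in> borel_measurable lborel"
    and i: "integrable lborel (\<lambda>t. (cmod (f t))\<^sup>2)"
    using assms by (auto simp: square_integrable_def)
  have m: "(\<lambda>t. t - fst z) \<in> measurable lborel lborel"
    by simp
  have "integrable (distr lborel lborel (\<lambda>t. t - fst z)) (\<lambda>t. (cmod (f t))\<^sup>2)"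
    using i by (simp only: lborel_distr_minus_const)
  then have "integrable lborel (\<lambda>t. (cmod (f (t - fst z)))\<^sup>2)"
    by (subst (asm) integrable_distr_eq[OF m]) auto
  then show "square_integrable (tf_shift_fun z f)"
    by (simp add: square_integrable_def cmod_tf_shift_fun)
  have "(LINT t|lborel. (cmod (f t))\<^sup>2)
      = (LINT t|distr lborel lborel (\<lambda>t. t - fst z). (cmod (f t))\<^sup>2)"
    by (simp only: lborel_distr_minus_const)
  also have "\<dots> = (LINT t|lborel. (cmod (f (t - fst z)))\<^sup>2)"
    by (rule integral_distr[OF m]) simp
  finally show "(LINT t|lborel. (cmod (tf_shift_fun z f t))\<^sup>2) = (LINT t|lborel. (cmod (f t))\<^sup>2)"
    by (simp add: cmod_tf_shift_fun)
qed

definition l2_rel :: "(real^'d \<Rightarrow> complex) \<Rightarrow> (real^'d \<Rightarrow> complex) \<Rightarrow> bool" where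
  "l2_rel f g \<longleftrightarrow> square_integrable f \<and> square_integrable g \<and> (AE t in lborel. f t = g t)"

lemma tf_shift_fun_AE:
  assumes "l2_rel f g"
  shows "AE t in lborel. tf_shift_fun z f t = tf_shift_fun z g t"
proof -
  have [measurable]: "f \<in> borel_measurable lborel" "g \<in> borel_measurable lborel"
    and ae: "AE t in lborel. f t = g t"
    using assms by (auto simp: l2_rel_def square_integrable_def)
  have m: "(\<lambda>t. t - fst z) \<in> measurable lborel lborel"
    by simp
  have "AE t in distr lborel lborel (\<lambda>t. t - fst z). f t = g t"
    using ae by (simp only: lborel_distr_minus_const)
  then have "AE t in lborel. f (t - fst z) = g (t - fst z)"
    by (subst (asm) AE_distr_iff[OF m]) auto
  then show ?thesis
    by eventually_elim (auto simp: tf_shift_fun_def split: prod.split)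
qed

quotient_type 'd L2 = "real^'d::finite \<Rightarrow> complex" / partial: l2_rel
proof (rule part_equivpI)
  show "\<exists>f::real^'d \<Rightarrow> complex. l2_rel f f"
    by (rule exI[of _ "\<lambda>_. 0"]) (simp add: l2_rel_def square_integrable_zero)
  show "symp (l2_rel :: (real^'d \<Rightarrow> complex) \<Rightarrow> _)"
    by (auto simp: symp_def l2_rel_def)
  show "transp (l2_rel :: (real^'d \<Rightarrow> complex) \<Rightarrow> _)"
    unfolding transp_def l2_rel_def
  proof (intro allI impI conjI; elim conjE)
    fix f g h :: "real^'d \<Rightarrow> complex"
    assume "AE t in lborel. f t = g t" "AE t in lborel. g t = h t"
    then show "AE t in lborel. f t = h t"
      by eventually_elim simp
  qed
qed

lift_definition scaleC :: "complex \<Rightarrow> 'd::finite L2 \<Rightarrow> 'd L2"  (infixr \<open>*\<^sub>C\<close> 75)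
  is "\<lambda>c f t. c * f t"
  by (auto simp: l2_rel_def intro: square_integrable_mult_const elim: eventually_mono)

text \<open>The complex inner product is linear in the first argument.\<close>

lift_definition cinner :: "'d::finite L2 \<Rightarrow> 'd L2 \<Rightarrow> complex"
  is "\<lambda>f g. LINT t|lborel. f t * cnj (g t)"
proof -
  fix f f' g g' :: "real^'d \<Rightarrow> complex"
  assume *: "l2_rel f f'" "l2_rel g g'"
  then have "AE t in lborel. f t = f' t" "AE t in lborel. g t = g' t"
    by (auto simp: l2_rel_def)
  then have "AE t in lborel. f t * cnj (g t) = f' t * cnj (g' t)"
    by eventually_elim simp
  then show "(LINT t|lborel. f t * cnj (g t)) = (LINT t|lborel. f' t * cnj (g' t))"
    using * by (intro integral_cong_AE borel_measurable_integrable square_integrable_mult_cnj)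
      (auto simp: l2_rel_def)
qed

text \<open>
  The real Hilbert space structure underlying the complex one: the real inner product is the
  real part of \<^const>\<open>cinner\<close>, so the norm is the usual one and the library's bounded
  linear maps can be used. Complex linearity of operators is imposed separately below.
\<close>

instantiation L2 :: (finite) real_inner
begin

lift_definition zero_L2 :: "'a L2" is "\<lambda>_. 0"
  by (simp add: l2_rel_def square_integrable_zero)

lift_definition plus_L2 :: "'a L2 \<Rightarrow> 'a L2 \<Rightarrow> 'a L2" is "\<lambda>f g t. f t + g t"
proof -
  fix f f' g g' :: "real^'a \<Rightarrow> complex"
  assume *: "l2_rel f f'" "l2_rel g g'"
  then have "AE t in lborel. f t = f' t" "AE t in lborel. g t = g' t"
    by (auto simp: l2_rel_def)
  then have "AE t in lborel. f t + g t = f' t + g' t"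
    by eventually_elim simp
  with * show "l2_rel (\<lambda>t. f t + g t) (\<lambda>t. f' t + g' t)"
    by (auto simp: l2_rel_def square_integrable_add)
qed

definition scaleR_L2 :: "real \<Rightarrow> 'a L2 \<Rightarrow> 'a L2" where
  "scaleR_L2 r f = complex_of_real r *\<^sub>C f"

definition uminus_L2 :: "'a L2 \<Rightarrow> 'a L2" where
  "uminus_L2 f = (- 1) *\<^sub>C f"

definition minus_L2 :: "'a L2 \<Rightarrow> 'a L2 \<Rightarrow> 'a L2" where
  "minus_L2 f g = f + - (g :: 'a L2)"

definition inner_L2 :: "'a L2 \<Rightarrow> 'a L2 \<Rightarrow> real" where
  "inner_L2 f g = Re (cinner f g)"

definition norm_L2 :: "'a L2 \<Rightarrow> real" where
  "norm_L2 f = sqrt (f \<bullet> f)"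

definition dist_L2 :: "'a L2 \<Rightarrow> 'a L2 \<Rightarrow> real" where
  "dist_L2 f g = norm (f - g)"

definition sgn_L2 :: "'a L2 \<Rightarrow> 'a L2" where
  "sgn_L2 f = inverse (norm f) *\<^sub>R f"

definition uniformity_L2 :: "('a L2 \<times> 'a L2) filter" where
  "uniformity_L2 = (INF e\<in>{0<..}. principal {(f, g). dist f g < e})"

definition open_L2 :: "'a L2 set \<Rightarrow> bool" where
  "open_L2 U \<longleftrightarrow> (\<forall>f\<in>U. \<forall>\<^sub>F (f', g) in uniformity. f' = f \<longrightarrow> g \<in> U)"

instance
proof
  have rel: "l2_rel u v" if "square_integrable u" "u = v" for u v :: "real^'a \<Rightarrow> complex"
    using that by (simp add: l2_rel_def)
  fix f g h :: "'a L2" and r s :: real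
  show "f + g + h = f + (g + h)"
    by transfer (auto simp: l2_rel_def algebra_simps intro!: rel square_integrable_add)
  show "f + g = g + f"
    by transfer (auto simp: l2_rel_def algebra_simps intro!: rel square_integrable_add)
  show "0 + f = f"
    by transfer (auto simp: l2_rel_def)
  show "- f + f = 0"
    unfolding uminus_L2_def by transfer (auto simp: l2_rel_def square_integrable_zero)
  show "f - g = f + - g"
    by (simp add: minus_L2_def)
  show "r *\<^sub>R (f + g) = r *\<^sub>R f + r *\<^sub>R g"
    unfolding scaleR_L2_def
    by transfer (auto simp: l2_rel_def distrib_left
        intro!: rel square_integrable_add square_integrable_mult_const)
  show "(r + s) *\<^sub>R f = r *\<^sub>R f + s *\<^sub>R f"
    unfolding scaleR_L2_def
    by transfer (auto simp: l2_rel_def distrib_right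
        intro!: rel square_integrable_add square_integrable_mult_const)
  show "r *\<^sub>R s *\<^sub>R f = (r * s) *\<^sub>R f"
    unfolding scaleR_L2_def
    by transfer (auto simp: l2_rel_def mult.assoc intro!: rel square_integrable_mult_const)
  show "1 *\<^sub>R f = f"
    unfolding scaleR_L2_def by transfer (auto simp: l2_rel_def)
  show "sgn f = inverse (norm f) *\<^sub>R f"
    by (rule sgn_L2_def)
  show "dist f g = norm (f - g)"
    by (rule dist_L2_def)
  show "(uniformity :: ('a L2 \<times> 'a L2) filter)
      = (INF e\<in>{0<..}. principal {(f, g). dist f g < e})"
    by (rule uniformity_L2_def)
  show "open U \<longleftrightarrow> (\<forall>f\<in>U. \<forall>\<^sub>F (f', g) in uniformity. f' = f \<longrightarrow> g \<in> U)" for U :: "'a L2 set"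
    by (rule open_L2_def)
  show "norm f = sqrt (f \<bullet> f)"
    by (rule norm_L2_def)
  have cnj: "cinner f g = cnj (cinner g f)"
    by transfer (simp add: mult.commute flip: Bochner_Integration.integral_cnj)
  show "f \<bullet> g = g \<bullet> f"
    using cnj by (simp add: inner_L2_def)
  show "(f + g) \<bullet> h = f \<bullet> h + g \<bullet> h"
    unfolding inner_L2_def
    by transfer (auto simp: l2_rel_def distrib_right square_integrable_mult_cnj)
  show "r *\<^sub>R f \<bullet> g = r * (f \<bullet> g)"
    unfolding inner_L2_def scaleR_L2_def by transfer (simp add: mult.assoc)
  have sq: "\<exists>u :: real^'a \<Rightarrow> complex. square_integrable u \<and> f \<bullet> f = (LINT t|lborel. (cmod (u t))\<^sup>2) \<and>
      (f = 0 \<longleftrightarrow> (AE t in lborel. u t = 0))"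
    unfolding inner_L2_def
  proof transfer
    fix u :: "real^'a \<Rightarrow> complex"
    assume u: "l2_rel u u"
    have "(LINT t|lborel. u t * cnj (u t)) = (LINT t|lborel. complex_of_real ((cmod (u t))\<^sup>2))"
      by (simp only: complex_norm_square)
    then have "Re (LINT t|lborel. u t * cnj (u t)) = (LINT t|lborel. (cmod (u t))\<^sup>2)"
      by (simp del: of_real_power)
    from u this show "\<exists>v :: real^'a \<Rightarrow> complex. square_integrable v \<and>
        Re (LINT t|lborel. u t * cnj (u t)) = (LINT t|lborel. (cmod (v t))\<^sup>2) \<and>
        l2_rel u (\<lambda>_. 0) = (AE t in lborel. v t = 0)"
      by - (rule exI[of _ u], auto simp: l2_rel_def square_integrable_zero)
  qed
  then obtain u :: "real^'a \<Rightarrow> complex" where u: "square_integrable u" "f \<bullet> f = (LINT t|lborel. (cmod (u t))\<^sup>2)"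
    "f = 0 \<longleftrightarrow> (AE t in lborel. u t = 0)"
    by blast
  show "0 \<le> f \<bullet> f"
    by (simp add: u(2))
  show "f \<bullet> f = 0 \<longleftrightarrow> f = 0"
    unfolding u(2,3) using u(1)
    by (subst integral_nonneg_eq_0_iff_AE) (auto simp: square_integrable_def)
qed

end


section \<open>Bounded operators\<close>

type_synonym 'd op = "'d L2 \<Rightarrow>\<^sub>L 'd L2"

lemma norm_L2_sq: "(norm f)\<^sup>2 = Re (cinner f f)" for f :: "'d::finite L2"
  by (simp add: power2_norm_eq_inner inner_L2_def)

lemma norm_scaleC: "norm (c *\<^sub>C f) = cmod c * norm f" for f :: "'d::finite L2"
proof -
  have "cinner (c *\<^sub>C f) (c *\<^sub>C f) = of_real ((cmod c)\<^sup>2) * cinner f f"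
  proof transfer
    fix c and f :: "real^'d \<Rightarrow> complex"
    have "(\<lambda>t. c * f t * cnj (c * f t)) = (\<lambda>t. of_real ((cmod c)\<^sup>2) * (f t * cnj (f t)))"
      by (simp add: complex_norm_square mult_ac fun_eq_iff del: of_real_power)
    then show "(LINT t|lborel. c * f t * cnj (c * f t))
        = of_real ((cmod c)\<^sup>2) * (LINT t|lborel. f t * cnj (f t))"
      by simp
  qed
  then have "(norm (c *\<^sub>C f))\<^sup>2 = (cmod c * norm f)\<^sup>2"
    by (simp add: norm_L2_sq power_mult_distrib del: of_real_power)
  then show ?thesis
    by (rule power2_eq_imp_eq) auto
qed

text \<open>Multiplication by a complex constant; \<open>c T\<close> for an operator \<open>T\<close> is \<open>cmul c o\<^sub>L T\<close>.\<close>

lift_definition cmul :: "complex \<Rightarrow> 'd::finite op" is scaleC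
proof (rule bounded_linear_intro)
  fix c and f g :: "'d L2" and r :: real
  show "c *\<^sub>C (f + g) = c *\<^sub>C f + c *\<^sub>C g"
    by transfer (auto simp: l2_rel_def distrib_left square_integrable_add square_integrable_mult_const)
  show "c *\<^sub>C (r *\<^sub>R f) = r *\<^sub>R (c *\<^sub>C f)"
    unfolding scaleR_L2_def
    by transfer (auto simp: l2_rel_def mult.left_commute square_integrable_mult_const)
  show "norm (c *\<^sub>C f) \<le> norm f * cmod c"
    by (simp add: norm_scaleC)
qed

lift_definition tf_shift_L2 :: "(real^'d) \<times> (real^'d) \<Rightarrow> 'd::finite L2 \<Rightarrow> 'd L2"
  is tf_shift_fun
  by (metis l2_rel_def tf_shift_fun_AE square_integrable_tf_shift_fun(1))

lift_definition tf_shift :: "(real^'d) \<times> (real^'d) \<Rightarrow> 'd::finite op" is tf_shift_L2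
proof (rule bounded_linear_intro)
  fix z and f g :: "'d L2" and r :: real
  show "tf_shift_L2 z (f + g) = tf_shift_L2 z f + tf_shift_L2 z g"
  proof transfer
    fix z and f g :: "real^'d \<Rightarrow> complex"
    assume "l2_rel f f" "l2_rel g g"
    moreover have "tf_shift_fun z (\<lambda>t. f t + g t) = (\<lambda>t. tf_shift_fun z f t + tf_shift_fun z g t)"
      by (auto simp: tf_shift_fun_def distrib_left split: prod.split)
    ultimately show "l2_rel (tf_shift_fun z (\<lambda>t. f t + g t))
        (\<lambda>t. tf_shift_fun z f t + tf_shift_fun z g t)"
      by (auto simp: l2_rel_def intro!: square_integrable_add square_integrable_tf_shift_fun)
  qed
  show "tf_shift_L2 z (r *\<^sub>R f) = r *\<^sub>R tf_shift_L2 z f"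
    unfolding scaleR_L2_def
  proof transfer
    fix z and r and f :: "real^'d \<Rightarrow> complex"
    assume "l2_rel f f"
    moreover have "tf_shift_fun z (\<lambda>t. complex_of_real r * f t)
        = (\<lambda>t. complex_of_real r * tf_shift_fun z f t)"
      by (auto simp: tf_shift_fun_def mult_ac split: prod.split)
    ultimately show "l2_rel (tf_shift_fun z (\<lambda>t. complex_of_real r * f t))
        (\<lambda>t. complex_of_real r * tf_shift_fun z f t)"
      by (auto simp: l2_rel_def intro!: square_integrable_mult_const square_integrable_tf_shift_fun)
  qed
  have "cinner (tf_shift_L2 z f) (tf_shift_L2 z f) = cinner f f"
  proof transfer
    fix z and f :: "real^'d \<Rightarrow> complex"
    assume "l2_rel f f"
    then have "(LINT t|lborel. (cmod (tf_shift_fun z f t))\<^sup>2) = (LINT t|lborel. (cmod (f t))\<^sup>2)"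
      by (simp add: l2_rel_def square_integrable_tf_shift_fun)
    then show "(LINT t|lborel. tf_shift_fun z f t * cnj (tf_shift_fun z f t))
        = (LINT t|lborel. f t * cnj (f t))"
      by (simp flip: complex_norm_square of_real_power)
  qed
  then have "(norm (tf_shift_L2 z f))\<^sup>2 = (norm f)\<^sup>2"
    by (simp add: norm_L2_sq)
  then show "norm (tf_shift_L2 z f) \<le> norm f * 1"
    by simp
qed

definition clinear_op :: "'d::finite op \<Rightarrow> bool" where
  "clinear_op T \<longleftrightarrow> (\<forall>c f. T (c *\<^sub>C f) = c *\<^sub>C T f)"

definition adjoint_op :: "'d::finite op \<Rightarrow> 'd op"  (\<open>_\<^sup>\<dagger>\<close> [1000] 999) where
  "T\<^sup>\<dagger> = (THE U::'d op. \<forall>f g. cinner (U f) g = cinner f (T g))"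

definition positive_op :: "'d::finite op \<Rightarrow> bool" where
  "positive_op P \<longleftrightarrow> clinear_op P \<and> (\<forall>f. cinner (P f) f \<in> \<real>\<^sub>\<ge>\<^sub>0)"

text \<open>The absolute value \<open>(T\<^sup>\<dagger> T)\<^bsup>1/2\<^esup>\<close>, i.e. the unique positive square root.\<close>

definition abs_op :: "'d::finite op \<Rightarrow> 'd op" where
  "abs_op T = (THE P::'d op. positive_op P \<and> P o\<^sub>L P = T\<^sup>\<dagger> o\<^sub>L T)"

section \<open>Trace class\<close>

definition orthonormal_basis :: "'d::finite L2 set \<Rightarrow> bool" where
  "orthonormal_basis B \<longleftrightarrow>
     (\<forall>e\<in>B. \<forall>e'\<in>B. cinner e e' = (if e = e' then 1 else 0)) \<and>
     (\<forall>f. (\<forall>e\<in>B. cinner f e = 0) \<longrightarrow> f = 0)"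

text \<open>
  As usual, the trace of the positive operator \<open>abs_op T\<close> does not depend on the orthonormal
  basis used to compute it, so neither the quantifier in the first definition nor the choice
  in the second one matters.
\<close>

definition trace_class :: "'d::finite op \<Rightarrow> bool" where
  "trace_class T \<longleftrightarrow> clinear_op T \<and>
     (\<exists>B. orthonormal_basis B \<and> (\<lambda>e. Re (cinner (abs_op T e) e)) summable_on B)"

definition trace_norm :: "'d::finite op \<Rightarrow> real" where
  "trace_norm T = (\<Sum>\<^sub>\<infinity>e\<in>(SOME B. orthonormal_basis B). Re (cinner (abs_op T e) e))"

definition tendsto_S1 :: "(nat \<Rightarrow> 'd::finite op) \<Rightarrow> 'd op \<Rightarrow> bool" where
  "tendsto_S1 T T0 \<longleftrightarrow> (\<forall>n. trace_class (T n)) \<and> trace_class T0 \<and>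
     (\<lambda>n. trace_norm (T n - T0)) \<longlonglongrightarrow> 0"


section \<open>Lattices, the Wiener amalgam space and mixed-state Gabor multipliers\<close>

definition int_vec :: "int^'d \<Rightarrow> real^'d" where
  "int_vec k = (\<chi> i. of_int (k $ i))"

definition gabor_lattice :: "real \<Rightarrow> real \<Rightarrow> ((real^'d) \<times> (real^'d)) set" where
  "gabor_lattice \<alpha> \<beta> = range (\<lambda>k. \<alpha> *\<^sub>R int_vec k) \<times> range (\<lambda>l. \<beta> *\<^sub>R int_vec l)"

text \<open>
  \<open>gabor_lattice 1 1\<close> is the integer lattice in dimension \<open>2 d\<close>, and \<open>cbox 0 One\<close> is the closed
  unit cube of the product space.
\<close>

definition cube_sup :: "((real^'d) \<times> (real^'d) \<Rightarrow> complex) \<Rightarrow> (real^'d) \<times> (real^'d) \<Rightarrow> real" where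
  "cube_sup m k = (SUP z\<in>(+) k ` cbox 0 One. cmod (m z))"

definition wiener_amalgam :: "((real^'d) \<times> (real^'d) \<Rightarrow> complex) set" where
  "wiener_amalgam = {m. continuous_on UNIV m \<and> cube_sup m summable_on gabor_lattice 1 1}"

definition wiener_norm :: "((real^'d) \<times> (real^'d) \<Rightarrow> complex) \<Rightarrow> real" where
  "wiener_norm m = (\<Sum>\<^sub>\<infinity>k\<in>gabor_lattice 1 1. cube_sup m k)"

text \<open>
  The series is an unconditional sum in operator norm. For \<open>m\<close> in the Wiener amalgam space and
  \<open>S\<close> trace class it also converges absolutely in trace norm, with the same sum.
\<close>

definition mixed_gabor_multiplier ::
  "'d::finite op \<Rightarrow> ((real^'d) \<times> (real^'d) \<Rightarrow> complex) \<Rightarrow> real \<Rightarrow> real \<Rightarrow> 'd op" where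
  "mixed_gabor_multiplier S m \<alpha> \<beta> = (\<alpha> ^ CARD('d) * \<beta> ^ CARD('d)) *\<^sub>R
     (\<Sum>\<^sub>\<infinity>z\<in>gabor_lattice \<alpha> \<beta>. cmul (m z) o\<^sub>L (tf_shift z o\<^sub>L S o\<^sub>L (tf_shift z)\<^sup>\<dagger>))"

end

theory Submission
  imports Defs
begin

text \<open>
  Write \<open>g S m a b\<close> for the lattice sum \<open>\<Sum> m(\<lambda>) \<pi>(\<lambda>) S \<pi>(\<lambda>)\<^sup>\<dagger>\<close> over the lattice with parameters
  \<open>a, b\<close>. Since \<open>g\<close> is linear in \<open>S\<close> and in \<open>m\<close>,
  \<open>g S\<^sub>n m\<^sub>n a\<^sub>n b\<^sub>n - g S m a b\<close> is the sum of \<open>g S\<^sub>n (m\<^sub>n - m) a\<^sub>n b\<^sub>n\<close>, of \<open>g (S\<^sub>n - S) m a\<^sub>n b\<^sub>n\<close>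
  and of \<open>g S m a\<^sub>n b\<^sub>n - g S m a b\<close>.

  The first two terms are small because the trace norm of \<open>g S m a b\<close> is at most
  \<open>N\<close> times the Wiener norm of \<open>m\<close> times the trace norm of \<open>S\<close>, where \<open>N\<close> bounds the number of
  lattice points in a unit cube and can be chosen uniformly as long as \<open>a\<close> and \<open>b\<close> stay away from
  \<open>0\<close> (\<open>trace_le_gabor_sum\<close>). For the third term, no summable majorant of \<open>m(a\<^sub>n k, b\<^sub>n l)\<close> that is
  independent of \<open>n\<close> has to exist: the point \<open>a\<^sub>n k\<close> moves over a distance proportional to \<open>k\<close>.
  What is uniform in \<open>n\<close> is the smallness of the tails: outside one finite set of indices, all the
  points of all the lattices lie in unit cubes that carry little of the Wiener norm
  (\<open>lattice_sum_uniform_tail\<close>). Inside this finite set every term converges, since \<open>m\<close> is continuous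
  and \<open>z \<mapsto> \<pi>(z) S \<pi>(z)\<^sup>\<dagger>\<close> is continuous in trace norm
  (\<open>trace_tendsto_conjugated_tf_shift\<close>): this is clear for operators of rank one from the strong
  continuity of \<open>\<pi>\<close> (\<open>tendsto_tf_shift\<close>), and operators of finite rank are dense in trace norm.

  The trace norm is handled through its dual description. The predicate \<open>trace_le T C\<close> says that
  \<open>Re (tr\<^sub>E (V T)) \<le> C\<close> for every contraction \<open>V\<close> and every finite orthonormal set \<open>E\<close>, the trace
  being taken over \<open>E\<close>. In this form the triangle inequality, unitary invariance
  and stability under limits are immediate. That it agrees with the definition by the
  absolute value \<open>\<bar>T\<bar> = (T\<^sup>\<dagger> T)\<^bsup>1/2\<^esup>\<close> rests on two facts. Contractions \<open>U, V\<close> with \<open>T = U \<bar>T\<bar>\<close> and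
  \<open>\<bar>T\<bar> = V T\<close> exist because \<open>T\<close> and \<open>\<bar>T\<bar>\<close> satisfy \<open>norm (T f) = norm (\<bar>T\<bar> f)\<close>
  (\<open>clinear_factor_through_dominating\<close>), and with \<open>R = \<bar>T\<bar>\<^bsup>1/2\<^esup>\<close> and an orthonormal basis \<open>B\<close> one has
  \<open>T f = \<Sum> \<langle>f, R e\<rangle> U R e\<close> over \<open>e \<in> B\<close> (\<open>nuclear_representation\<close>).
\<close>

section \<open>Operators on real Hilbert spaces\<close>


text \<open>
  Adjoints, square roots and factorizations only involve the real inner product. They are
  developed for real Hilbert spaces; complex linearity is recovered later, as the property of
  commuting with multiplication by \<open>\<i>\<close>.
\<close>

lemma subspace_closure:
  fixes M :: "'a::real_normed_vector set"
  assumes "subspace M"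
  shows "subspace (closure M)"
proof (rule subspaceI)
  show "0 \<in> closure M"
    using subspace_0[OF assms] closure_subset by blast
  fix x y and c :: real
  assume "x \<in> closure M"
  then obtain u where u: "\<And>n. u n \<in> M" "u \<longlonglongrightarrow> x"
    by (auto simp: closure_sequential)
  have "(\<lambda>n. c *\<^sub>R u n) \<longlonglongrightarrow> c *\<^sub>R x"
    by (intro tendsto_intros u)
  then show "c *\<^sub>R x \<in> closure M"
    unfolding closure_sequential
    by (intro exI[of _ "\<lambda>n. c *\<^sub>R u n"]) (auto intro: u subspace_scale assms)
  assume "y \<in> closure M"
  then obtain v where v: "\<And>n. v n \<in> M" "v \<longlonglongrightarrow> y"
    by (auto simp: closure_sequential)
  have "(\<lambda>n. u n + v n) \<longlonglongrightarrow> x + y"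
    by (intro tendsto_intros u v)
  then show "x + y \<in> closure M"
    unfolding closure_sequential
    by (intro exI[of _ "\<lambda>n. u n + v n"]) (auto intro: u v subspace_add assms)
qed

text \<open>
  By the parallelogram law the points of the subspace at almost minimal distance from \<open>y\<close> are close
  to each other, so that completeness gives a common limit.
\<close>

lemma ex_nearest_point_closed_subspace:
  fixes M :: "'a::{real_inner,banach} set"
  assumes "closed M" "subspace M"
  shows "\<exists>p\<in>M. \<forall>q\<in>M. dist y p \<le> dist y q"
proof -
  have ne: "M \<noteq> {}"
    using subspace_0[OF assms(2)] by blast
  define d where "d = infdist y M"
  have d0: "d \<ge> 0"
    by (simp add: d_def infdist_nonneg)
  define S where "S n = M \<inter> cball y (d + 1 / Suc n)" for n
  have lower: "d \<le> dist y q" if "q \<in> M" for q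
    using infdist_le[OF that] by (simp add: d_def)
  have "\<exists>p. \<forall>n. p \<in> S n"
  proof (rule decreasing_closed_nest[of S])
    show "closed (S n)" for n
      by (auto simp: S_def intro!: assms)
    show "S n \<noteq> {}" for n
    proof -
      have "infdist y M < d + 1 / Suc n"
        by (simp add: d_def)
      then obtain q where "q \<in> M" "dist y q < d + 1 / Suc n"
        unfolding infdist_notempty[OF ne] by (subst (asm) cINF_less_iff) (auto simp: ne intro!: bdd_belowI2[of _ 0])
      then show ?thesis
        by (auto simp: S_def less_imp_le)
    qed
    show "S n \<subseteq> S m" if "m \<le> n" for m n
    proof -
      have "1 / real (Suc n) \<le> 1 / real (Suc m)"
        using that by (simp add: field_simps)
      then show ?thesis
        by (auto simp: S_def)
    qed
    fix \<epsilon> :: real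
    assume e: "\<epsilon> > 0"
    have "(\<lambda>n. 4 * (d + 1 / real (Suc n))\<^sup>2) \<longlonglongrightarrow> 4 * (d + 0)\<^sup>2"
      by (intro tendsto_intros LIMSEQ_Suc[OF lim_1_over_n])
    then have "\<forall>\<^sub>F n in sequentially. 4 * (d + 1 / real (Suc n))\<^sup>2 < 4 * d\<^sup>2 + \<epsilon>\<^sup>2"
      using e by (elim order_tendstoD) auto
    then obtain n where n: "4 * (d + 1 / real (Suc n))\<^sup>2 < 4 * d\<^sup>2 + \<epsilon>\<^sup>2"
      by (meson eventually_happens' sequentially_bot)
    have "dist a b < \<epsilon>" if a: "a \<in> S n" and b: "b \<in> S n" for a b
    proof -
      have "(1/2) *\<^sub>R (a + b) \<in> M"
        using a b by (intro subspace_scale subspace_add assms) (auto simp: S_def)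
      then have "d\<^sup>2 \<le> (norm (y - (1/2) *\<^sub>R (a + b)))\<^sup>2"
        using lower[of "(1/2) *\<^sub>R (a + b)"] d0 by (intro power_mono) (auto simp: dist_norm)
      moreover have "(norm (a - b))\<^sup>2 + 4 * (norm (y - (1/2) *\<^sub>R (a + b)))\<^sup>2
          = 2 * (norm (y - a))\<^sup>2 + 2 * (norm (y - b))\<^sup>2"
        by (simp add: power2_norm_eq_inner inner_diff inner_add inner_commute algebra_simps)
      moreover have "(norm (y - a))\<^sup>2 \<le> (d + 1 / Suc n)\<^sup>2" "(norm (y - b))\<^sup>2 \<le> (d + 1 / Suc n)\<^sup>2"
        using a b by (auto simp: S_def dist_norm intro!: power_mono)
      ultimately have "(norm (a - b))\<^sup>2 < \<epsilon>\<^sup>2"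
        using n by linarith
      then show ?thesis
        using e by (simp add: dist_norm power2_less_imp_less)
    qed
    then show "\<exists>n. \<forall>a\<in>S n. \<forall>b\<in>S n. dist a b < \<epsilon>"
      by blast
  next
    show "\<exists>p. \<forall>n. p \<in> S n" if "\<And>n. a \<in> S n" for a
      using that by blast
  qed
  then obtain p where p: "\<And>n. p \<in> S n"
    by blast
  have "dist y p \<le> d + 1 / Suc n" for n
    using p[of n] by (simp add: S_def)
  then have "dist y p \<le> d + 0"
    by (intro LIMSEQ_le_const[of "\<lambda>n. d + 1 / Suc n"] tendsto_intros LIMSEQ_Suc[OF lim_1_over_n]) auto
  then show ?thesis
    using p[of 0] lower by (auto simp: S_def intro: order_trans)
qed

lemma orthogonal_projection_closed_subspace:
  fixes M :: "'a::{real_inner,banach} set"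
  assumes "closed M" "subspace M"
  shows "\<exists>p\<in>M. \<forall>q\<in>M. (y - p) \<bullet> q = 0"
proof -
  obtain p where p: "p \<in> M" "\<And>q. q \<in> M \<Longrightarrow> dist y p \<le> dist y q"
    using ex_nearest_point_closed_subspace[OF assms, of y] by blast
  have "(y - p) \<bullet> q = 0" if q: "q \<in> M" for q
  proof (cases "q = 0")
    case False
    define t where "t = ((y - p) \<bullet> q) / (q \<bullet> q)"
    have expand: "(norm (w - t *\<^sub>R q))\<^sup>2 = (norm w)\<^sup>2 - 2 * t * (w \<bullet> q) + t * t * (q \<bullet> q)" for w
      unfolding power2_norm_eq_inner by (simp add: inner_diff inner_commute[of q w] algebra_simps)
    have qq: "q \<bullet> q > 0"
      using False by simp
    have "p + t *\<^sub>R q \<in> M"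
      by (intro subspace_add subspace_scale assms p q)
    then have "(dist y p)\<^sup>2 \<le> (dist y (p + t *\<^sub>R q))\<^sup>2"
      by (intro power_mono p) auto
    also have "\<dots> = (norm ((y - p) - t *\<^sub>R q))\<^sup>2"
      by (simp add: dist_norm algebra_simps)
    also have "\<dots> = (dist y p)\<^sup>2 - 2 * t * ((y - p) \<bullet> q) + t * t * (q \<bullet> q)"
      using expand[of "y - p"] by (simp add: dist_norm)
    also have "t * t * (q \<bullet> q) = t * ((y - p) \<bullet> q)"
      using qq by (simp add: t_def)
    finally have "t * ((y - p) \<bullet> q) \<le> 0"
      by (simp add: algebra_simps)
    then have "((y - p) \<bullet> q)\<^sup>2 \<le> 0"
      using qq by (simp add: t_def power2_eq_square divide_le_0_iff)
    then show ?thesis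
      by simp
  qed auto
  with p(1) show ?thesis
    by blast
qed

lemma riesz_representation:
  fixes \<phi> :: "'a::{real_inner,banach} \<Rightarrow> real"
  assumes "bounded_linear \<phi>"
  shows "\<exists>u. \<forall>x. \<phi> x = u \<bullet> x"
proof (cases "\<forall>x. \<phi> x = 0")
  case True
  then show ?thesis
    by (intro exI[of _ 0]) simp
next
  case False
  then obtain y where y: "\<phi> y \<noteq> 0"
    by blast
  interpret bounded_linear \<phi> by fact
  define M where "M = \<phi> -` {0}"
  have "closed M"
    unfolding M_def by (intro closed_vimage closed_singleton continuous_on continuous_on_id)
  moreover have "subspace M"
    by (rule subspaceI) (auto simp: M_def add scaleR zero)
  ultimately obtain p where p: "p \<in> M" "\<And>q. q \<in> M \<Longrightarrow> (y - p) \<bullet> q = 0"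
    using orthogonal_projection_closed_subspace by blast
  define w where "w = y - p"
  have w: "\<phi> w \<noteq> 0"
    using p(1) y by (simp add: w_def diff M_def)
  then have w0: "w \<bullet> w \<noteq> 0"
    using zero by auto
  have "\<phi> x = ((\<phi> w / (w \<bullet> w)) *\<^sub>R w) \<bullet> x" for x
  proof -
    have "x - (\<phi> x / \<phi> w) *\<^sub>R w \<in> M"
      using w by (simp add: M_def diff scaleR)
    then have "w \<bullet> (x - (\<phi> x / \<phi> w) *\<^sub>R w) = 0"
      unfolding w_def by (rule p(2))
    then show ?thesis
      using w w0 by (simp add: inner_diff field_simps)
  qed
  then show ?thesis
    by blast
qed

lemma ex_adjoint:
  fixes T :: "'a::{real_inner,banach} \<Rightarrow>\<^sub>L 'a"
  shows "\<exists>U::'a \<Rightarrow>\<^sub>L 'a. \<forall>x y. U x \<bullet> y = x \<bullet> T y"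
proof -
  have "\<exists>u. \<forall>y. x \<bullet> T y = u \<bullet> y" for x
    by (rule riesz_representation) (rule bounded_linear_intros)+
  then obtain U where U: "\<And>x y. x \<bullet> T y = U x \<bullet> y"
    by metis
  have "bounded_linear U"
  proof (rule bounded_linear_intro)
    show "U (x + y) = U x + U y" for x y
      by (rule vector_eq_rdot[THEN iffD1]) (simp add: inner_add_left flip: U)
    show "U (r *\<^sub>R x) = r *\<^sub>R U x" for r x
      by (rule vector_eq_rdot[THEN iffD1]) (simp flip: U)
    show "norm (U x) \<le> norm x * norm T" for x
    proof (cases "U x = 0")
      case False
      have "norm (U x) * norm (U x) = x \<bullet> T (U x)"
        by (simp add: U power2_norm_eq_inner flip: power2_eq_square)
      also have "\<dots> \<le> norm x * (norm T * norm (U x))"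
        by (rule order_trans[OF norm_cauchy_schwarz mult_left_mono[OF norm_blinfun]]) auto
      finally show ?thesis
        using False by simp
    qed auto
  qed
  then show ?thesis
    by (intro exI[of _ "Blinfun U"]) (simp add: bounded_linear_Blinfun_apply U)
qed

text \<open>
  On a real Hilbert space, symmetry does not follow from a nonnegative quadratic form and is part
  of the notion.
\<close>

definition nonneg_form :: "('a::real_inner \<Rightarrow>\<^sub>L 'a) \<Rightarrow> bool" where
  "nonneg_form A \<longleftrightarrow> (\<forall>x y. A x \<bullet> y = x \<bullet> A y) \<and> (\<forall>x. A x \<bullet> x \<ge> 0)"

text \<open>
  A form of the Cauchy--Schwarz inequality for the semi-inner product \<open>(u, v) \<mapsto> A u \<bullet> v\<close>: expand
  the quadratic form at \<open>x - A x\<close>.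
\<close>

lemma nonneg_form_norm_sq_le:
  fixes A :: "'a::real_inner \<Rightarrow>\<^sub>L 'a"
  assumes A: "nonneg_form A" and n: "norm A \<le> 1"
  shows "(norm (A x))\<^sup>2 \<le> A x \<bullet> x"
proof -
  have sym: "A u \<bullet> v = u \<bullet> A v" and pos: "A u \<bullet> u \<ge> 0" for u v
    using A by (auto simp: nonneg_form_def)
  have "A (A x) \<bullet> A x \<le> norm (A (A x)) * norm (A x)"
    by (rule norm_cauchy_schwarz)
  also have "\<dots> \<le> norm (A x) * norm (A x)"
    using norm_blinfun[of A "A x"] n
    by (intro mult_right_mono order_trans[OF norm_blinfun]) (auto simp: mult_left_le_one_le)
  finally have *: "A (A x) \<bullet> A x \<le> A x \<bullet> A x"
    by (simp add: power2_norm_eq_inner flip: power2_eq_square)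
  have "0 \<le> A (x - A x) \<bullet> (x - A x)"
    by (rule pos)
  also have "\<dots> = A x \<bullet> x - 2 * (A x \<bullet> A x) + A (A x) \<bullet> A x"
    by (simp add: blinfun.diff_right inner_diff sym[of "A x" x] algebra_simps)
  finally show ?thesis
    using * by (simp add: power2_norm_eq_inner)
qed

lemma nonneg_form_kernel:
  fixes A :: "'a::real_inner \<Rightarrow>\<^sub>L 'a"
  assumes A: "nonneg_form A" and z: "A x \<bullet> x = 0"
  shows "A x = 0"
proof (cases "A = 0")
  case False
  define B where "B = (1 / norm A) *\<^sub>R A"
  have "nonneg_form B"
    using A by (auto simp: B_def nonneg_form_def blinfun.scaleR_left inner_commute)
  moreover have "norm B \<le> 1"
    using False by (simp add: B_def)
  ultimately have "(norm (B x))\<^sup>2 \<le> B x \<bullet> x"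
    by (rule nonneg_form_norm_sq_le)
  then show ?thesis
    using z False by (simp add: B_def blinfun.scaleR_left)
qed auto

text \<open>
  If \<open>norm B \<le> 1\<close>, the iteration \<open>Y \<mapsto> (B + Y\<^sup>2) / 2\<close> started at \<open>0\<close> is dominated term by term by
  the scalar iteration with \<open>B = 1\<close>, which increases to \<open>1\<close>; its limit \<open>Y\<close> satisfies
  \<open>(1 - Y)\<^sup>2 = 1 - B\<close>.
\<close>

primrec root_iter :: "('a::real_normed_vector \<Rightarrow>\<^sub>L 'a) \<Rightarrow> nat \<Rightarrow> 'a \<Rightarrow>\<^sub>L 'a" where
  "root_iter B 0 = 0"
| "root_iter B (Suc n) = (1/2) *\<^sub>R (B + (root_iter B n o\<^sub>L root_iter B n))"

primrec root_majorant :: "nat \<Rightarrow> real" where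
  "root_majorant 0 = 0"
| "root_majorant (Suc n) = (1 + (root_majorant n)\<^sup>2) / 2"

lemma root_majorant_bounds: "0 \<le> root_majorant n" "root_majorant n \<le> 1"
proof -
  have "0 \<le> root_majorant n \<and> root_majorant n \<le> 1"
    by (induction n) (auto simp: power_le_one)
  then show "0 \<le> root_majorant n" "root_majorant n \<le> 1"
    by auto
qed

lemma norm_root_iter_le:
  assumes "norm B \<le> 1"
  shows "norm (root_iter B n) \<le> root_majorant n"
proof (induction n)
  case (Suc n)
  have "norm (root_iter B n o\<^sub>L root_iter B n) \<le> (root_majorant n)\<^sup>2"
    unfolding power2_eq_square
    by (rule order_trans[OF norm_blinfun_compose mult_mono[OF Suc Suc]]) (auto simp: root_majorant_bounds)
  then have "norm (B + (root_iter B n o\<^sub>L root_iter B n)) \<le> 1 + (root_majorant n)\<^sup>2"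
    using assms by norm
  then show ?case
    by simp
qed auto

lemma norm_root_iter_diff_le:
  assumes B: "norm B \<le> 1"
  shows "norm (root_iter B (Suc n) - root_iter B n) \<le> root_majorant (Suc n) - root_majorant n"
proof (induction n)
  case 0
  then show ?case
    using B by simp
next
  case (Suc n)
  let ?Y = "root_iter B (Suc n)" and ?Z = "root_iter B n"
  let ?y = "root_majorant (Suc n)" and ?z = "root_majorant n"
  have y: "norm ?Y \<le> ?y" "norm ?Z \<le> ?z"
    using norm_root_iter_le[OF B] by blast+
  have "root_iter B (Suc (Suc n)) - ?Y = (1/2) *\<^sub>R ((?Y o\<^sub>L ?Y) - (?Z o\<^sub>L ?Z))"
    by (simp add: algebra_simps del: root_iter.simps) (simp add: algebra_simps)
  also have "(?Y o\<^sub>L ?Y) - (?Z o\<^sub>L ?Z) = (?Y o\<^sub>L (?Y - ?Z)) + ((?Y - ?Z) o\<^sub>L ?Z)"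
    by (rule blinfun_eqI) (simp add: blinfun.diff_left blinfun.diff_right blinfun.add_left del: root_iter.simps)
  finally have "norm (root_iter B (Suc (Suc n)) - ?Y)
      = norm ((?Y o\<^sub>L (?Y - ?Z)) + ((?Y - ?Z) o\<^sub>L ?Z)) / 2"
    by simp
  also have "\<dots> \<le> (norm ?Y * norm (?Y - ?Z) + norm (?Y - ?Z) * norm ?Z) / 2"
    by (intro divide_right_mono order_trans[OF norm_triangle_ineq] add_mono norm_blinfun_compose) auto
  also have "\<dots> \<le> (?y * (?y - ?z) + (?y - ?z) * ?z) / 2"
    using y Suc root_majorant_bounds order_trans[OF norm_ge_zero Suc]
    by (intro divide_right_mono add_mono mult_mono) auto
  also have "\<dots> = root_majorant (Suc (Suc n)) - ?y"
    by (simp add: power2_eq_square algebra_simps add_divide_distrib diff_divide_distrib)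
  finally show ?case .
qed

lemma root_iter_convergent:
  fixes B :: "'a::banach \<Rightarrow>\<^sub>L 'a"
  assumes B: "norm B \<le> 1"
  shows "convergent (root_iter B)"
proof -
  have step: "root_majorant n \<le> root_majorant (Suc n)" for n
    using zero_le_power2[of "1 - root_majorant n"] by (simp add: power2_eq_square algebra_simps)
  have "incseq root_majorant"
    by (intro incseq_SucI step)
  moreover have "bdd_above (range root_majorant)"
    using root_majorant_bounds(2) by (auto intro!: bdd_aboveI[of _ 1])
  ultimately have "convergent root_majorant"
    using LIMSEQ_incseq_SUP convergentI by blast
  then have "summable (\<lambda>n. root_majorant (Suc n) - root_majorant n)"
    using telescope_sums[of root_majorant] unfolding convergent_def summable_def by blast
  then have "summable (\<lambda>n. norm (root_iter B (Suc n) - root_iter B n))"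
    by (rule summable_comparison_test'[where N = 0]) (use norm_root_iter_diff_le[OF B] in \<open>simp del: root_iter.simps root_majorant.simps\<close>)
  then have "summable (\<lambda>n. root_iter B (Suc n) - root_iter B n)"
    by (rule summable_norm_cancel)
  then obtain s where "(\<lambda>n. root_iter B (Suc n) - root_iter B n) sums s"
    by (auto simp: summable_def)
  then have "(\<lambda>n. root_iter B n) \<longlonglongrightarrow> s"
    by (simp add: sums_def sum_lessThan_telescope del: root_iter.simps(2))
  then show ?thesis
    by (rule convergentI)
qed

lemma blinfun_compose_scaleR_left': "(r *\<^sub>R A) o\<^sub>L B = r *\<^sub>R (A o\<^sub>L B)"
  by (rule blinfun_eqI) (simp add: blinfun.scaleR_left)

lemma blinfun_compose_scaleR_right': "A o\<^sub>L (r *\<^sub>R B) = r *\<^sub>R (A o\<^sub>L B)"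
  by (rule blinfun_eqI) (simp add: blinfun.scaleR_left blinfun.scaleR_right)

text \<open>
  The square root is \<open>1 - Y\<close>, where \<open>Y\<close> is the limit of the iteration for \<open>B = 1 - A\<close>. As a limit of
  polynomials in \<open>A\<close> it commutes with everything that commutes with \<open>A\<close>; uniqueness of the root and
  its complex linearity come from this property.
\<close>

lemma ex_sqrt_contraction:
  fixes A :: "'a::{real_inner,banach} \<Rightarrow>\<^sub>L 'a"
  assumes A: "nonneg_form A" and n: "norm A \<le> 1"
  shows "\<exists>P. nonneg_form P \<and> P o\<^sub>L P = A \<and> (\<forall>Q. Q o\<^sub>L A = A o\<^sub>L Q \<longrightarrow> Q o\<^sub>L P = P o\<^sub>L Q)"
proof -
  define B where "B = id_blinfun - A"
  have sym: "A u \<bullet> v = u \<bullet> A v" and pos: "A u \<bullet> u \<ge> 0" for u v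
    using A by (auto simp: nonneg_form_def)
  have nB: "norm B \<le> 1"
  proof (rule norm_blinfun_bound)
    fix x
    have "(norm (B x))\<^sup>2 = (norm x)\<^sup>2 - 2 * (A x \<bullet> x) + (norm (A x))\<^sup>2"
      by (simp add: B_def blinfun.diff_left power2_norm_eq_inner inner_diff inner_commute algebra_simps)
    also have "\<dots> \<le> (norm x)\<^sup>2"
      using nonneg_form_norm_sq_le[OF A n, of x] pos[of x] by simp
    finally show "norm (B x) \<le> 1 * norm x"
      by (simp add: power2_le_iff_abs_le)
  qed auto
  obtain Y where Y: "root_iter B \<longlonglongrightarrow> Y"
    using root_iter_convergent[OF nB] by (auto simp: convergent_def)
  have lim: "(\<lambda>n. root_iter B n x) \<longlonglongrightarrow> Y x" for x
    by (intro tendsto_intros Y)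
  have nY: "norm Y \<le> 1"
    by (rule LIMSEQ_le_const2[OF tendsto_norm[OF Y]])
      (meson norm_root_iter_le[OF nB] root_majorant_bounds(2) order_trans)
  have eq: "2 *\<^sub>R Y = B + (Y o\<^sub>L Y)"
  proof (rule blinfun_eqI)
    fix x
    have "(\<lambda>n. 2 *\<^sub>R root_iter B (Suc n) x) \<longlonglongrightarrow> 2 *\<^sub>R Y x"
      by (intro tendsto_intros LIMSEQ_Suc[OF Y])
    moreover have "(\<lambda>n. B x + root_iter B n (root_iter B n x)) \<longlonglongrightarrow> B x + Y (Y x)"
      by (intro tendsto_intros Y)
    moreover have "2 *\<^sub>R root_iter B (Suc n) x = B x + root_iter B n (root_iter B n x)" for n
      by (simp add: blinfun.scaleR_left blinfun.add_left)
    ultimately have "2 *\<^sub>R Y x = B x + Y (Y x)"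
      by (simp add: LIMSEQ_unique)
    then show "(2 *\<^sub>R Y) x = (B + (Y o\<^sub>L Y)) x"
      by (simp add: blinfun.scaleR_left blinfun.add_left)
  qed
  have symB: "B u \<bullet> v = u \<bullet> B v" for u v
    by (simp add: B_def blinfun.diff_left inner_diff sym)
  have "root_iter B n u \<bullet> v = u \<bullet> root_iter B n v" for n u v
    by (induction n arbitrary: u v)
      (auto simp: blinfun.scaleR_left blinfun.add_left inner_add symB)
  then have "(\<lambda>n. root_iter B n u \<bullet> v) \<longlonglongrightarrow> u \<bullet> Y v" for u v
    by (simp add: tendsto_inner[OF tendsto_const lim])
  then have symY: "Y u \<bullet> v = u \<bullet> Y v" for u v
    by (rule LIMSEQ_unique[OF tendsto_inner[OF lim tendsto_const]])
  define P where "P = id_blinfun - Y"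
  have "nonneg_form P"
    unfolding nonneg_form_def
  proof (intro conjI allI)
    show "P u \<bullet> v = u \<bullet> P v" for u v
      by (simp add: P_def blinfun.diff_left inner_diff symY)
    fix u
    have "Y u \<bullet> u \<le> norm (Y u) * norm u"
      by (rule norm_cauchy_schwarz)
    also have "\<dots> \<le> norm u * norm u"
      using nY by (intro mult_right_mono order_trans[OF norm_blinfun]) (auto simp: mult_left_le_one_le)
    finally show "P u \<bullet> u \<ge> 0"
      by (simp add: P_def blinfun.diff_left inner_diff power2_norm_eq_inner flip: power2_eq_square)
  qed
  moreover have "P o\<^sub>L P = A"
  proof (rule blinfun_eqI)
    fix x
    have "2 *\<^sub>R Y x = B x + Y (Y x)"
      using arg_cong[OF eq, of "\<lambda>F. blinfun_apply F x"] by (simp add: blinfun.scaleR_left blinfun.add_left)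
    then have "Y (Y x) = 2 *\<^sub>R Y x - x + A x"
      by (simp add: B_def blinfun.diff_left algebra_simps)
    then show "(P o\<^sub>L P) x = A x"
      by (simp add: P_def blinfun.diff_left blinfun.diff_right scaleR_2)
  qed
  moreover have "Q o\<^sub>L P = P o\<^sub>L Q" if "Q o\<^sub>L A = A o\<^sub>L Q" for Q
  proof (rule blinfun_eqI)
    fix x
    have "Q (A x) = A (Q x)" for x
      using arg_cong[OF that, of "\<lambda>F. blinfun_apply F x"] by simp
    then have BQ: "Q (B x) = B (Q x)" for x
      by (simp add: B_def blinfun.diff_left blinfun.diff_right)
    have "Q (root_iter B n x) = root_iter B n (Q x)" for n x
      by (induction n arbitrary: x)
        (auto simp: blinfun.scaleR_left blinfun.add_left blinfun.scaleR_right blinfun.add_right BQ)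
    moreover have "(\<lambda>n. Q (root_iter B n x)) \<longlonglongrightarrow> Q (Y x)"
      by (intro tendsto_intros Y)
    ultimately have "Q (Y x) = Y (Q x)"
      using lim[of "Q x"] by (simp add: LIMSEQ_unique)
    then show "(Q o\<^sub>L P) x = (P o\<^sub>L Q) x"
      by (simp add: P_def blinfun.diff_left blinfun.diff_right)
  qed
  ultimately show ?thesis
    by blast
qed

lemma ex_sqrt:
  fixes A :: "'a::{real_inner,banach} \<Rightarrow>\<^sub>L 'a"
  assumes A: "nonneg_form A"
  shows "\<exists>P. nonneg_form P \<and> P o\<^sub>L P = A \<and> (\<forall>Q. Q o\<^sub>L A = A o\<^sub>L Q \<longrightarrow> Q o\<^sub>L P = P o\<^sub>L Q)"
proof (cases "A = 0")
  case True
  then show ?thesis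
    by (intro exI[of _ 0]) (auto simp: nonneg_form_def intro!: blinfun_eqI)
next
  case False
  define c where "c = norm A"
  have c: "c > 0"
    using False by (simp add: c_def)
  define A' where "A' = (1 / c) *\<^sub>R A"
  have "nonneg_form A'"
    using A c by (auto simp: A'_def nonneg_form_def blinfun.scaleR_left inner_commute)
  moreover have "norm A' \<le> 1"
    using c by (simp add: A'_def c_def)
  ultimately obtain P where P: "nonneg_form P" "P o\<^sub>L P = A'"
    "\<And>Q. Q o\<^sub>L A' = A' o\<^sub>L Q \<Longrightarrow> Q o\<^sub>L P = P o\<^sub>L Q"
    using ex_sqrt_contraction by blast
  show ?thesis
  proof (intro exI[of _ "sqrt c *\<^sub>R P"] conjI allI impI)
    show "nonneg_form (sqrt c *\<^sub>R P)"
      using P(1) c by (auto simp: nonneg_form_def blinfun.scaleR_left inner_commute)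
    have "(sqrt c *\<^sub>R P) o\<^sub>L (sqrt c *\<^sub>R P) = c *\<^sub>R (P o\<^sub>L P)"
      using c by (intro blinfun_eqI) (simp add: blinfun.scaleR_left blinfun.scaleR_right)
    also have "\<dots> = A"
      using c by (simp add: P(2) A'_def)
    finally show "(sqrt c *\<^sub>R P) o\<^sub>L (sqrt c *\<^sub>R P) = A" .
    fix Q
    assume "Q o\<^sub>L A = A o\<^sub>L Q"
    then have "Q o\<^sub>L A' = A' o\<^sub>L Q"
      unfolding A'_def by (metis blinfun_compose_scaleR_left' blinfun_compose_scaleR_right')
    then show "Q o\<^sub>L (sqrt c *\<^sub>R P) = (sqrt c *\<^sub>R P) o\<^sub>L Q"
      by (simp only: blinfun_compose_scaleR_left' blinfun_compose_scaleR_right' P(3))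
  qed
qed

text \<open>
  For commuting roots and \<open>D = P - Q\<close> one has \<open>(P + Q) D = P\<^sup>2 - Q\<^sup>2 = 0\<close>. As both forms are nonnegative,
  \<open>P\<close> and \<open>Q\<close>, and hence \<open>D\<close>, vanish on the range of \<open>D\<close>. So \<open>D\<^sup>2 = 0\<close>, and \<open>D = 0\<close> by symmetry.
\<close>

lemma sqrt_unique:
  fixes P Q :: "'a::{real_inner,banach} \<Rightarrow>\<^sub>L 'a"
  assumes P: "nonneg_form P" and Q: "nonneg_form Q" and eq: "P o\<^sub>L P = Q o\<^sub>L Q"
    and comm: "Q o\<^sub>L P = P o\<^sub>L Q"
  shows "P = Q"
proof (rule blinfun_eqI)
  fix x
  have cQP: "Q (P u) = P (Q u)" and eq': "P (P u) = Q (Q u)" for u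
    using arg_cong[OF comm, of "\<lambda>F. blinfun_apply F u"] arg_cong[OF eq, of "\<lambda>F. blinfun_apply F u"]
    by simp_all
  define D where "D = P - Q"
  have symD: "D u \<bullet> v = u \<bullet> D v" for u v
    using P Q by (simp add: D_def nonneg_form_def blinfun.diff_left inner_diff)
  define y where "y = D x"
  have "P y + Q y = 0"
    by (simp add: y_def D_def blinfun.diff_left blinfun.diff_right cQP eq')
  then have "P y \<bullet> y + Q y \<bullet> y = 0"
    by (metis inner_add_left inner_zero_left)
  moreover have "P y \<bullet> y \<ge> 0" "Q y \<bullet> y \<ge> 0"
    using P Q by (auto simp: nonneg_form_def)
  ultimately have "P y \<bullet> y = 0" "Q y \<bullet> y = 0"
    by linarith+
  then have "P y = 0" "Q y = 0"
    by (auto intro: nonneg_form_kernel P Q)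
  then have "D y = 0"
    by (simp add: D_def blinfun.diff_left)
  then have "D x \<bullet> D x = 0"
    using symD[of "D x" x] by (simp add: y_def)
  then show "P x = Q x"
    by (simp add: D_def blinfun.diff_left)
qed

text \<open>
  Douglas factorization. The assignment \<open>P x \<mapsto> T x\<close> is a contraction on the range of \<open>P\<close>; it
  extends to the closure of the range by continuity and by \<open>0\<close> to the orthogonal complement. The
  relation \<open>G y w\<close> in the proof is the graph of this extension.
\<close>

lemma factor_through_dominating:
  fixes T P :: "'a::{real_inner,banach} \<Rightarrow>\<^sub>L 'a"
  assumes le: "\<And>x. norm (T x) \<le> norm (P x)"
  shows "\<exists>U. norm U \<le> 1 \<and> U o\<^sub>L P = T"
proof -
  define N where "N = closure (range P)"
  have "subspace (range P)"
    by (intro linear_subspace_image subspace_UNIV bounded_linear.linear blinfun.bounded_linear_right)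
  then have N: "subspace N" "closed N"
    by (auto simp: N_def subspace_closure)
  define G where "G y w \<longleftrightarrow> (\<exists>p u. (\<forall>x. (y - p) \<bullet> P x = 0) \<and> (\<lambda>n. P (u n)) \<longlonglongrightarrow> p \<and> (\<lambda>n. T (u n)) \<longlonglongrightarrow> w)"
    for y w
  have GP: "G (P x) (T x)" for x
    unfolding G_def by (rule exI[of _ "P x"], rule exI[of _ "\<lambda>_. x"]) simp
  have Gi: "G y w" if "\<forall>x. (y - p) \<bullet> P x = 0" "(\<lambda>n. P (u n)) \<longlonglongrightarrow> p" "(\<lambda>n. T (u n)) \<longlonglongrightarrow> w" for y w p u
    unfolding G_def using that by blast
  have Ge: thesis if "G y w" "\<And>p u. \<forall>x. (y - p) \<bullet> P x = 0 \<Longrightarrow> (\<lambda>n. P (u n)) \<longlonglongrightarrow> p \<Longrightarrow> (\<lambda>n. T (u n)) \<longlonglongrightarrow> w \<Longrightarrow> thesis"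
    for y w thesis
    using that unfolding G_def by blast
  have Gadd: "G (y + y') (w + w')" if "G y w" "G y' w'" for y w y' w'
  proof -
    from that(1) obtain p u where
      1: "\<forall>x. (y - p) \<bullet> P x = 0" "(\<lambda>n. P (u n)) \<longlonglongrightarrow> p" "(\<lambda>n. T (u n)) \<longlonglongrightarrow> w"
      by (rule Ge)
    from that(2) obtain p' u' where
      2: "\<forall>x. (y' - p') \<bullet> P x = 0" "(\<lambda>n. P (u' n)) \<longlonglongrightarrow> p'" "(\<lambda>n. T (u' n)) \<longlonglongrightarrow> w'"
      by (rule Ge)
    show ?thesis
    proof (rule Gi[of _ "p + p'" "\<lambda>n. u n + u' n"])
      show "\<forall>x. (y + y' - (p + p')) \<bullet> P x = 0"
        using 1(1) 2(1) by (simp add: inner_diff inner_add)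
    qed (use tendsto_add[OF 1(2) 2(2)] tendsto_add[OF 1(3) 2(3)] in \<open>simp_all add: blinfun.add_right\<close>)
  qed
  have Gscale: "G (r *\<^sub>R y) (r *\<^sub>R w)" if "G y w" for r y w
  proof -
    from that obtain p u where
      1: "\<forall>x. (y - p) \<bullet> P x = 0" "(\<lambda>n. P (u n)) \<longlonglongrightarrow> p" "(\<lambda>n. T (u n)) \<longlonglongrightarrow> w"
      by (rule Ge)
    show ?thesis
    proof (rule Gi[of _ "r *\<^sub>R p" "\<lambda>n. r *\<^sub>R u n"])
      show "\<forall>x. (r *\<^sub>R y - r *\<^sub>R p) \<bullet> P x = 0"
        using 1(1) by (simp add: inner_diff)
    qed (use tendsto_scaleR[OF tendsto_const 1(2)] tendsto_scaleR[OF tendsto_const 1(3)]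
        in \<open>simp_all add: blinfun.scaleR_right\<close>)
  qed
  have Gnorm: "norm w \<le> norm y" if "G y w" for y w
  proof -
    from that obtain p u where
      pu: "\<forall>x. (y - p) \<bullet> P x = 0" "(\<lambda>n. P (u n)) \<longlonglongrightarrow> p" "(\<lambda>n. T (u n)) \<longlonglongrightarrow> w"
      by (rule Ge)
    have "norm w \<le> norm p"
      by (rule LIMSEQ_le[OF tendsto_norm[OF pu(3)] tendsto_norm[OF pu(2)]]) (auto simp: le)
    moreover have "(y - p) \<bullet> p = 0"
      using LIMSEQ_unique[OF tendsto_inner[OF tendsto_const[of "y - p"] pu(2)], of 0] pu(1) by simp
    then have "(norm y)\<^sup>2 = (norm p)\<^sup>2 + (norm (y - p))\<^sup>2"
      by (simp add: power2_norm_eq_inner inner_diff inner_commute algebra_simps)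
    then have "(norm p)\<^sup>2 \<le> (norm y)\<^sup>2"
      by simp
    then have "norm p \<le> norm y"
      by (rule power2_le_imp_le) simp
    ultimately show ?thesis
      by simp
  qed
  have Gunique: "w = w'" if "G y w" "G y w'" for y w w'
    using Gnorm[OF Gadd[OF that(1) Gscale[OF that(2), of "- 1"]]] by simp
  have Gex: "\<exists>w. G y w" for y
  proof -
    obtain p where p: "p \<in> N" "\<And>q. q \<in> N \<Longrightarrow> (y - p) \<bullet> q = 0"
      using orthogonal_projection_closed_subspace[OF N(2,1)] by blast
    then obtain v where v: "\<And>n. v n \<in> range P" "v \<longlonglongrightarrow> p"
      unfolding N_def closure_sequential by blast
    then obtain u where u: "\<And>n. v n = P (u n)"
      unfolding image_iff by metis
    have lim: "(\<lambda>n. P (u n)) \<longlonglongrightarrow> p"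
      using v(2) by (simp flip: u)
    have "Cauchy (\<lambda>n. T (u n))"
    proof (rule metric_CauchyI)
      fix e :: real
      assume "0 < e"
      then obtain M where M: "\<And>m n. m \<ge> M \<Longrightarrow> n \<ge> M \<Longrightarrow> dist (P (u m)) (P (u n)) < e"
        using metric_CauchyD[OF LIMSEQ_imp_Cauchy[OF lim]] by meson
      have "dist (T (u m)) (T (u n)) \<le> dist (P (u m)) (P (u n))" for m n
        using le[of "u m - u n"] by (simp add: dist_norm blinfun.diff_right)
      with M show "\<exists>M. \<forall>m\<ge>M. \<forall>n\<ge>M. dist (T (u m)) (T (u n)) < e"
        by (meson order_le_less_trans)
    qed
    then obtain w where "(\<lambda>n. T (u n)) \<longlonglongrightarrow> w"
      using Cauchy_convergent convergent_def by blast
    moreover have "(y - p) \<bullet> P x = 0" for x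
      unfolding N_def by (intro p(2)[unfolded N_def] subsetD[OF closure_subset] rangeI)
    ultimately show ?thesis
      unfolding G_def using lim by blast
  qed
  then obtain U where U: "\<And>y. G y (U y)"
    by metis
  have bl: "bounded_linear U"
  proof (rule bounded_linear_intro)
    show "U (x + y) = U x + U y" for x y
      by (rule Gunique[OF U Gadd[OF U U]])
    show "U (r *\<^sub>R x) = r *\<^sub>R U x" for r x
      by (rule Gunique[OF U Gscale[OF U]])
    show "norm (U x) \<le> norm x * 1" for x
      using Gnorm[OF U] by simp
  qed
  show ?thesis
  proof (intro exI[of _ "Blinfun U"] conjI)
    show "norm (Blinfun U) \<le> 1"
      by (rule norm_blinfun_bound) (auto simp: bounded_linear_Blinfun_apply[OF bl] Gnorm[OF U])
    show "Blinfun U o\<^sub>L P = T"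
      by (rule blinfun_eqI) (simp add: bounded_linear_Blinfun_apply[OF bl] Gunique[OF U GP])
  qed
qed

section \<open>Completeness of the space of square-integrable functions\<close>

lemma L2_cases:
  obtains u where "square_integrable u" "F = abs_L2 u"
proof -
  obtain u where "l2_rel u u" "F = abs_L2 u"
    by (induct F rule: L2.abs_induct) blast
  then show ?thesis
    using that by (auto simp: l2_rel_def)
qed

lemma l2_rel_refl: "l2_rel u u \<longleftrightarrow> square_integrable u"
  by (auto simp: l2_rel_def)

lemma abs_L2_eq_iff:
  assumes "square_integrable u" "square_integrable v"
  shows "abs_L2 u = abs_L2 v \<longleftrightarrow> (AE t in lborel. u t = v t)"
  using assms Quotient3_rel[OF Quotient3_L2, of u v] by (simp add: l2_rel_def)

lemma abs_L2_add:
  assumes "square_integrable u" "square_integrable v"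
  shows "abs_L2 u + abs_L2 v = abs_L2 (\<lambda>t. u t + v t)"
  using assms by (simp add: plus_L2.abs_eq l2_rel_refl)

lemma abs_L2_scaleC:
  assumes "square_integrable u"
  shows "c *\<^sub>C abs_L2 u = abs_L2 (\<lambda>t. c * u t)"
  using assms by (simp add: scaleC.abs_eq l2_rel_refl)

lemma square_integrable_diff:
  assumes "square_integrable u" "square_integrable v"
  shows "square_integrable (\<lambda>t. u t - v t)"
  using square_integrable_add[OF assms(1) square_integrable_mult_const[OF assms(2), of "-1"]] by simp

lemma abs_L2_diff:
  assumes "square_integrable u" "square_integrable v"
  shows "abs_L2 u - abs_L2 v = abs_L2 (\<lambda>t. u t - v t)"
  using assms abs_L2_add[OF assms(1) square_integrable_mult_const[OF assms(2), of "-1"]]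
  by (simp add: minus_L2_def uminus_L2_def abs_L2_scaleC)

lemma cinner_abs_L2:
  assumes "square_integrable u" "square_integrable v"
  shows "cinner (abs_L2 u) (abs_L2 v) = (LINT t|lborel. u t * cnj (v t))"
  using assms by (simp add: cinner.abs_eq l2_rel_refl)

lemma norm_abs_L2_sq:
  assumes "square_integrable u"
  shows "(norm (abs_L2 u))\<^sup>2 = (LINT t|lborel. (cmod (u t))\<^sup>2)"
proof -
  have "cinner (abs_L2 u) (abs_L2 u) = (LINT t|lborel. complex_of_real ((cmod (u t))\<^sup>2))"
    by (simp add: cinner_abs_L2 assms complex_norm_square del: of_real_power)
  then show ?thesis
    by (simp add: norm_L2_sq del: of_real_power)
qed

lemma nn_integral_cmod_sq:
  assumes "square_integrable u"
  shows "(\<integral>\<^sup>+t. ennreal ((cmod (u t))\<^sup>2) \<partial>lborel) = ennreal ((norm (abs_L2 u))\<^sup>2)"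
  using assms unfolding norm_abs_L2_sq[OF assms]
  by (intro nn_integral_eq_integral) (auto simp: square_integrable_def)

text \<open>
  Riesz--Fischer. Along a subsequence \<open>u k\<close> whose increments satisfy
  \<open>norm (u (k + 1) - u k) \<le> 4\<^sup>-\<^sup>k\<close>, the weighted sum of \<open>4\<^sup>k \<bar>u (k + 1) - u k\<bar>\<^sup>2\<close> has finite
  integral, so almost everywhere the increments are \<open>O(2\<^sup>-\<^sup>k)\<close> and \<open>u k\<close> converges pointwise.
  Fatou's lemma identifies the pointwise limit as the limit in norm.
\<close>

lemma fast_Cauchy_AE_convergent:
  fixes u :: "nat \<Rightarrow> real^'d::finite \<Rightarrow> complex"
  assumes u: "\<And>k. square_integrable (u k)"
    and fast: "\<And>k. norm (abs_L2 (u (Suc k)) - abs_L2 (u k)) \<le> (1/4) ^ k"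
  shows "AE t in lborel. convergent (\<lambda>k. u k t)"
proof -
  define g where "g k t = u (Suc k) t - u k t" for k t
  have g: "square_integrable (g k)" for k
    unfolding g_def by (intro square_integrable_diff u)
  have [measurable]: "g k \<in> borel_measurable lborel" for k
    using g by (simp add: square_integrable_def)
  have "(\<integral>\<^sup>+t. ennreal (4 ^ k * (cmod (g k t))\<^sup>2) \<partial>lborel) \<le> ennreal ((1/4) ^ k)" for k
  proof -
    have "(norm (abs_L2 (g k)))\<^sup>2 \<le> ((1/4) ^ k)\<^sup>2"
      using fast[of k] unfolding g_def by (intro power_mono) (simp_all add: abs_L2_diff u)
    then have "4 ^ k * (norm (abs_L2 (g k)))\<^sup>2 \<le> 4 ^ k * ((1/4) ^ k)\<^sup>2"
      by (intro mult_left_mono) auto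
    also have "\<dots> = (1/4) ^ k"
      by (simp add: power2_eq_square power_one_over field_simps)
    finally have "ennreal (4 ^ k * (norm (abs_L2 (g k)))\<^sup>2) \<le> ennreal ((1/4) ^ k)"
      by (rule ennreal_leI)
    moreover have "(\<integral>\<^sup>+t. ennreal (4 ^ k * (cmod (g k t))\<^sup>2) \<partial>lborel)
        = ennreal (4 ^ k) * (\<integral>\<^sup>+t. ennreal ((cmod (g k t))\<^sup>2) \<partial>lborel)"
      by (subst ennreal_mult) (auto intro!: nn_integral_cmult)
    ultimately show ?thesis
      by (simp only: nn_integral_cmod_sq[OF g] ennreal_mult zero_le_power2 zero_le_power zero_le_numeral)
  qed
  then have "(\<integral>\<^sup>+t. (\<Sum>k. ennreal (4 ^ k * (cmod (g k t))\<^sup>2)) \<partial>lborel) \<le> (\<Sum>k. ennreal ((1/4) ^ k))"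
    by (subst nn_integral_suminf) (auto intro!: suminf_le)
  also have "\<dots> < \<infinity>"
    by (subst suminf_ennreal2) (auto intro!: summable_geometric)
  finally have "AE t in lborel. (\<Sum>k. ennreal (4 ^ k * (cmod (g k t))\<^sup>2)) \<noteq> \<infinity>"
    by (intro nn_integral_noteq_infinite) auto
  then show ?thesis
  proof eventually_elim
    fix t
    define s where "s = (\<Sum>k. ennreal (4 ^ k * (cmod (g k t))\<^sup>2))"
    assume "(\<Sum>k. ennreal (4 ^ k * (cmod (g k t))\<^sup>2)) \<noteq> \<infinity>"
    then obtain c where c: "s = ennreal c" "c \<ge> 0"
      unfolding s_def[symmetric] by (cases s) auto
    have bound: "norm (g k t) \<le> sqrt c * (1/2) ^ k" for k
    proof -
      have "ennreal (4 ^ k * (cmod (g k t))\<^sup>2) \<le> s"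
        unfolding s_def by (rule order_trans[OF eq_refl sum_le_suminf[of _ "{k}"]]) simp_all
      then have "4 ^ k * (cmod (g k t))\<^sup>2 \<le> c"
        using c by simp
      moreover have "(2 ^ k * cmod (g k t))\<^sup>2 = 4 ^ k * (cmod (g k t))\<^sup>2"
        using power_mult[of "2::real" 2 k] by (simp add: power_mult_distrib power_mult[symmetric] mult.commute)
      ultimately have "(2 ^ k * cmod (g k t))\<^sup>2 \<le> c"
        by (simp only:)
      then have "2 ^ k * cmod (g k t) \<le> sqrt c"
        by (simp add: real_le_rsqrt)
      then show ?thesis
        by (simp add: power_one_over field_simps)
    qed
    have "summable (\<lambda>k. sqrt c * (1/2) ^ k)"
      by (intro summable_mult summable_geometric) auto
    then have "summable (\<lambda>k. norm (g k t))"
      by (rule summable_comparison_test'[where N = 0]) (simp add: bound)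
    then have "summable (\<lambda>k. u (Suc k) t - u k t)"
      unfolding g_def by (rule summable_norm_cancel)
    then obtain l where "(\<lambda>k. u (Suc k) t - u k t) sums l"
      by (auto simp: summable_def)
    then have "(\<lambda>n. (u n t - u 0 t) + u 0 t) \<longlonglongrightarrow> l + u 0 t"
      unfolding sums_def sum_lessThan_telescope[of "\<lambda>k. u k t"] by (rule tendsto_add[OF _ tendsto_const])
    then show "convergent (\<lambda>k. u k t)"
      by (auto intro: convergentI)
  qed
qed

text \<open>
  Fatou's lemma: a bound in norm that holds eventually along the sequence passes to the pointwise
  limit.
\<close>

lemma AE_limit_L2_le:
  fixes u :: "nat \<Rightarrow> real^'d::finite \<Rightarrow> complex"
  assumes u: "\<And>k. square_integrable (u k)" and v: "square_integrable v"
    and w: "w \<in> borel_measurable lborel" and lim: "AE t in lborel. (\<lambda>k. u k t) \<longlonglongrightarrow> w t"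
    and le: "\<And>k. k \<ge> N \<Longrightarrow> norm (abs_L2 (u k) - abs_L2 v) \<le> e"
  shows "square_integrable w \<and> norm (abs_L2 w - abs_L2 v) \<le> e"
proof -
  note [measurable] = w
  have [measurable]: "u k \<in> borel_measurable lborel" "v \<in> borel_measurable lborel" for k
    using u v by (auto simp: square_integrable_def)
  have e: "e \<ge> 0"
    using le[of N] norm_ge_zero order_trans by blast
  have "(\<integral>\<^sup>+t. ennreal ((cmod (w t - v t))\<^sup>2) \<partial>lborel)
      = (\<integral>\<^sup>+t. liminf (\<lambda>k. ennreal ((cmod (u (k + N) t - v t))\<^sup>2)) \<partial>lborel)"
  proof (rule nn_integral_cong_AE)
    show "AE t in lborel. ennreal ((cmod (w t - v t))\<^sup>2)
        = liminf (\<lambda>k. ennreal ((cmod (u (k + N) t - v t))\<^sup>2))"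
      using lim
    proof eventually_elim
      fix t
      assume "(\<lambda>k. u k t) \<longlonglongrightarrow> w t"
      then have "(\<lambda>k. u (k + N) t) \<longlonglongrightarrow> w t"
        by (rule LIMSEQ_ignore_initial_segment)
      then have "(\<lambda>k. ennreal ((cmod (u (k + N) t - v t))\<^sup>2)) \<longlonglongrightarrow> ennreal ((cmod (w t - v t))\<^sup>2)"
        by (intro tendsto_intros)
      then show "ennreal ((cmod (w t - v t))\<^sup>2) = liminf (\<lambda>k. ennreal ((cmod (u (k + N) t - v t))\<^sup>2))"
        by (intro lim_imp_Liminf[symmetric]) auto
    qed
  qed
  also have "\<dots> \<le> liminf (\<lambda>k. \<integral>\<^sup>+t. ennreal ((cmod (u (k + N) t - v t))\<^sup>2) \<partial>lborel)"
    by (rule nn_integral_liminf) measurable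
  also have "\<dots> \<le> ennreal (e\<^sup>2)"
  proof (rule Liminf_le)
    have "(\<integral>\<^sup>+t. ennreal ((cmod (u (k + N) t - v t))\<^sup>2) \<partial>lborel) \<le> ennreal (e\<^sup>2)" for k
      using le[of "k + N"]
      by (simp add: nn_integral_cmod_sq[OF square_integrable_diff[OF u v]] abs_L2_diff[OF u v, symmetric]
          power_mono ennreal_leI)
    then show "\<forall>\<^sub>F k in sequentially. (\<integral>\<^sup>+t. ennreal ((cmod (u (k + N) t - v t))\<^sup>2) \<partial>lborel) \<le> ennreal (e\<^sup>2)"
      by simp
  qed simp
  finally have *: "(\<integral>\<^sup>+t. ennreal ((cmod (w t - v t))\<^sup>2) \<partial>lborel) \<le> ennreal (e\<^sup>2)" .
  then have "integrable lborel (\<lambda>t. (cmod (w t - v t))\<^sup>2)"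
    by (intro integrableI_nonneg) (auto intro: le_less_trans)
  then have sq: "square_integrable (\<lambda>t. w t - v t)"
    by (simp add: square_integrable_def)
  then have "square_integrable w"
    using square_integrable_add[OF sq v] by simp
  moreover have "(norm (abs_L2 (\<lambda>t. w t - v t)))\<^sup>2 \<le> e\<^sup>2"
    using * by (simp add: nn_integral_cmod_sq[OF sq])
  ultimately show ?thesis
    using e by (simp add: abs_L2_diff v)
qed

instance L2 :: (finite) banach
proof
  fix X :: "nat \<Rightarrow> 'a L2"
  assume X: "Cauchy X"
  have "\<exists>N. \<forall>m\<ge>N. \<forall>n\<ge>N. dist (X m) (X n) < (1/4) ^ k" for k :: nat
    by (rule metric_CauchyD[OF X]) simp
  then obtain N where N: "\<And>k m n. m \<ge> N k \<Longrightarrow> n \<ge> N k \<Longrightarrow> dist (X m) (X n) < (1/4) ^ k"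
    by metis
  \<comment> \<open>at least \<open>N k\<close> and \<open>N (k - 1)\<close>, and tending to infinity\<close>
  define r where "r k = k + (\<Sum>i\<le>k. N i)" for k
  have r: "r k \<ge> N k" "r k \<ge> k" for k
    by (auto simp: r_def intro: trans_le_add2 member_le_sum)
  have rSuc: "r (Suc k) \<ge> N k" for k
    using r(1)[of k] by (simp add: r_def)
  have "\<exists>u. square_integrable u \<and> X (r k) = abs_L2 u" for k
    by (metis L2_cases)
  then obtain u where u: "\<And>k. square_integrable (u k)" "\<And>k. X (r k) = abs_L2 (u k)"
    by metis
  have "norm (abs_L2 (u (Suc k)) - abs_L2 (u k)) \<le> (1/4) ^ k" for k
    using N[OF rSuc r(1), of k] by (simp add: dist_norm u(2) less_imp_le)
  then have conv: "AE t in lborel. convergent (\<lambda>k. u k t)"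
    using u(1) by (intro fast_Cauchy_AE_convergent)
  define w where "w t = lim (\<lambda>k. u k t)" for t
  have w: "w \<in> borel_measurable lborel"
    unfolding w_def using u(1) by (intro borel_measurable_lim_metric) (simp add: square_integrable_def)
  have lim: "AE t in lborel. (\<lambda>k. u k t) \<longlonglongrightarrow> w t"
    using conv by eventually_elim (simp add: w_def convergent_LIMSEQ_iff)
  have "X \<longlonglongrightarrow> abs_L2 w"
  proof (rule metric_LIMSEQ_I)
    fix e :: real
    assume e: "e > 0"
    obtain M where M: "\<And>m n. m \<ge> M \<Longrightarrow> n \<ge> M \<Longrightarrow> dist (X m) (X n) < e / 2"
      using metric_CauchyD[OF X, of "e / 2"] e by auto
    have "dist (X m) (abs_L2 w) < e" if m: "m \<ge> M" for m
    proof -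
      obtain v where v: "square_integrable v" "X m = abs_L2 v"
        by (metis L2_cases)
      have "norm (abs_L2 (u k) - abs_L2 v) \<le> e / 2" if "k \<ge> M" for k
        using M[of "r k" m] m r(2)[of k] that by (simp add: u(2) v(2) dist_norm less_imp_le)
      then have "norm (abs_L2 w - abs_L2 v) \<le> e / 2"
        using AE_limit_L2_le[OF u(1) v(1) w lim] by blast
      then show ?thesis
        using e by (simp add: v(2) dist_norm norm_minus_commute)
    qed
    then show "\<exists>M. \<forall>m\<ge>M. dist (X m) (abs_L2 w) < e"
      by blast
  qed
  then show "convergent X"
    by (rule convergentI)
qed

section \<open>Complex-linear operators and the absolute value\<close>

lemma cinner_add_left: "cinner (f + g) h = cinner f h + cinner g h"
  by transfer (auto simp: l2_rel_def distrib_right square_integrable_mult_cnj)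

lemma cinner_scaleC_left: "cinner (c *\<^sub>C f) g = c * cinner f g"
  by transfer (simp add: mult.assoc)

lemma cinner_commute: "cinner f g = cnj (cinner g f)"
  by transfer (simp add: mult.commute flip: Bochner_Integration.integral_cnj)

lemma cinner_add_right: "cinner h (f + g) = cinner h f + cinner h g"
  using cinner_add_left[of f g h] by (simp add: cinner_commute[of h] del: cinner_add_left)

lemma cinner_scaleC_right: "cinner f (c *\<^sub>C g) = cnj c * cinner f g"
  using cinner_scaleC_left[of c g f] by (simp add: cinner_commute[of f])

lemma cinner_scaleR_left: "cinner (r *\<^sub>R f) g = r *\<^sub>R cinner f g"
  by (simp add: scaleR_L2_def cinner_scaleC_left scaleR_conv_of_real)

lemma cinner_scaleR_right: "cinner f (r *\<^sub>R g) = r *\<^sub>R cinner f g"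
  by (simp add: scaleR_L2_def cinner_scaleC_right scaleR_conv_of_real)

lemma scaleC_scaleC: "c *\<^sub>C d *\<^sub>C f = (c * d) *\<^sub>C f"
  by transfer (auto simp: l2_rel_def mult.assoc intro: square_integrable_mult_const)

lemma scaleC_add_left: "(c + d) *\<^sub>C f = c *\<^sub>C f + d *\<^sub>C f"
  by transfer (auto simp: l2_rel_def distrib_right intro: square_integrable_mult_const square_integrable_add)

lemma scaleC_diff_left: "(c - d) *\<^sub>C f = c *\<^sub>C f - d *\<^sub>C f"
  using scaleC_add_left[of "c - d" d f] by (simp add: algebra_simps)

lemma scaleC_of_real: "complex_of_real r *\<^sub>C f = r *\<^sub>R f"
  by (simp add: scaleR_L2_def)

lemma scaleC_one [simp]: "1 *\<^sub>C f = f"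
  using scaleC_of_real[of 1 f] by simp

lemma scaleC_zero_left [simp]: "0 *\<^sub>C f = 0"
  using scaleC_of_real[of 0 f] by simp

lemma scaleC_minus_one: "(- 1) *\<^sub>C f = - f"
  using scaleC_of_real[of "- 1" f] by simp

lemma cmul_apply [simp]: "cmul c f = c *\<^sub>C f"
  by (simp add: cmul.rep_eq)

lemma scaleC_add_right: "c *\<^sub>C (f + g) = c *\<^sub>C f + c *\<^sub>C g"
  using blinfun.add_right[of "cmul c" f g] by simp

lemma scaleC_diff_right: "c *\<^sub>C (f - g) = c *\<^sub>C f - c *\<^sub>C g"
  using blinfun.diff_right[of "cmul c" f g] by simp

lemma scaleC_zero_right [simp]: "c *\<^sub>C 0 = 0"
  using blinfun.zero_right[of "cmul c"] unfolding cmul_apply .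

lemma scaleC_scaleR_commute: "c *\<^sub>C r *\<^sub>R f = r *\<^sub>R c *\<^sub>C f"
  using blinfun.scaleR_right[of "cmul c" r f] by simp

text \<open>
  The real inner product determines the complex one, so that identities between real inner products
  of complex-linear operators carry over.
\<close>

lemma Im_cinner: "Im (cinner f g) = f \<bullet> (\<i> *\<^sub>C g)"
  by (simp add: inner_L2_def cinner_scaleC_right)

lemma cinner_eq_Complex: "cinner f g = Complex (f \<bullet> g) (f \<bullet> (\<i> *\<^sub>C g))"
  by (rule complex_eqI) (simp_all add: Im_cinner inner_L2_def)

lemma cmod_cinner_le: "cmod (cinner f g) \<le> norm f * norm g"
proof (cases "cinner f g = 0")
  case False
  define c where "c = cnj (sgn (cinner f g))"
  have "c * cinner f g = complex_of_real (cmod (cinner f g))"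
    using False by (simp add: c_def sgn_eq complex_norm_square[symmetric] field_simps)
      (simp add: complex_norm_square power2_eq_square[symmetric] mult.commute)
  then have "cmod (cinner f g) = (c *\<^sub>C f) \<bullet> g"
    by (simp add: inner_L2_def cinner_scaleC_left)
  also have "\<dots> \<le> norm (c *\<^sub>C f) * norm g"
    by (rule norm_cauchy_schwarz)
  also have "norm (c *\<^sub>C f) = norm f"
    using False by (simp add: norm_scaleC c_def norm_sgn)
  finally show ?thesis .
qed simp

lemma bounded_linear_cinner_left: "bounded_linear (\<lambda>f. cinner f g)"
  by (rule bounded_linear_intro[where K = "norm g"])
    (simp_all add: cinner_add_left cinner_scaleR_left cmod_cinner_le)

lemma bounded_linear_cinner_right: "bounded_linear (cinner f)"
  by (rule bounded_linear_intro[where K = "norm f"])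
    (simp_all add: cinner_add_right cinner_scaleR_right cmod_cinner_le mult.commute[of _ "norm f"])

lemmas cinner_diff_left = linear_diff[OF bounded_linear.linear[OF bounded_linear_cinner_left]]
lemmas cinner_diff_right = linear_diff[OF bounded_linear.linear[OF bounded_linear_cinner_right]]
lemmas cinner_sum_left = linear_sum[OF bounded_linear.linear[OF bounded_linear_cinner_left]]
lemmas cinner_sum_right = linear_sum[OF bounded_linear.linear[OF bounded_linear_cinner_right]]
lemmas cinner_zero_left [simp] = linear_0[OF bounded_linear.linear[OF bounded_linear_cinner_left]]
lemmas cinner_zero_right [simp] = linear_0[OF bounded_linear.linear[OF bounded_linear_cinner_right]]

lemma cinner_right_unique:
  assumes "\<And>g. cinner f g = cinner f' g"
  shows "f = f'"
  by (rule vector_eq_rdot[THEN iffD1]) (simp add: inner_L2_def assms)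

lemma clinear_op_scaleC: "clinear_op T \<Longrightarrow> T (c *\<^sub>C f) = c *\<^sub>C T f"
  by (simp add: clinear_op_def)

lemma clinear_op_compose: "clinear_op S \<Longrightarrow> clinear_op T \<Longrightarrow> clinear_op (S o\<^sub>L T)"
  by (simp add: clinear_op_def)

lemma clinear_op_cmul: "clinear_op (cmul c)"
  by (simp add: clinear_op_def scaleC_scaleC mult.commute)

lemma clinear_op_diff: "clinear_op S \<Longrightarrow> clinear_op T \<Longrightarrow> clinear_op (S - T)"
  by (simp add: clinear_op_def blinfun.diff_left scaleC_diff_right)

lemma clinear_op_scaleR: "clinear_op T \<Longrightarrow> clinear_op (r *\<^sub>R T)"
  by (simp add: clinear_op_def blinfun.scaleR_left scaleC_scaleR_commute)

text \<open>Decompose \<open>c f = Re c f + Im c (\<i> f)\<close>.\<close>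

lemma clinear_op_iff_i: "clinear_op T \<longleftrightarrow> (\<forall>f. T (\<i> *\<^sub>C f) = \<i> *\<^sub>C T f)"
proof
  assume i: "\<forall>f. T (\<i> *\<^sub>C f) = \<i> *\<^sub>C T f"
  have decomp: "c *\<^sub>C f = Re c *\<^sub>R f + Im c *\<^sub>R cmul \<i> f" for c and f :: "'a L2"
  proof -
    have "c *\<^sub>C f = (complex_of_real (Re c) + complex_of_real (Im c) * \<i>) *\<^sub>C f"
      by (metis complex_eq mult.commute)
    then show ?thesis
      by (simp only: cmul_apply scaleC_add_left scaleC_of_real flip: scaleC_scaleC)
  qed
  have i': "T (cmul \<i> f) = cmul \<i> (T f)" for f
    using i by simp
  show "clinear_op T"
    unfolding clinear_op_def
    by (intro allI) (simp only: decomp blinfun.add_right blinfun.scaleR_right i')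
qed (simp add: clinear_op_def)

lemma adjoint_op:
  fixes T :: "'d::finite op"
  assumes T: "clinear_op T"
  shows cinner_adjoint: "cinner ((T\<^sup>\<dagger>) f) g = cinner f (T g)" and clinear_op_adjoint: "clinear_op (T\<^sup>\<dagger>)"
proof -
  obtain U :: "'d op" where U: "\<And>x y. U x \<bullet> y = x \<bullet> T y"
    using ex_adjoint[of T] by blast
  have U': "cinner (U f) g = cinner f (T g)" for f g
    by (simp add: cinner_eq_Complex U clinear_op_scaleC[OF T])
  have "\<forall>f g. cinner ((T\<^sup>\<dagger>) f) g = cinner f (T g)"
    unfolding adjoint_op_def
  proof (rule theI)
    show "\<forall>f g. cinner (U f) g = cinner f (T g)"
      by (simp add: U')
    fix W :: "'d op"
    assume "\<forall>f g. cinner (W f) g = cinner f (T g)"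
    then show "W = U"
      by (intro blinfun_eqI cinner_right_unique) (simp add: U')
  qed
  then show *: "cinner ((T\<^sup>\<dagger>) f) g = cinner f (T g)" for f g
    by blast
  show "clinear_op (T\<^sup>\<dagger>)"
    unfolding clinear_op_def
    by (intro allI cinner_right_unique) (simp add: * cinner_scaleC_left)
qed

text \<open>
  Over the complex numbers, real values of the quadratic form already force symmetry, by
  polarization.
\<close>

lemma positive_op_iff: "positive_op P \<longleftrightarrow> clinear_op P \<and> nonneg_form P"
proof
  assume "positive_op P"
  then have P: "clinear_op P" and pos: "\<And>f. 0 \<le> Re (cinner (P f) f)" "\<And>f. Im (cinner (P f) f) = 0"
    by (auto simp: positive_op_def complex_nonneg_Reals_iff)
  have skew: "P x \<bullet> (\<i> *\<^sub>C y) = - (P y \<bullet> (\<i> *\<^sub>C x))" for x y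
    using pos(2)[of "x + y"] pos(2)[of x] pos(2)[of y]
    by (simp add: Im_cinner blinfun.add_right scaleC_add_right inner_add)
  have iso: "(\<i> *\<^sub>C a) \<bullet> (\<i> *\<^sub>C b) = a \<bullet> b" for a b :: "'a L2"
    by (simp add: inner_L2_def cinner_scaleC_left cinner_scaleC_right)
  have "P x \<bullet> y = x \<bullet> P y" for x y
  proof -
    have "P x \<bullet> y = P x \<bullet> (\<i> *\<^sub>C (- \<i>) *\<^sub>C y)"
      by (simp add: scaleC_scaleC)
    also have "\<dots> = - (((- \<i>) *\<^sub>C P y) \<bullet> (\<i> *\<^sub>C x))"
      by (simp add: skew clinear_op_scaleC[OF P])
    also have "((- \<i>) *\<^sub>C P y) = - (\<i> *\<^sub>C P y)"
      by (simp add: scaleC_scaleC flip: scaleC_minus_one)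
    finally show ?thesis
      by (simp add: iso inner_commute)
  qed
  with P pos(1) show "clinear_op P \<and> nonneg_form P"
    by (simp add: nonneg_form_def inner_L2_def)
next
  assume *: "clinear_op P \<and> nonneg_form P"
  then have sym: "P x \<bullet> y = x \<bullet> P y" for x y
    by (simp add: nonneg_form_def)
  have "P f \<bullet> (\<i> *\<^sub>C f) = 0" for f
  proof -
    have "P f \<bullet> (\<i> *\<^sub>C f) = f \<bullet> (\<i> *\<^sub>C P f)"
      using * by (simp add: sym clinear_op_scaleC)
    also have "\<dots> = - (P f \<bullet> (\<i> *\<^sub>C f))"
      using arg_cong[OF cinner_commute[of f "P f"], of Im] by (simp add: Im_cinner)
    finally show ?thesis
      by simp
  qed
  then show "positive_op P"
    using * by (auto simp: positive_op_def complex_nonneg_Reals_iff Im_cinner nonneg_form_def simp flip: inner_L2_def)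
qed

lemma ex_positive_sqrt:
  assumes A: "positive_op A"
  shows "\<exists>P. positive_op P \<and> P o\<^sub>L P = A \<and> (\<forall>Q. positive_op Q \<and> Q o\<^sub>L Q = A \<longrightarrow> Q = P)"
proof -
  have A': "clinear_op A" "nonneg_form A"
    using A by (auto simp: positive_op_iff)
  obtain P where P: "nonneg_form P" "P o\<^sub>L P = A" "\<And>Q. Q o\<^sub>L A = A o\<^sub>L Q \<Longrightarrow> Q o\<^sub>L P = P o\<^sub>L Q"
    using ex_sqrt[OF A'(2)] by blast
  have "cmul c o\<^sub>L P = P o\<^sub>L cmul c" for c
    by (rule P(3)) (rule blinfun_eqI, simp add: clinear_op_scaleC[OF A'(1)])
  then have "c *\<^sub>C P f = P (c *\<^sub>C f)" for c f
    by (metis blinfun_apply_blinfun_compose cmul_apply)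
  then have "clinear_op P"
    by (simp add: clinear_op_def)
  then have pos: "positive_op P"
    using P(1) by (simp add: positive_op_iff)
  have uniq: "Q = P" if Q: "positive_op Q" "Q o\<^sub>L Q = A" for Q
  proof (rule sqrt_unique[symmetric])
    have "Q o\<^sub>L A = A o\<^sub>L Q"
      unfolding Q(2)[symmetric] by (rule blinfun_eqI) simp
    then show "Q o\<^sub>L P = P o\<^sub>L Q"
      by (rule P(3))
    show "nonneg_form P" "nonneg_form Q"
      using pos Q(1) by (simp_all add: positive_op_iff)
    show "P o\<^sub>L P = Q o\<^sub>L Q"
      unfolding P(2) Q(2) ..
  qed
  show ?thesis
    by (intro exI[of _ P] conjI allI impI pos P(2)) (elim conjE, rule uniq)
qed

lemma abs_op:
  fixes T :: "'d::finite op"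
  assumes T: "clinear_op T"
  shows positive_abs_op: "positive_op (abs_op T)" and norm_abs_op: "norm (abs_op T f) = norm (T f)"
proof -
  have sym: "(T\<^sup>\<dagger>) (T x) \<bullet> y = T x \<bullet> T y" for x y
    by (simp add: inner_L2_def cinner_adjoint[OF T])
  then have sym': "x \<bullet> (T\<^sup>\<dagger>) (T y) = T x \<bullet> T y" for x y
    by (metis inner_commute)
  have "positive_op (T\<^sup>\<dagger> o\<^sub>L T)"
    using T by (auto simp: positive_op_iff nonneg_form_def sym sym' intro!: clinear_op_compose clinear_op_adjoint)
  then obtain P where P: "positive_op P \<and> P o\<^sub>L P = T\<^sup>\<dagger> o\<^sub>L T"
    "\<And>Q. positive_op Q \<and> Q o\<^sub>L Q = T\<^sup>\<dagger> o\<^sub>L T \<Longrightarrow> Q = P"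
    using ex_positive_sqrt by metis
  have *: "positive_op (abs_op T) \<and> abs_op T o\<^sub>L abs_op T = T\<^sup>\<dagger> o\<^sub>L T"
    unfolding abs_op_def by (rule theI[of _ P]) (fact P)+
  then show "positive_op (abs_op T)"
    by blast
  then have "abs_op T f \<bullet> abs_op T f = (abs_op T o\<^sub>L abs_op T) f \<bullet> f"
    by (simp add: positive_op_iff nonneg_form_def)
  also have "\<dots> = T f \<bullet> T f"
    by (simp add: * sym)
  finally show "norm (abs_op T f) = norm (T f)"
    by (simp add: norm_eq_sqrt_inner)
qed

text \<open>
  If a contraction \<open>U0\<close> satisfies \<open>U0 P = T\<close> with \<open>P\<close> and \<open>T\<close> complex-linear, then \<open>- \<i> U0 \<i>\<close> does
  too, and the average of the two commutes with \<open>\<i>\<close>.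
\<close>

lemma clinear_factor_through_dominating:
  fixes T P :: "'d::finite op"
  assumes T: "clinear_op T" and P: "clinear_op P" and le: "\<And>x. norm (T x) \<le> norm (P x)"
  shows "\<exists>U. clinear_op U \<and> norm U \<le> 1 \<and> (\<forall>x. U (P x) = T x)"
proof -
  obtain U0 where U0: "norm U0 \<le> 1" "U0 o\<^sub>L P = T"
    using factor_through_dominating[of T P] le by blast
  have U0P: "U0 (P x) = T x" for x
    using U0(2) by (metis blinfun_apply_blinfun_compose)
  define J :: "'d op" where "J = cmul \<i>"
  define U where "U = (1/2) *\<^sub>R (U0 - (J o\<^sub>L U0 o\<^sub>L J))"
  have U: "U x = (1/2) *\<^sub>R (U0 x - \<i> *\<^sub>C U0 (\<i> *\<^sub>C x))" for x
    by (simp add: U_def J_def blinfun.scaleR_left blinfun.diff_left)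
  have "U (\<i> *\<^sub>C x) = \<i> *\<^sub>C U x" for x
    by (simp add: U scaleC_scaleC scaleC_minus_one blinfun.minus_right scaleC_scaleR_commute scaleC_diff_right)
      (simp add: scaleC_scaleC flip: scaleC_minus_one)
  then have "clinear_op U"
    by (simp add: clinear_op_iff_i)
  moreover have "norm U \<le> 1"
  proof (rule norm_blinfun_bound)
    fix x
    have 1: "norm (U0 y) \<le> norm y" for y
      using order_trans[OF norm_blinfun mult_right_mono[OF U0(1) norm_ge_zero]] by simp
    have "norm (U0 x - \<i> *\<^sub>C U0 (\<i> *\<^sub>C x)) \<le> norm (U0 x) + norm (\<i> *\<^sub>C U0 (\<i> *\<^sub>C x))"
      by (rule norm_triangle_ineq4)
    also have "\<dots> \<le> norm x + norm x"
      using 1[of x] 1[of "\<i> *\<^sub>C x"] by (simp add: norm_scaleC)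
    finally show "norm (U x) \<le> 1 * norm x"
      by (simp add: U)
  qed auto
  moreover have "U (P x) = T x" for x
  proof -
    have "U0 (\<i> *\<^sub>C P x) = \<i> *\<^sub>C T x"
      by (metis U0P clinear_op_scaleC P T)
    then show ?thesis
      by (simp add: U U0P scaleC_scaleC scaleC_minus_one flip: scaleR_2)
  qed
  ultimately show ?thesis
    by blast
qed

definition orthonormal_set :: "'d::finite L2 set \<Rightarrow> bool" where
  "orthonormal_set E \<longleftrightarrow> (\<forall>e\<in>E. \<forall>e'\<in>E. cinner e e' = (if e = e' then 1 else 0))"

lemma orthonormal_basis_iff:
  "orthonormal_basis B \<longleftrightarrow> orthonormal_set B \<and> (\<forall>f. (\<forall>e\<in>B. cinner f e = 0) \<longrightarrow> f = 0)"
  by (simp add: orthonormal_basis_def orthonormal_set_def)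

lemma orthonormal_set_mono: "orthonormal_set B \<Longrightarrow> E \<subseteq> B \<Longrightarrow> orthonormal_set E"
  unfolding orthonormal_set_def by blast

lemma norm_residual_sq:
  assumes E: "orthonormal_set E" "finite E"
  shows "(norm (f - (\<Sum>e\<in>E. cinner f e *\<^sub>C e)))\<^sup>2 = (norm f)\<^sup>2 - (\<Sum>e\<in>E. (cmod (cinner f e))\<^sup>2)"
proof -
  define p where "p = (\<Sum>e\<in>E. cinner f e *\<^sub>C e)"
  have pe: "cinner p e = cinner f e" if "e \<in> E" for e
  proof -
    have "cinner p e = (\<Sum>e'\<in>E. cinner f e' * cinner e' e)"
      by (simp add: p_def cinner_sum_left cinner_scaleC_left)
    also have "\<dots> = (\<Sum>e'\<in>E. if e' = e then cinner f e' else 0)"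
      using E(1) that by (intro sum.cong) (auto simp: orthonormal_set_def)
    finally show ?thesis
      using that E(2) by simp
  qed
  have fp: "cinner h p = (\<Sum>e\<in>E. cnj (cinner f e) * cinner h e)" for h
    by (simp add: p_def cinner_sum_right cinner_scaleC_right)
  have "cinner (f - p) p = 0"
    by (simp add: fp cinner_diff_left pe)
  then have "cinner p p = cinner f p" "(f - p) \<bullet> p = 0"
    by (simp_all add: cinner_diff_left inner_L2_def)
  moreover have "cinner f p = complex_of_real (\<Sum>e\<in>E. (cmod (cinner f e))\<^sup>2)"
    by (simp add: fp complex_norm_square mult.commute del: of_real_power)
  ultimately have 1: "(norm p)\<^sup>2 = (\<Sum>e\<in>E. (cmod (cinner f e))\<^sup>2)" and 2: "(f - p) \<bullet> p = 0"
    by (simp_all add: norm_L2_sq[of p] del: of_real_sum of_real_power)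
  have "(norm f)\<^sup>2 = (norm p)\<^sup>2 + (norm (f - p))\<^sup>2"
    using 2 by (simp add: power2_norm_eq_inner inner_diff inner_commute)
  with 1 show ?thesis
    by (simp add: p_def)
qed

lemma bessel_inequality:
  assumes "orthonormal_set E" "finite E"
  shows "(\<Sum>e\<in>E. (cmod (cinner f e))\<^sup>2) \<le> (norm f)\<^sup>2"
  using norm_residual_sq[OF assms, of f] zero_le_power2[of "norm (f - (\<Sum>e\<in>E. cinner f e *\<^sub>C e))"] by linarith

text \<open>
  Cauchy--Schwarz combined with Bessel's inequality. This bounds the trace of an operator of rank
  one over any finite orthonormal set.
\<close>

lemma sum_cinner_cinner_le:
  assumes E: "orthonormal_set E" "finite E"
  shows "(\<Sum>e\<in>E. cmod (cinner a e) * cmod (cinner b e)) \<le> norm a * norm b"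
proof -
  have L2: "L2_set (\<lambda>e. cmod (cinner x e)) E \<le> norm x" for x
    unfolding L2_set_def by (rule real_le_lsqrt) (auto simp: bessel_inequality[OF E] sum_nonneg)
  have "(\<Sum>e\<in>E. cmod (cinner a e) * cmod (cinner b e))
      \<le> L2_set (\<lambda>e. cmod (cinner a e)) E * L2_set (\<lambda>e. cmod (cinner b e)) E"
    using L2_set_mult_ineq[of "\<lambda>e. cmod (cinner a e)" "\<lambda>e. cmod (cinner b e)" E] by simp
  also have "\<dots> \<le> norm a * norm b"
    by (intro mult_mono L2) auto
  finally show ?thesis .
qed

lemma has_sum_metric:
  fixes f :: "'b \<Rightarrow> 'a::{comm_monoid_add,metric_space}"
  shows "(f has_sum x) A \<longleftrightarrow> (\<forall>\<epsilon>>0. \<exists>X. finite X \<and> X \<subseteq> A \<and>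
    (\<forall>Y. finite Y \<and> X \<subseteq> Y \<and> Y \<subseteq> A \<longrightarrow> dist (sum f Y) x < \<epsilon>))"
  by (simp add: has_sum_def tendsto_iff eventually_finite_subsets_at_top)

text \<open>
  The vectors that equal their Fourier series form a closed subspace, because every residual map
  \<open>f \<mapsto> f - (\<Sum>e\<in>F. \<langle>f, e\<rangle> e)\<close> is a contraction. A vector orthogonal to this subspace is
  orthogonal to the basis, hence \<open>0\<close>.
\<close>

lemma has_sum_fourier_series:
  fixes f :: "'d::finite L2"
  assumes B: "orthonormal_basis B"
  shows "((\<lambda>e. cinner f e *\<^sub>C e) has_sum f) B"
proof -
  have B': "orthonormal_set B" "\<And>f. (\<And>e. e \<in> B \<Longrightarrow> cinner f e = 0) \<Longrightarrow> f = 0"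
    using B by (auto simp: orthonormal_basis_iff)
  define M where "M = {f. ((\<lambda>e. cinner f e *\<^sub>C e) has_sum f) B}"
  have contr: "norm (f - (\<Sum>e\<in>F. cinner f e *\<^sub>C e)) \<le> norm f" if "finite F" "F \<subseteq> B" for F f
  proof -
    have "(norm (f - (\<Sum>e\<in>F. cinner f e *\<^sub>C e)))\<^sup>2 \<le> (norm f)\<^sup>2"
      using norm_residual_sq[OF orthonormal_set_mono[OF B'(1) that(2)] that(1), of f]
      by (simp add: sum_nonneg)
    then show ?thesis
      by (rule power2_le_imp_le) simp
  qed
  have add: "f + g \<in> M" if "f \<in> M" "g \<in> M" for f g
    using has_sum_add[of "\<lambda>e. cinner f e *\<^sub>C e" B f "\<lambda>e. cinner g e *\<^sub>C e" g] that
    by (simp add: M_def cinner_add_left scaleC_add_left)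
  have scale: "c *\<^sub>C f \<in> M" if "f \<in> M" for c f
    using has_sum_bounded_linear[OF blinfun.bounded_linear_right[of "cmul c"], of "\<lambda>e. cinner f e *\<^sub>C e" B f] that
    by (simp add: M_def cinner_scaleC_left scaleC_scaleC)
  have sub: "subspace M"
  proof (rule subspaceI)
    show "0 \<in> M"
      by (simp add: M_def)
    show "r *\<^sub>R f \<in> M" if "f \<in> M" for r f
      using scale[OF that, of "complex_of_real r"] by (simp add: scaleC_of_real)
  qed (rule add)
  have "closed M"
    unfolding closed_sequential_limits
  proof (intro allI impI)
    fix u l
    assume *: "(\<forall>n. u n \<in> M) \<and> u \<longlonglongrightarrow> l"
    show "l \<in> M"
      unfolding M_def mem_Collect_eq has_sum_metric
    proof (intro allI impI)
      fix \<epsilon> :: real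
      assume e: "\<epsilon> > 0"
      then obtain n where n: "dist (u n) l < \<epsilon> / 2"
        using * metric_LIMSEQ_D[of u l "\<epsilon> / 2"] by auto
      have "((\<lambda>e. cinner (u n) e *\<^sub>C e) has_sum u n) B"
        using * by (simp add: M_def)
      then obtain X where X: "finite X" "X \<subseteq> B"
        "\<And>Y. finite Y \<Longrightarrow> X \<subseteq> Y \<Longrightarrow> Y \<subseteq> B \<Longrightarrow> dist (\<Sum>e\<in>Y. cinner (u n) e *\<^sub>C e) (u n) < \<epsilon> / 2"
        using e unfolding has_sum_metric by (metis half_gt_zero)
      have "dist (\<Sum>e\<in>Y. cinner l e *\<^sub>C e) l < \<epsilon>" if Y: "finite Y" "X \<subseteq> Y" "Y \<subseteq> B" for Y
      proof -
        have "l - (\<Sum>e\<in>Y. cinner l e *\<^sub>C e)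
            = (u n - (\<Sum>e\<in>Y. cinner (u n) e *\<^sub>C e)) + ((l - u n) - (\<Sum>e\<in>Y. cinner (l - u n) e *\<^sub>C e))"
          by (simp add: cinner_diff_left scaleC_diff_left sum_subtractf)
        also have "norm \<dots> \<le> norm (u n - (\<Sum>e\<in>Y. cinner (u n) e *\<^sub>C e)) + norm (l - u n)"
          by (intro order_trans[OF norm_triangle_ineq] add_left_mono contr Y)
        also have "\<dots> < \<epsilon>"
          using X(3)[OF Y] n by (simp add: dist_norm norm_minus_commute)
        finally show ?thesis
          by (simp add: dist_norm norm_minus_commute)
      qed
      then show "\<exists>X. finite X \<and> X \<subseteq> B \<and> (\<forall>Y. finite Y \<and> X \<subseteq> Y \<and> Y \<subseteq> B \<longrightarrow>
          dist (\<Sum>e\<in>Y. cinner l e *\<^sub>C e) l < \<epsilon>)"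
        using X(1,2) by blast
    qed
  qed
  then obtain p where p: "p \<in> M" "\<And>q. q \<in> M \<Longrightarrow> (f - p) \<bullet> q = 0"
    using orthogonal_projection_closed_subspace[OF _ sub] by blast
  have "cinner (f - p) e = 0" if e: "e \<in> B" for e
  proof -
    have "((\<lambda>e'. cinner e e' *\<^sub>C e') has_sum e) B \<longleftrightarrow> ((\<lambda>e'. e') has_sum e) {e}"
      using B'(1) e by (intro has_sum_cong_neutral) (auto simp: orthonormal_set_def)
    then have "e \<in> M"
      by (simp add: M_def has_sum_finite_iff)
    then show ?thesis
      using p(2)[of e] p(2)[OF scale[of e \<i>]] by (simp add: cinner_eq_Complex complex_eq_iff)
  qed
  then have "f = p"
    using B'(2)[of "f - p"] by simp
  with p(1) show ?thesis
    by (simp add: M_def)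
qed

section \<open>The trace norm by duality\<close>

definition rank_one :: "'d::finite L2 \<Rightarrow> 'd L2 \<Rightarrow> 'd op" where
  "rank_one a b = Blinfun (\<lambda>f. cinner f b *\<^sub>C a)"

lemma rank_one_apply [simp]: "rank_one a b f = cinner f b *\<^sub>C a"
proof -
  have "bounded_linear (\<lambda>f. cinner f b *\<^sub>C a)"
  proof (rule bounded_linear_intro)
    show "cinner (f + g) b *\<^sub>C a = cinner f b *\<^sub>C a + cinner g b *\<^sub>C a" for f g
      by (simp add: cinner_add_left scaleC_add_left)
    show "cinner (r *\<^sub>R f) b *\<^sub>C a = r *\<^sub>R cinner f b *\<^sub>C a" for r f
      by (simp add: cinner_scaleR_left scaleR_conv_of_real scaleC_of_real flip: scaleC_scaleC)
    show "norm (cinner f b *\<^sub>C a) \<le> norm f * (norm b * norm a)" for f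
      using mult_right_mono[OF cmod_cinner_le[of f b] norm_ge_zero[of a]] by (simp add: norm_scaleC mult.assoc)
  qed
  then show ?thesis
    by (simp add: rank_one_def bounded_linear_Blinfun_apply)
qed

text \<open>
  By the duality between trace-class and bounded operators, the infimum of the admissible \<open>C\<close> is the
  trace norm. Taking the real part suffices, since \<open>V\<close> may be multiplied by a phase, and the
  restriction to finite sets \<open>E\<close> makes the condition meaningful for every operator.
\<close>

definition trace_le :: "'d::finite op \<Rightarrow> real \<Rightarrow> bool" where
  "trace_le T C \<longleftrightarrow> (\<forall>V E. clinear_op V \<longrightarrow> norm V \<le> 1 \<longrightarrow> finite E \<longrightarrow> orthonormal_set E \<longrightarrow>
     (\<Sum>e\<in>E. Re (cinner (V (T e)) e)) \<le> C)"

lemma trace_leI: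
  fixes T :: "'d::finite op"
  assumes "\<And>V E. clinear_op V \<Longrightarrow> norm V \<le> 1 \<Longrightarrow> finite E \<Longrightarrow> orthonormal_set E \<Longrightarrow>
    (\<Sum>e\<in>E. Re (cinner (V (T e)) e)) \<le> C"
  shows "trace_le T C"
  using assms by (simp add: trace_le_def)

lemma trace_leD:
  fixes T :: "'d::finite op"
  assumes "trace_le T C" "clinear_op V" "norm V \<le> 1" "finite E" "orthonormal_set E"
  shows "(\<Sum>e\<in>E. Re (cinner (V (T e)) e)) \<le> C"
  using assms by (simp add: trace_le_def)

lemma trace_le_nonneg:
  assumes "trace_le T C"
  shows "C \<ge> 0"
  using trace_leD[OF assms, of 0 "{}"] by (simp add: clinear_op_def orthonormal_set_def)

lemma trace_le_mono: "trace_le T C \<Longrightarrow> C \<le> D \<Longrightarrow> trace_le T D"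
  unfolding trace_le_def by (meson order_trans)

lemma trace_le_zero: "trace_le 0 0"
  by (rule trace_leI) simp

lemma trace_le_add:
  assumes "trace_le S C" "trace_le T D"
  shows "trace_le (S + T) (C + D)"
  by (rule trace_leI)
    (simp add: blinfun.add_left blinfun.add_right cinner_add_left sum.distrib add_mono trace_leD[OF assms(1)] trace_leD[OF assms(2)])

text \<open>
  The phase of \<open>c\<close> is absorbed into the contraction.
\<close>

lemma trace_le_cmul:
  fixes T :: "'d::finite op"
  assumes T: "trace_le T C"
  shows "trace_le (cmul c o\<^sub>L T) (cmod c * C)"
proof (rule trace_leI)
  fix V :: "'d op" and E :: "'d L2 set"
  assume V: "clinear_op V" "norm V \<le> 1" and E: "finite E" "orthonormal_set E"
  \<comment> \<open>for \<open>c = 0\<close> the phase \<open>sgn c\<close> is \<open>0\<close>, so \<open>W\<close> is a contraction in any case\<close>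
  define W where "W = V o\<^sub>L cmul (sgn c)"
  have "norm (cmul (sgn c) :: 'd op) \<le> 1"
    by (rule norm_blinfun_bound) (auto simp: norm_scaleC norm_sgn)
  then have "norm W \<le> 1"
    unfolding W_def using V(2) by (intro order_trans[OF norm_blinfun_compose] mult_le_one) auto
  then have "(\<Sum>e\<in>E. Re (cinner (W (T e)) e)) \<le> C"
    using V E by (intro trace_leD[OF T]) (auto simp: W_def clinear_op_compose clinear_op_cmul)
  then have "cmod c * (\<Sum>e\<in>E. Re (cinner (W (T e)) e)) \<le> cmod c * C"
    by (rule mult_left_mono) simp
  moreover have "cinner (V (c *\<^sub>C T e)) e = complex_of_real (cmod c) * cinner (W (T e)) e" for e
  proof -
    have "complex_of_real (cmod c) * sgn c = c"
      by (cases "c = 0") (simp_all add: sgn_eq)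
    then show ?thesis
      by (simp add: W_def clinear_op_scaleC[OF V(1)] cinner_scaleC_left flip: mult.assoc)
  qed
  ultimately show "(\<Sum>e\<in>E. Re (cinner (V ((cmul c o\<^sub>L T) e)) e)) \<le> cmod c * C"
    by (simp add: sum_distrib_left)
qed

lemma cmul_of_real_compose: "cmul (complex_of_real r) o\<^sub>L T = r *\<^sub>R T"
  by (rule blinfun_eqI) (simp add: scaleC_of_real blinfun.scaleR_left)

lemma trace_le_scaleR:
  assumes "trace_le T C"
  shows "trace_le (r *\<^sub>R T) (\<bar>r\<bar> * C)"
  using trace_le_cmul[OF assms, of "complex_of_real r"] by (simp add: cmul_of_real_compose)

lemma trace_le_diff:
  assumes "trace_le S C" "trace_le T D"
  shows "trace_le (S - T) (C + D)"
  using trace_le_add[OF assms(1) trace_le_scaleR[OF assms(2), of "- 1"]] by simp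

lemma has_sum_finite_sum:
  fixes f :: "'e \<Rightarrow> 'j \<Rightarrow> 'a::{topological_comm_monoid_add}"
  assumes "finite E" "\<And>e. e \<in> E \<Longrightarrow> (f e has_sum s e) A"
  shows "((\<lambda>j. \<Sum>e\<in>E. f e j) has_sum (\<Sum>e\<in>E. s e)) A"
  using assms by (induction E rule: finite_induct) (auto intro: has_sum_add)

text \<open>
  For fixed \<open>V\<close> and \<open>E\<close> the trace is continuous in the operator norm, so that bounds on the terms of
  a series convergent in operator norm add up to a bound on its sum.
\<close>

lemma trace_le_has_sum:
  fixes T :: "'j \<Rightarrow> 'd::finite op"
  assumes T: "(T has_sum S) J" and C: "(C has_sum D) J" and le: "\<And>j. j \<in> J \<Longrightarrow> trace_le (T j) (C j)"
  shows "trace_le S D"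
proof (rule trace_leI)
  fix V :: "'d op" and E :: "'d L2 set"
  assume V: "clinear_op V" "norm V \<le> 1" and E: "finite E" "orthonormal_set E"
  have "((\<lambda>j. Re (cinner (V (T j e)) e)) has_sum Re (cinner (V (S e)) e)) J" for e
    by (intro has_sum_bounded_linear[OF bounded_linear_Re] has_sum_bounded_linear[OF bounded_linear_cinner_left]
        has_sum_bounded_linear[OF blinfun.bounded_linear_right] has_sum_bounded_linear[OF blinfun.bounded_linear_left] T)
  then have "((\<lambda>j. \<Sum>e\<in>E. Re (cinner (V (T j e)) e)) has_sum (\<Sum>e\<in>E. Re (cinner (V (S e)) e))) J"
    by (intro has_sum_finite_sum E)
  then show "(\<Sum>e\<in>E. Re (cinner (V (S e)) e)) \<le> D"
    by (rule has_sum_mono[OF _ C]) (intro trace_leD[OF le] V E)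
qed

text \<open>
  The series for \<open>T\<close> is only assumed to converge pointwise, since this is what a Fourier expansion
  provides.
\<close>

lemma trace_le_nuclear:
  fixes T :: "'d::finite op" and a b :: "'j \<Rightarrow> 'd L2"
  assumes T: "\<And>f. ((\<lambda>j. cinner f (b j) *\<^sub>C a j) has_sum T f) J"
    and C: "((\<lambda>j. norm (a j) * norm (b j)) has_sum C) J"
  shows "trace_le T C"
proof (rule trace_leI)
  fix V :: "'d op" and E :: "'d L2 set"
  assume V: "clinear_op V" "norm V \<le> 1" and E: "finite E" "orthonormal_set E"
  have "((\<lambda>j. Re (cinner (V (cinner e (b j) *\<^sub>C a j)) e)) has_sum Re (cinner (V (T e)) e)) J" for e
    by (intro has_sum_bounded_linear[OF bounded_linear_Re] has_sum_bounded_linear[OF bounded_linear_cinner_left]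
        has_sum_bounded_linear[OF blinfun.bounded_linear_right] T)
  then have "((\<lambda>j. \<Sum>e\<in>E. Re (cinner (V (cinner e (b j) *\<^sub>C a j)) e)) has_sum (\<Sum>e\<in>E. Re (cinner (V (T e)) e))) J"
    by (intro has_sum_finite_sum E)
  then show "(\<Sum>e\<in>E. Re (cinner (V (T e)) e)) \<le> C"
  proof (rule has_sum_mono[OF _ C])
    fix j
    have "(\<Sum>e\<in>E. Re (cinner (V (cinner e (b j) *\<^sub>C a j)) e))
        \<le> (\<Sum>e\<in>E. cmod (cinner (V (a j)) e) * cmod (cinner (b j) e))"
    proof (rule sum_mono)
      fix e
      have "Re (cinner (V (cinner e (b j) *\<^sub>C a j)) e) \<le> cmod (cinner e (b j) * cinner (V (a j)) e)"
        by (simp add: clinear_op_scaleC[OF V(1)] cinner_scaleC_left complex_Re_le_cmod del: times_complex.simps)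
      also have "\<dots> = cmod (cinner (V (a j)) e) * cmod (cinner (b j) e)"
        by (simp add: norm_mult cinner_commute[of e "b j"] mult.commute)
      finally show "Re (cinner (V (cinner e (b j) *\<^sub>C a j)) e) \<le> cmod (cinner (V (a j)) e) * cmod (cinner (b j) e)" .
    qed
    also have "\<dots> \<le> norm (V (a j)) * norm (b j)"
      by (rule sum_cinner_cinner_le[OF E(2,1)])
    also have "\<dots> \<le> norm (a j) * norm (b j)"
      using order_trans[OF norm_blinfun mult_right_mono[OF V(2) norm_ge_zero], of "a j"]
      by (intro mult_right_mono) auto
    finally show "(\<Sum>e\<in>E. Re (cinner (V (cinner e (b j) *\<^sub>C a j)) e)) \<le> norm (a j) * norm (b j)" .
  qed
qed

lemma trace_le_rank_one: "trace_le (rank_one a b) (norm a * norm b)"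
  by (rule trace_le_nuclear[where J = "{()}" and a = "\<lambda>_. a" and b = "\<lambda>_. b"])
    (simp_all add: has_sum_finite_iff)

lemma trace_le_rank_one_diff:
  "trace_le (rank_one a b - rank_one a' b') (norm (a - a') * norm b + norm a' * norm (b - b'))"
proof -
  have "rank_one a b - rank_one a' b' = rank_one (a - a') b + rank_one a' (b - b')"
    by (rule blinfun_eqI)
      (simp add: blinfun.diff_left blinfun.add_left cinner_diff_right scaleC_diff_left scaleC_diff_right)
  then show ?thesis
    by (simp add: trace_le_add trace_le_rank_one)
qed

definition unitary_op :: "'d::finite op \<Rightarrow> bool" where
  "unitary_op W \<longleftrightarrow> clinear_op W \<and> (\<forall>f g. cinner (W f) (W g) = cinner f g) \<and>
     (\<forall>f g. cinner ((W\<^sup>\<dagger>) f) ((W\<^sup>\<dagger>) g) = cinner f g)"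

lemma unitary_op_norm:
  assumes "unitary_op W"
  shows "norm (W f) = norm f" "norm ((W\<^sup>\<dagger>) f) = norm f" "norm W \<le> 1" "norm (W\<^sup>\<dagger>) \<le> 1"
proof -
  show *: "norm (W f) = norm f" "norm ((W\<^sup>\<dagger>) f) = norm f" for f
    using assms by (auto simp: unitary_op_def norm_eq_sqrt_inner inner_L2_def)
  show "norm W \<le> 1" "norm (W\<^sup>\<dagger>) \<le> 1"
    by (rule norm_blinfun_bound; simp add: *)+
qed

abbreviation conjugated :: "'d::finite op \<Rightarrow> 'd op \<Rightarrow> 'd op" where
  "conjugated W T \<equiv> W o\<^sub>L T o\<^sub>L W\<^sup>\<dagger>"

text \<open>
  A unitary conjugation moves from \<open>T\<close> to the test objects: it replaces \<open>V\<close> by \<open>W\<^sup>\<dagger> V W\<close> and \<open>E\<close> by its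
  image under \<open>W\<^sup>\<dagger>\<close>.
\<close>

lemma trace_le_conjugated:
  fixes T W :: "'d::finite op"
  assumes T: "trace_le T C" and W: "unitary_op W"
  shows "trace_le (conjugated W T) C"
proof (rule trace_leI)
  fix V :: "'d op" and E :: "'d L2 set"
  assume V: "clinear_op V" "norm V \<le> 1" and E: "finite E" "orthonormal_set E"
  have W': "clinear_op W" "clinear_op (W\<^sup>\<dagger>)" "\<And>f g. cinner ((W\<^sup>\<dagger>) f) ((W\<^sup>\<dagger>) g) = cinner f g"
    using W by (auto simp: unitary_op_def clinear_op_adjoint)
  have inj: "inj_on (W\<^sup>\<dagger>) E"
    by (rule inj_onI) (metis W'(3) cinner_right_unique)
  define E' where "E' = (W\<^sup>\<dagger>) ` E"
  define V' where "V' = W\<^sup>\<dagger> o\<^sub>L V o\<^sub>L W"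
  have "(\<Sum>e\<in>E'. Re (cinner (V' (T e)) e)) \<le> C"
  proof (rule trace_leD[OF T])
    show "orthonormal_set E'"
      using E(2) inj by (simp add: E'_def orthonormal_set_def W'(3) inj_on_eq_iff)
    show "clinear_op V'"
      unfolding V'_def by (intro clinear_op_compose V W')
    show "norm V' \<le> 1"
      unfolding V'_def
      by (intro order_trans[OF norm_blinfun_compose] mult_le_one unitary_op_norm[OF W] V norm_ge_zero)
  qed (simp add: E'_def E)
  also have "(\<Sum>e\<in>E'. Re (cinner (V' (T e)) e)) = (\<Sum>e\<in>E. Re (cinner (V ((conjugated W T) e)) e))"
    unfolding E'_def by (simp add: sum.reindex[OF inj] V'_def W'(3))
  finally show "(\<Sum>e\<in>E. Re (cinner (V ((conjugated W T) e)) e)) \<le> C" .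
qed

lemma conjugated_rank_one:
  assumes "unitary_op W"
  shows "conjugated W (rank_one a b) = rank_one (W a) (W b)"
  using assms by (intro blinfun_eqI) (simp add: unitary_op_def clinear_op_scaleC cinner_adjoint)

lemma abs_op_form_nonneg: "clinear_op T \<Longrightarrow> 0 \<le> Re (cinner (abs_op T e) e)"
  using positive_abs_op[of T] by (simp add: positive_op_def complex_nonneg_Reals_iff)

text \<open>
  The test operator \<open>V\<close> is chosen with \<open>V T = \<bar>T\<bar>\<close>. The orthonormal basis is arbitrary, which makes
  the choice of a basis in the trace norm harmless.
\<close>

lemma trace_norm_bound:
  fixes T :: "'d::finite op"
  assumes T: "clinear_op T" "trace_le T C" and B: "orthonormal_basis B"
  shows "(\<lambda>e. Re (cinner (abs_op T e) e)) summable_on B"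
    and "(\<Sum>\<^sub>\<infinity>e\<in>B. Re (cinner (abs_op T e) e)) \<le> C"
proof -
  let ?P = "abs_op T"
  have P: "clinear_op ?P" "nonneg_form ?P"
    using positive_abs_op[OF T(1)] by (auto simp: positive_op_iff)
  note nonneg = abs_op_form_nonneg[OF T(1)]
  obtain V where V: "clinear_op V" "norm V \<le> 1" "\<And>x. V (T x) = ?P x"
    using clinear_factor_through_dominating[OF P(1) T(1)] norm_abs_op[OF T(1)] by (metis order_refl)
  have bound: "(\<Sum>e\<in>F. Re (cinner (?P e) e)) \<le> C" if F: "finite F" "F \<subseteq> B" for F
    using trace_leD[OF T(2) V(1,2) F(1)] orthonormal_set_mono[OF _ F(2)] B
    by (simp add: V(3) orthonormal_basis_iff)
  show sum: "(\<lambda>e. Re (cinner (?P e) e)) summable_on B"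
    by (rule nonneg_bdd_above_summable_on[OF nonneg]) (auto intro!: bdd_aboveI2 bound)
  show "(\<Sum>\<^sub>\<infinity>e\<in>B. Re (cinner (?P e) e)) \<le> C"
    by (rule infsum_le_finite_sums[OF sum bound])
qed

text \<open>
  With \<open>T = U \<bar>T\<bar>\<close> and \<open>R = \<bar>T\<bar>\<^bsup>1/2\<^esup>\<close>, apply \<open>U R\<close> to the Fourier series of \<open>R f\<close>. The products of the
  norms are at most \<open>(norm (R e))\<^sup>2 = \<langle>\<bar>T\<bar> e, e\<rangle>\<close>, whose sum is the trace of \<open>\<bar>T\<bar>\<close>.
\<close>

lemma nuclear_representation:
  fixes T :: "'d::finite op" and B :: "'d L2 set"
  assumes T: "clinear_op T" and B: "orthonormal_basis B"
  shows "\<exists>a b. (\<forall>f. ((\<lambda>e. cinner f (b e) *\<^sub>C a e) has_sum T f) B) \<and>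
    (\<forall>e. norm (a e) * norm (b e) \<le> Re (cinner (abs_op T e) e))"
proof -
  let ?P = "abs_op T"
  have P: "clinear_op ?P"
    using positive_abs_op[OF T] by (auto simp: positive_op_iff)
  obtain R where R: "positive_op R" "R o\<^sub>L R = ?P"
    using ex_positive_sqrt[OF positive_abs_op[OF T]] by blast
  have R': "clinear_op R" "\<And>x y. R x \<bullet> y = x \<bullet> R y"
    using R(1) by (auto simp: positive_op_iff nonneg_form_def)
  have RR: "R (R x) = ?P x" for x
    using R(2) by (metis blinfun_apply_blinfun_compose)
  have sym: "cinner (R x) y = cinner x (R y)" for x y
    by (simp add: cinner_eq_Complex R'(2) clinear_op_scaleC[OF R'(1)])
  obtain U where U: "clinear_op U" "norm U \<le> 1" "\<And>x. U (?P x) = T x"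
    using clinear_factor_through_dominating[OF T P] norm_abs_op[OF T] by (metis order_refl)
  have "((\<lambda>e. U (R (cinner (R f) e *\<^sub>C e))) has_sum U (R (R f))) B" for f
    by (intro has_sum_bounded_linear[OF blinfun.bounded_linear_right] has_sum_fourier_series B)
  then have series: "((\<lambda>e. cinner f (R e) *\<^sub>C U (R e)) has_sum T f) B" for f
    by (simp add: sym RR U(3) clinear_op_scaleC[OF U(1)] clinear_op_scaleC[OF R'(1)])
  have bound: "norm (U (R e)) * norm (R e) \<le> Re (cinner (?P e) e)" for e
  proof -
    have "norm (U (R e)) \<le> norm (R e)"
      using order_trans[OF norm_blinfun mult_right_mono[OF U(2) norm_ge_zero], of "R e"] by simp
    then have "norm (U (R e)) * norm (R e) \<le> (norm (R e))\<^sup>2"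
      unfolding power2_eq_square by (rule mult_right_mono) simp
    also have "\<dots> = Re (cinner (?P e) e)"
      by (simp add: norm_L2_sq sym[symmetric] RR)
    finally show ?thesis .
  qed
  show ?thesis
    by (rule exI[of _ "\<lambda>e. U (R e)"], rule exI[of _ "blinfun_apply R"]) (intro conjI allI series bound)
qed

lemma trace_le_infsum_abs_op:
  fixes T :: "'d::finite op" and B :: "'d L2 set"
  assumes T: "clinear_op T" and B: "orthonormal_basis B"
    and s: "(\<lambda>e. Re (cinner (abs_op T e) e)) summable_on B"
  shows "trace_le T (\<Sum>\<^sub>\<infinity>e\<in>B. Re (cinner (abs_op T e) e))"
proof -
  obtain a b where ab: "\<And>f. ((\<lambda>e. cinner f (b e) *\<^sub>C a e) has_sum T f) B"
    "\<And>e. norm (a e) * norm (b e) \<le> Re (cinner (abs_op T e) e)"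
    using nuclear_representation[OF T B] by blast
  have s': "(\<lambda>e. norm (a e) * norm (b e)) summable_on B"
    by (rule summable_on_comparison_test[OF s]) (auto intro: ab(2))
  show ?thesis
    by (rule trace_le_mono[OF trace_le_nuclear[OF ab(1) has_sum_infsum[OF s']]])
      (intro infsum_mono s s' ab(2))
qed

text \<open>
  The existence of an orthonormal basis is a hypothesis here; in the applications it is supplied by
  some operator already known to be of trace class.
\<close>

lemma trace_class_iff:
  fixes T :: "'d::finite op"
  assumes "orthonormal_basis (B :: 'd L2 set)"
  shows "trace_class T \<longleftrightarrow> clinear_op T \<and> (\<exists>C. trace_le T C)"
  unfolding trace_class_def using assms trace_norm_bound(1) trace_le_infsum_abs_op by blast

lemma some_orthonormal_basis:
  "orthonormal_basis (B :: 'd::finite L2 set) \<Longrightarrow> orthonormal_basis (SOME B :: 'd L2 set. orthonormal_basis B)"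
  by (rule someI)

lemma trace_norm_le:
  fixes T :: "'d::finite op"
  assumes "orthonormal_basis (B :: 'd L2 set)" "clinear_op T" "trace_le T C"
  shows "trace_norm T \<le> C"
  unfolding trace_norm_def by (rule trace_norm_bound(2)[OF assms(2,3) some_orthonormal_basis[OF assms(1)]])

lemma trace_class_ex_basis:
  "trace_class (T :: 'd::finite op) \<Longrightarrow> \<exists>B :: 'd L2 set. orthonormal_basis B"
  by (auto simp: trace_class_def)

lemma trace_class_clinear: "trace_class T \<Longrightarrow> clinear_op T"
  by (simp add: trace_class_def)

lemma trace_le_trace_norm:
  fixes T :: "'d::finite op"
  assumes "trace_class T"
  shows "trace_le T (trace_norm T)"
proof -
  obtain B :: "'d L2 set" where B: "orthonormal_basis B"
    using trace_class_ex_basis[OF assms] by blast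
  then show ?thesis
    using assms unfolding trace_norm_def trace_class_iff[OF B]
    by (auto intro!: trace_le_infsum_abs_op trace_norm_bound(1) some_orthonormal_basis)
qed

lemma trace_norm_nonneg:
  assumes "clinear_op T"
  shows "trace_norm T \<ge> 0"
  unfolding trace_norm_def by (intro infsum_nonneg abs_op_form_nonneg assms)

lemma finite_rank_approximation:
  fixes T :: "'d::finite op"
  assumes T: "trace_class T" and e: "\<epsilon> > 0"
  obtains F :: "'d L2 set" and a b where "finite F" "trace_le (T - (\<Sum>e\<in>F. rank_one (a e) (b e))) \<epsilon>"
proof -
  obtain B where B: "orthonormal_basis B" "(\<lambda>e. Re (cinner (abs_op T e) e)) summable_on B" and cT: "clinear_op T"
    using T by (auto simp: trace_class_def)
  obtain a b where ab: "\<And>f. ((\<lambda>e. cinner f (b e) *\<^sub>C a e) has_sum T f) B"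
    "\<And>e. norm (a e) * norm (b e) \<le> Re (cinner (abs_op T e) e)"
    using nuclear_representation[OF cT B(1)] by blast
  let ?c = "\<lambda>e. norm (a e) * norm (b e)"
  have s: "?c summable_on B"
    by (rule summable_on_comparison_test[OF B(2)]) (auto intro: ab(2))
  obtain F where F: "finite F" "F \<subseteq> B" "dist (sum ?c F) (infsum ?c B) \<le> \<epsilon>"
    using has_sum_finite_approximation[OF has_sum_infsum[OF s] e] by blast
  have "trace_le (T - (\<Sum>e\<in>F. rank_one (a e) (b e))) (infsum ?c B - sum ?c F)"
  proof (rule trace_le_nuclear[where J = "B - F"])
    show "(?c has_sum (infsum ?c B - sum ?c F)) (B - F)"
      by (rule has_sum_Diff[OF has_sum_infsum[OF s] has_sum_finite[OF F(1)] F(2)])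
    show "((\<lambda>e. cinner f (b e) *\<^sub>C a e) has_sum (T - (\<Sum>e\<in>F. rank_one (a e) (b e))) f) (B - F)" for f
      using has_sum_Diff[OF ab(1)[of f] has_sum_finite[OF F(1)] F(2)]
      by (simp add: blinfun.diff_left blinfun.sum_left)
  qed
  moreover have "infsum ?c B - sum ?c F \<le> \<epsilon>"
    using F(3) by (simp add: dist_real_def)
  ultimately show thesis
    using that F(1) trace_le_mono by blast
qed

section \<open>Strong continuity of time-frequency shifts\<close>

lemma tf_shift_abs_L2:
  "square_integrable u \<Longrightarrow> tf_shift z (abs_L2 u) = abs_L2 (tf_shift_fun z u)"
  by (simp add: tf_shift.rep_eq tf_shift_L2.abs_eq l2_rel_refl)

lemma tf_shift_fun_eq:
  "tf_shift_fun z f t = exp (2 * of_real pi * \<i> * of_real (snd z \<bullet> t)) * f (t - fst z)"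
  by (simp add: tf_shift_fun_def split: prod.split)

lemma norm_tf_shift: "norm (tf_shift z f) = norm f"
proof -
  obtain u where u: "square_integrable u" "f = abs_L2 u"
    by (rule L2_cases)
  have "(norm (tf_shift z f))\<^sup>2 = (norm f)\<^sup>2"
    using u(1) by (simp add: u(2) tf_shift_abs_L2 norm_abs_L2_sq square_integrable_tf_shift_fun)
  then show ?thesis
    by simp
qed

lemma clinear_op_tf_shift: "clinear_op (tf_shift z)"
  unfolding clinear_op_def
proof (intro allI)
  fix c and f :: "'a L2"
  obtain u :: "real^'a \<Rightarrow> complex" where u: "square_integrable u" "f = abs_L2 u"
    by (rule L2_cases)
  have "tf_shift_fun z (\<lambda>t. c * u t) = (\<lambda>t. c * tf_shift_fun z u t)"
    by (auto simp: tf_shift_fun_def split: prod.split)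
  then show "tf_shift z (c *\<^sub>C f) = c *\<^sub>C tf_shift z f"
    using u(1) by (simp add: u(2) abs_L2_scaleC tf_shift_abs_L2 square_integrable_mult_const square_integrable_tf_shift_fun)
qed

text \<open>
  Up to the phase \<open>c\<close>, the inverse of the shift by \<open>(x, \<omega>)\<close> is the shift by \<open>(- x, - \<omega>)\<close>.
\<close>

lemma tf_shift_surj: "\<exists>g. tf_shift z g = f"
proof -
  obtain x \<omega> where z: "z = (x, \<omega>)"
    by (cases z)
  obtain u where u: "square_integrable u" "f = abs_L2 u"
    by (rule L2_cases)
  define c where "c = exp (- (2 * of_real pi * \<i> * of_real (\<omega> \<bullet> x)))"
  have "tf_shift_fun z (\<lambda>t. c * tf_shift_fun (- x, - \<omega>) u t) = u"
  proof
    fix t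
    have "exp (2 * of_real pi * \<i> * of_real (\<omega> \<bullet> t)) * (c * exp (2 * of_real pi * \<i> * of_real (- \<omega> \<bullet> (t - x)))) = 1"
      unfolding c_def by (simp add: inner_diff_right algebra_simps flip: exp_add)
    then show "tf_shift_fun z (\<lambda>t. c * tf_shift_fun (- x, - \<omega>) u t) t = u t"
      by (simp add: tf_shift_fun_def z flip: mult.assoc)
  qed
  then have "tf_shift z (abs_L2 (\<lambda>t. c * tf_shift_fun (- x, - \<omega>) u t)) = f"
    using u(1) by (simp add: u(2) tf_shift_abs_L2 square_integrable_mult_const square_integrable_tf_shift_fun)
  then show ?thesis
    by blast
qed

lemma unitary_opI:
  fixes W :: "'d::finite op"
  assumes W: "clinear_op W" and iso: "\<And>f. norm (W f) = norm f" and surj: "\<And>f. \<exists>g. W g = f"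
  shows "unitary_op W"
proof -
  have "W f \<bullet> W g = f \<bullet> g" for f g
    using dot_norm[of "W f" "W g"] dot_norm[of f g] by (simp add: iso flip: blinfun.add_right)
  then have WW: "cinner (W f) (W g) = cinner f g" for f g
    by (simp add: cinner_eq_Complex flip: clinear_op_scaleC[OF W])
  have inv: "(W\<^sup>\<dagger>) (W f) = f" for f
    by (rule cinner_right_unique) (simp add: cinner_adjoint[OF W] WW)
  have "cinner ((W\<^sup>\<dagger>) f) ((W\<^sup>\<dagger>) g) = cinner f g" for f g
  proof -
    obtain f' g' where "W f' = f" "W g' = g"
      using surj by metis
    then show ?thesis
      by (auto simp: inv WW)
  qed
  then show ?thesis
    using W WW by (simp add: unitary_op_def)
qed

lemma unitary_op_tf_shift: "unitary_op (tf_shift z)"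
  by (intro unitary_opI clinear_op_tf_shift norm_tf_shift tf_shift_surj)

lemma square_integrable_indicator:
  assumes "A \<in> sets borel" "emeasure lborel A < \<infinity>"
  shows "square_integrable (indicator A :: real^'d::finite \<Rightarrow> complex)"
proof -
  have "(\<lambda>t. (cmod (indicator A t))\<^sup>2) = (indicator A :: real^'d \<Rightarrow> real)"
    by (auto simp: indicator_def)
  then show ?thesis
    using assms by (simp add: square_integrable_def)
qed

lemma cnj_indicator: "cnj (indicator A t) = indicator A t"
  by (simp add: indicator_def)

text \<open>
  For unitary operators convergence of \<open>\<langle>\<pi>(z\<^sub>n) F, \<pi>(z\<^sub>0) F\<rangle>\<close> to \<open>(norm F)\<^sup>2\<close> is enough. If \<open>F\<close> is the
  indicator of an open set \<open>U\<close>, the integrands converge at every point: where the second factor does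
  not vanish, \<open>t - x\<^sub>0\<close> lies in \<open>U\<close>, and then \<open>t - x\<^sub>n\<close> lies in \<open>U\<close> for large \<open>n\<close>. The second factor
  also dominates the product.
\<close>

lemma tendsto_tf_shift_open_indicator:
  fixes U :: "(real^'d::finite) set"
  assumes U: "open U" "emeasure lborel U < \<infinity>" and z: "z \<longlonglongrightarrow> z0"
  shows "(\<lambda>n. tf_shift (z n) (abs_L2 (indicator U))) \<longlonglongrightarrow> tf_shift z0 (abs_L2 (indicator U))"
proof -
  define F where "F = (abs_L2 (indicator U) :: 'd L2)"
  let ?s = "\<lambda>z. tf_shift_fun z (indicator U)"
  have sq: "square_integrable (indicator U :: real^'d \<Rightarrow> complex)"
    using U by (intro square_integrable_indicator) auto
  note sqs = square_integrable_tf_shift_fun(1)[OF sq]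
  have [measurable]: "?s z \<in> borel_measurable lborel" for z
    using sqs by (simp add: square_integrable_def)
  have bnd: "cmod (?s z t) \<le> 1" for z t
    by (simp add: cmod_tf_shift_fun indicator_def)
  have "(\<lambda>n. LINT t|lborel. ?s (z n) t * cnj (?s z0 t)) \<longlonglongrightarrow> (LINT t|lborel. ?s z0 t * cnj (?s z0 t))"
  proof (rule integral_dominated_convergence)
    show "integrable lborel (\<lambda>t. (cmod (?s z0 t))\<^sup>2)"
      using sqs[of z0] by (simp add: square_integrable_def)
    show "AE t in lborel. (\<lambda>n. ?s (z n) t * cnj (?s z0 t)) \<longlonglongrightarrow> ?s z0 t * cnj (?s z0 t)"
    proof (rule AE_I2)
      fix t
      show "(\<lambda>n. ?s (z n) t * cnj (?s z0 t)) \<longlonglongrightarrow> ?s z0 t * cnj (?s z0 t)"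
      proof (cases "t - fst z0 \<in> U")
        case True
        have "(\<lambda>n. t - fst (z n)) \<longlonglongrightarrow> t - fst z0"
          by (intro tendsto_intros z)
        then have ev: "\<forall>\<^sub>F n in sequentially. t - fst (z n) \<in> U"
          using topological_tendstoD U(1) True by blast
        have "(\<lambda>n. exp (2 * of_real pi * \<i> * of_real (snd (z n) \<bullet> t)))
            \<longlonglongrightarrow> exp (2 * of_real pi * \<i> * of_real (snd z0 \<bullet> t))"
          by (intro tendsto_intros z)
        moreover have "\<forall>\<^sub>F n in sequentially. exp (2 * of_real pi * \<i> * of_real (snd (z n) \<bullet> t)) = ?s (z n) t"
          using ev by eventually_elim (simp add: tf_shift_fun_eq)
        ultimately have "(\<lambda>n. ?s (z n) t) \<longlonglongrightarrow> exp (2 * of_real pi * \<i> * of_real (snd z0 \<bullet> t))"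
          by (rule Lim_transform_eventually)
        moreover have "exp (2 * of_real pi * \<i> * of_real (snd z0 \<bullet> t)) = ?s z0 t"
          using True by (simp add: tf_shift_fun_eq)
        ultimately show ?thesis
          by (intro tendsto_mult tendsto_const) simp
      next
        case False
        then have "?s z0 t = 0"
          by (simp add: tf_shift_fun_eq)
        then show ?thesis
          by simp
      qed
    qed
    show "AE t in lborel. norm (?s (z n) t * cnj (?s z0 t)) \<le> (cmod (?s z0 t))\<^sup>2" for n
    proof (rule AE_I2)
      fix t
      have "cmod (?s z0 t) = (cmod (?s z0 t))\<^sup>2"
        by (simp add: cmod_tf_shift_fun indicator_def)
      then show "norm (?s (z n) t * cnj (?s z0 t)) \<le> (cmod (?s z0 t))\<^sup>2"
        using mult_right_mono[OF bnd[of "z n" t] norm_ge_zero[of "?s z0 t"]] by (simp add: norm_mult)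
    qed
  qed measurable
  then have "(\<lambda>n. cinner (tf_shift (z n) F) (tf_shift z0 F)) \<longlonglongrightarrow> cinner (tf_shift z0 F) (tf_shift z0 F)"
    by (simp add: F_def tf_shift_abs_L2 sq sqs cinner_abs_L2)
  then have "(\<lambda>n. tf_shift (z n) F \<bullet> tf_shift z0 F) \<longlonglongrightarrow> tf_shift z0 F \<bullet> tf_shift z0 F"
    unfolding inner_L2_def by (rule tendsto_Re)
  then have "(\<lambda>n. 2 * (norm F)\<^sup>2 - 2 * (tf_shift (z n) F \<bullet> tf_shift z0 F)) \<longlonglongrightarrow> 2 * (norm F)\<^sup>2 - 2 * (tf_shift z0 F \<bullet> tf_shift z0 F)"
    by (rule tendsto_diff[OF tendsto_const tendsto_mult_left])
  moreover have "(norm (tf_shift (z n) F - tf_shift z0 F))\<^sup>2 = 2 * (norm F)\<^sup>2 - 2 * (tf_shift (z n) F \<bullet> tf_shift z0 F)" for n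
    using norm_tf_shift[of "z n" F] norm_tf_shift[of z0 F]
    by (simp add: power2_norm_eq_inner[symmetric] inner_diff inner_commute[of "tf_shift z0 F"] dot_norm_neg field_simps)
  moreover have "tf_shift z0 F \<bullet> tf_shift z0 F = (norm F)\<^sup>2"
    using norm_tf_shift[of z0 F] by (simp add: power2_norm_eq_inner[symmetric])
  ultimately have "(\<lambda>n. (norm (tf_shift (z n) F - tf_shift z0 F))\<^sup>2) \<longlonglongrightarrow> 0"
    by simp
  then have "(\<lambda>n. sqrt ((norm (tf_shift (z n) F - tf_shift z0 F))\<^sup>2)) \<longlonglongrightarrow> sqrt 0"
    by (rule tendsto_real_sqrt)
  then show ?thesis
    by (simp add: F_def tendsto_norm_zero_iff LIM_zero_iff)
qed

text \<open>
  The set where \<open>Re (c v) > 1 / (n + 1)\<close> has finite measure since \<open>v\<close> is square-integrable, and the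
  integral of \<open>Re (c v)\<close> over it vanishes, so it is a null set.
\<close>

lemma AE_nonpos_if_integrals_vanish:
  fixes v :: "real^'d::finite \<Rightarrow> complex"
  assumes v: "square_integrable v"
    and zero: "\<And>A. A \<in> sets borel \<Longrightarrow> emeasure lborel A < \<infinity> \<Longrightarrow> (LINT t|lborel. v t * indicator A t) = 0"
  shows "AE t in lborel. Re (c * v t) \<le> 0"
proof -
  have [measurable]: "v \<in> borel_measurable borel" and int: "integrable lborel (\<lambda>t. (cmod (v t))\<^sup>2)"
    using v by (auto simp: square_integrable_def)
  have "AE t in lborel. \<not> Re (c * v t) > 1 / Suc n" for n
  proof -
    define A where "A = {t. Re (c * v t) > 1 / Suc n}"
    have A [measurable]: "A \<in> sets borel"
      unfolding A_def by measurable
    define K where "K = (real (Suc n))\<^sup>2 * (cmod c)\<^sup>2"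
    have K: "1 \<le> K * (cmod (v t))\<^sup>2" if "t \<in> A" for t
    proof -
      have "1 / Suc n \<le> Re (c * v t)"
        using that by (simp add: A_def)
      also have "\<dots> \<le> cmod c * cmod (v t)"
        by (metis complex_Re_le_cmod norm_mult)
      finally have "1 \<le> real (Suc n) * cmod c * cmod (v t)"
        by (simp add: field_simps)
      then have "1 \<le> (real (Suc n) * cmod c * cmod (v t))\<^sup>2"
        by (simp add: one_le_power)
      then show ?thesis
        by (simp add: K_def power_mult_distrib)
    qed
    have "emeasure lborel A = (\<integral>\<^sup>+t. indicator A t \<partial>lborel)"
      by simp
    also have "\<dots> \<le> (\<integral>\<^sup>+t. ennreal (K * (cmod (v t))\<^sup>2) \<partial>lborel)"
      using K by (intro nn_integral_mono) (auto simp: indicator_def)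
    also have "\<dots> = ennreal (LINT t|lborel. K * (cmod (v t))\<^sup>2)"
      using int by (intro nn_integral_eq_integral) (auto simp: K_def)
    also have "\<dots> < \<infinity>"
      by simp
    finally have fin: "emeasure lborel A < \<infinity>" .
    have i1: "integrable lborel (\<lambda>t. v t * indicator A t)"
      using square_integrable_mult_cnj[OF v square_integrable_indicator[OF A fin]]
      by (simp add: cnj_indicator)
    have "Re (c * (LINT t|lborel. v t * indicator A t)) = (LINT t|lborel. Re (c * (v t * indicator A t)))"
      by (subst integral_Re) (use i1 in simp_all)
    then have 0: "(LINT t|lborel. Re (c * (v t * indicator A t))) = 0"
      using zero[OF A fin] by simp
    have "(LINT t|lborel. (1 / Suc n) * indicator A t) \<le> (LINT t|lborel. Re (c * (v t * indicator A t)))"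
    proof (rule integral_mono)
      show "integrable lborel (\<lambda>t. 1 / real (Suc n) * indicator A t)"
        using fin by simp
      show "integrable lborel (\<lambda>t. Re (c * (v t * indicator A t)))"
        using i1 by (intro integrable_Re integrable_mult_right)
      show "1 / real (Suc n) * indicator A t \<le> Re (c * (v t * indicator A t))" for t
        by (auto simp: A_def indicator_def simp del: times_complex.simps)
    qed
    then have "measure lborel A \<le> 0"
      unfolding 0 by (simp add: divide_le_0_iff)
    then have "emeasure lborel A = 0"
      using fin by (simp add: emeasure_eq_ennreal_measure measure_le_0_iff)
    then show ?thesis
      by (intro AE_I[of _ _ A]) (auto simp: A_def)
  qed
  then have "AE t in lborel. \<forall>n. \<not> Re (c * v t) > 1 / Suc n"
    by (simp add: AE_all_countable)
  then show ?thesis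
  proof eventually_elim
    fix t
    assume "\<forall>n. \<not> Re (c * v t) > 1 / Suc n"
    then show "Re (c * v t) \<le> 0"
      by (meson nat_approx_posE not_le)
  qed
qed

text \<open>
  The vectors on which the shifts converge form a closed complex subspace \<open>M\<close>. It contains the
  indicators of open sets of finite measure and therefore, by outer regularity, those of all Borel
  sets of finite measure. A function orthogonal to all of these is \<open>0\<close>, so \<open>M\<close> is the whole space.
\<close>

lemma tendsto_tf_shift:
  fixes f :: "'d::finite L2"
  assumes z: "z \<longlonglongrightarrow> z0"
  shows "(\<lambda>n. tf_shift (z n) f) \<longlonglongrightarrow> tf_shift z0 f"
proof -
  define M where "M = {f :: 'd L2. (\<lambda>n. tf_shift (z n) f) \<longlonglongrightarrow> tf_shift z0 f}"
  have scale: "c *\<^sub>C f \<in> M" if "f \<in> M" for c f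
    using bounded_linear.tendsto[OF blinfun.bounded_linear_right[of "cmul c"]] that
    by (fastforce simp: M_def clinear_op_scaleC[OF clinear_op_tf_shift])
  have sub: "subspace M"
    by (rule subspaceI)
      (auto simp: M_def blinfun.add_right blinfun.scaleR_right intro!: tendsto_add tendsto_scaleR)
  have "closed M"
    unfolding closed_sequential_limits
  proof (intro allI impI)
    fix u l
    assume *: "(\<forall>n. u n \<in> M) \<and> u \<longlonglongrightarrow> l"
    show "l \<in> M"
      unfolding M_def mem_Collect_eq
    proof (rule metric_LIMSEQ_I)
      fix e :: real
      assume e: "e > 0"
      obtain k where k: "dist (u k) l < e / 3"
        using * metric_LIMSEQ_D[of u l "e / 3"] e by auto
      have "(\<lambda>n. tf_shift (z n) (u k)) \<longlonglongrightarrow> tf_shift z0 (u k)"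
        using * by (simp add: M_def)
      then obtain N where N: "\<And>n. n \<ge> N \<Longrightarrow> dist (tf_shift (z n) (u k)) (tf_shift z0 (u k)) < e / 3"
        using metric_LIMSEQ_D[of _ _ "e / 3"] e by (metis divide_pos_pos zero_less_numeral)
      have iso: "dist (tf_shift w l) (tf_shift w (u k)) < e / 3" for w
        using k norm_tf_shift[of w "l - u k"] by (simp add: dist_norm norm_minus_commute blinfun.diff_right)
      have "dist (tf_shift (z n) l) (tf_shift z0 l) < e" if "n \<ge> N" for n
        using N[OF that] iso[of "z n"] iso[of z0] by metric
      then show "\<exists>N. \<forall>n\<ge>N. dist (tf_shift (z n) l) (tf_shift z0 l) < e"
        by blast
    qed
  qed
  have ind: "abs_L2 (indicator A) \<in> M" if A: "A \<in> sets borel" "emeasure lborel A < \<infinity>" for A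
  proof -
    have "abs_L2 (indicator A) \<in> closure M"
      unfolding closure_approachable
    proof (intro allI impI)
      fix e :: real
      assume e: "e > 0"
      obtain U where U: "open U" "A \<subseteq> U" "U - A \<in> lmeasurable" "emeasure lebesgue (U - A) < ennreal (e\<^sup>2)"
        using sets_lebesgue_outer_open[of A "e\<^sup>2"] A e by auto
      have UA: "U - A \<in> sets borel" "U \<in> sets borel"
        using U(1) A(1) by auto
      then have UA': "emeasure lborel (U - A) < ennreal (e\<^sup>2)"
        using U(4) by simp
      have "emeasure lborel U \<le> emeasure lborel A + emeasure lborel (U - A)"
        using emeasure_subadditive[of A lborel "U - A"] A UA U(2) by (simp add: Un_absorb1)
      also have "\<dots> < \<infinity>"
        using A(2) UA' by (simp add: less_top order.strict_trans)
      finally have fU: "emeasure lborel U < \<infinity>" .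
      have sq: "square_integrable (indicator U :: real^'d \<Rightarrow> complex)"
        "square_integrable (indicator A :: real^'d \<Rightarrow> complex)"
        using square_integrable_indicator fU A UA by blast+
      have "(\<lambda>t. (cmod (indicator U t - indicator A t))\<^sup>2) = (indicator (U - A) :: real^'d \<Rightarrow> real)"
        using U(2) by (intro ext) (auto split: split_indicator)
      then have "(norm (abs_L2 (indicator U) - abs_L2 (indicator A) :: 'd L2))\<^sup>2 = measure lborel (U - A)"
        using UA by (simp add: abs_L2_diff sq norm_abs_L2_sq square_integrable_diff)
      also have "\<dots> < e\<^sup>2"
      proof -
        have "emeasure lborel (U - A) \<noteq> top"
          using UA' by auto
        then have "ennreal (measure lborel (U - A)) < ennreal (e\<^sup>2)"
          using UA' by (simp add: emeasure_eq_ennreal_measure)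
        then show ?thesis
          by (simp add: ennreal_less_iff)
      qed
      finally have "dist (abs_L2 (indicator U)) (abs_L2 (indicator A) :: 'd L2) < e"
        using e by (simp add: dist_norm power2_less_imp_less)
      moreover have "abs_L2 (indicator U) \<in> M"
        unfolding M_def using tendsto_tf_shift_open_indicator[OF U(1) fU z] by simp
      ultimately show "\<exists>y\<in>M. dist y (abs_L2 (indicator A)) < e"
        by blast
    qed
    then show ?thesis
      using \<open>closed M\<close> by simp
  qed
  obtain p where p: "p \<in> M" "\<And>g. g \<in> M \<Longrightarrow> (f - p) \<bullet> g = 0"
    using orthogonal_projection_closed_subspace[OF \<open>closed M\<close> sub] by blast
  have orth: "cinner (f - p) g = 0" if "g \<in> M" for g
    using p(2)[OF that] p(2)[OF scale[OF that, of \<i>]] by (simp add: cinner_eq_Complex complex_eq_iff)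
  obtain v where v: "square_integrable v" "f - p = abs_L2 v"
    by (rule L2_cases)
  have "(LINT t|lborel. v t * indicator A t) = 0" if "A \<in> sets borel" "emeasure lborel A < \<infinity>" for A
    using orth[OF ind[OF that]] v square_integrable_indicator[OF that]
    by (simp add: cinner_abs_L2 cnj_indicator)
  then have le: "AE t in lborel. Re (c * v t) \<le> 0" for c
    using AE_nonpos_if_integrals_vanish[OF v(1)] by blast
  \<comment> \<open>both signs of the real and of the imaginary part of \<open>v\<close>\<close>
  have "AE t in lborel. v t = 0"
    using le[of 1] le[of "- 1"] le[of \<i>] le[of "- \<i>"]
    by eventually_elim (simp add: complex_eq_iff)
  then have "f - p = abs_L2 (\<lambda>_. 0)"
    using v by (simp add: abs_L2_eq_iff square_integrable_zero)
  then have "f = p"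
    by (simp flip: zero_L2.abs_eq)
  then show ?thesis
    using p(1) by (simp add: M_def)
qed

section \<open>Lattice sums and the Wiener amalgam norm\<close>

definition lattice_point :: "real \<Rightarrow> real \<Rightarrow> (int^'d) \<times> (int^'d) \<Rightarrow> (real^'d) \<times> (real^'d)" where
  "lattice_point a b k = (a *\<^sub>R int_vec (fst k), b *\<^sub>R int_vec (snd k))"

lemma gabor_lattice_eq: "gabor_lattice a b = range (lattice_point a b)"
  by (auto simp: gabor_lattice_def lattice_point_def image_iff)

lemma inj_lattice_point:
  assumes "a > 0" "b > 0"
  shows "inj (lattice_point a b :: (int^'d) \<times> (int^'d) \<Rightarrow> _)"
  using assms by (auto simp: inj_on_def lattice_point_def int_vec_def vec_eq_iff prod_eq_iff)

text \<open>
  The integer corner of the unit cube that contains the lattice point with index \<open>k\<close>.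
\<close>

definition cell :: "real \<Rightarrow> real \<Rightarrow> (int^'d) \<times> (int^'d) \<Rightarrow> (int^'d) \<times> (int^'d)" where
  "cell a b k = ((\<chi> i. \<lfloor>a * of_int (fst k $ i)\<rfloor>), (\<chi> i. \<lfloor>b * of_int (snd k $ i)\<rfloor>))"

lemma lattice_point_in_cell:
  "lattice_point a b (k :: (int^'d) \<times> (int^'d::finite)) \<in> (+) (lattice_point 1 1 (cell a b k)) ` cbox 0 One"
proof -
  have "lattice_point a b k - lattice_point 1 1 (cell a b k) \<in> cbox 0 One"
    unfolding mem_box
  proof (intro ballI)
    fix e :: "(real^'d) \<times> (real^'d)"
    assume e: "e \<in> Basis"
    have "0 \<le> (lattice_point a b k - lattice_point 1 1 (cell a b k)) \<bullet> e
        \<and> (lattice_point a b k - lattice_point 1 1 (cell a b k)) \<bullet> e \<le> 1"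
    proof -
      have fl: "real_of_int \<lfloor>x\<rfloor> \<le> x" "x - real_of_int \<lfloor>x\<rfloor> \<le> 1" for x
        by linarith+
      from e obtain i where "e = (axis i 1, 0) \<or> e = (0, axis i 1)"
        by (auto simp: Basis_prod_def Basis_vec_def)
      then show ?thesis
        by (elim disjE) (simp_all add: lattice_point_def cell_def int_vec_def inner_axis fl)
    qed
    with e show "0 \<bullet> e \<le> (lattice_point a b k - lattice_point 1 1 (cell a b k)) \<bullet> e
        \<and> (lattice_point a b k - lattice_point 1 1 (cell a b k)) \<bullet> e \<le> One \<bullet> e"
      by (simp add: inner_sum_left_Basis)
  qed
  then show ?thesis
    by (intro image_eqI[of _ _ "lattice_point a b k - lattice_point 1 1 (cell a b k)"]) auto
qed

lemma cube_sup_upper: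
  fixes m :: "(real^'d::finite) \<times> (real^'d) \<Rightarrow> complex"
  assumes "continuous_on UNIV m" "z \<in> (+) k ` cbox 0 One"
  shows "cmod (m z) \<le> cube_sup m k"
proof -
  have "compact ((+) k ` cbox 0 One)"
    by (intro compact_translation compact_cbox)
  then have "compact ((\<lambda>z. cmod (m z)) ` (+) k ` cbox 0 One)"
    by (intro compact_continuous_image continuous_intros continuous_on_subset[OF assms(1)]) auto
  then have "bdd_above ((\<lambda>z. cmod (m z)) ` (+) k ` cbox 0 One)"
    by (intro bounded_imp_bdd_above compact_imp_bounded)
  then show ?thesis
    unfolding cube_sup_def by (rule cSUP_upper[OF assms(2)])
qed

lemma cube_sup_nonneg:
  fixes m :: "(real^'d::finite) \<times> (real^'d) \<Rightarrow> complex"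
  assumes "continuous_on UNIV m"
  shows "cube_sup m k \<ge> 0"
proof -
  have "k \<in> (+) k ` cbox 0 One"
    by (intro image_eqI[of _ _ 0]) (auto simp: mem_box)
  then show ?thesis
    using cube_sup_upper[OF assms] norm_ge_zero order_trans by blast
qed

lemma wiener_amalgam_index:
  fixes m :: "(real^'d::finite) \<times> (real^'d) \<Rightarrow> complex"
  assumes "m \<in> wiener_amalgam"
  shows "((\<lambda>j. cube_sup m (lattice_point 1 1 j)) has_sum wiener_norm m) UNIV"
proof -
  have "(cube_sup m has_sum wiener_norm m) (range (lattice_point 1 1))"
    using assms unfolding wiener_norm_def gabor_lattice_eq[symmetric] by (simp add: wiener_amalgam_def)
  then show ?thesis
    using has_sum_reindex[OF inj_lattice_point[of 1 1], of "cube_sup m"] by (simp add: o_def)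
qed

lemma wiener_amalgam_continuous: "m \<in> wiener_amalgam \<Longrightarrow> continuous_on UNIV m"
  by (simp add: wiener_amalgam_def)

lemma wiener_amalgam_diff:
  fixes m m' :: "(real^'d::finite) \<times> (real^'d) \<Rightarrow> complex"
  assumes m: "m \<in> wiener_amalgam" and m': "m' \<in> wiener_amalgam"
  shows "(\<lambda>z. m z - m' z) \<in> wiener_amalgam"
proof -
  have cont: "continuous_on UNIV (\<lambda>z. m z - m' z)"
    by (intro continuous_intros wiener_amalgam_continuous m m')
  have le: "cube_sup (\<lambda>z. m z - m' z) k \<le> cube_sup m k + cube_sup m' k" for k
    unfolding cube_sup_def[of "\<lambda>z. m z - m' z"]
  proof (rule cSUP_least)
    fix z
    assume "z \<in> (+) k ` cbox 0 One"
    then have "cmod (m z) \<le> cube_sup m k" "cmod (m' z) \<le> cube_sup m' k"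
      using cube_sup_upper wiener_amalgam_continuous m m' by blast+
    then show "cmod (m z - m' z) \<le> cube_sup m k + cube_sup m' k"
      by norm
  qed simp
  have "cube_sup (\<lambda>z. m z - m' z) summable_on gabor_lattice 1 1"
  proof (rule summable_on_comparison_test)
    show "(\<lambda>k. cube_sup m k + cube_sup m' k) summable_on gabor_lattice 1 1"
      using m m' by (intro summable_on_add) (auto simp: wiener_amalgam_def)
  qed (rule le cube_sup_nonneg[OF cont])+
  with cont show ?thesis
    by (simp add: wiener_amalgam_def)
qed

lemma finite_int_box:
  assumes "\<And>i. finite (S i)"
  shows "finite {v :: int^'d::finite. \<forall>i. v $ i \<in> S i}"
proof (rule finite_subset)
  show "{v :: int^'d. \<forall>i. v $ i \<in> S i} \<subseteq> vec_lambda ` Pi\<^sub>E UNIV S"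
  proof
    fix v :: "int^'d"
    assume "v \<in> {v. \<forall>i. v $ i \<in> S i}"
    then show "v \<in> vec_lambda ` Pi\<^sub>E UNIV S"
      by (intro image_eqI[of _ _ "vec_nth v"]) auto
  qed
  show "finite (vec_lambda ` Pi\<^sub>E UNIV S)"
    by (intro finite_imageI finite_PiE assms) auto
qed

text \<open>
  Consecutive multiples of \<open>a\<close> are at least \<open>1 / q\<close> apart, so indices whose multiples lie in one unit
  interval differ by less than \<open>q\<close> and are determined by their residue modulo \<open>q\<close>.
\<close>

lemma floor_mod_inj:
  fixes k k' :: int and q :: nat
  assumes "\<lfloor>a * of_int k\<rfloor> = \<lfloor>a * of_int k'\<rfloor>" "k mod int q = k' mod int q" "(a::real) * q \<ge> 1" "a > 0"
  shows "k = k'"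
proof (rule ccontr)
  assume ne: "k \<noteq> k'"
  have "\<bar>a * of_int k - a * of_int k'\<bar> < 1"
    using assms(1) by linarith
  then have "a * of_int \<bar>k - k'\<bar> < 1"
    using assms(4) by (simp add: abs_mult flip: right_diff_distrib)
  then have "a * of_int \<bar>k - k'\<bar> < a * q"
    using assms(3) by linarith
  then have "\<bar>k - k'\<bar> < int q"
    using assms(4) by (simp flip: of_int_less_iff[where 'a = real])
  moreover have "int q dvd k - k'"
    using assms(2) by (simp add: mod_eq_dvd_iff)
  ultimately show False
    using ne zdvd_not_zless[of "\<bar>k - k'\<bar>" "int q"] by auto
qed

text \<open>
  Its cardinality \<open>q\<^bsup>2 d\<^esup>\<close> bounds the number of lattice points in a unit cube for all parameters
  \<open>a, b \<ge> 1 / q\<close> at once.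
\<close>

definition residues_box :: "nat \<Rightarrow> ((int^'d) \<times> (int^'d)) set" where
  "residues_box q = {v. \<forall>i. v $ i \<in> {0..<int q}} \<times> {v. \<forall>i. v $ i \<in> {0..<int q}}"

lemma finite_residues_box: "finite (residues_box q :: ((int^'d::finite) \<times> (int^'d)) set)"
  unfolding residues_box_def by (intro finite_cartesian_product finite_int_box) auto

lemma card_cell_le:
  fixes F :: "((int^'d::finite) \<times> (int^'d)) set"
  assumes ab: "a > 0" "b > 0" "a * q \<ge> 1" "b * q \<ge> 1"
  shows "card {k \<in> F. cell a b k = j} \<le> card (residues_box q :: ((int^'d) \<times> (int^'d)) set)"
proof (rule card_inj_on_le[OF _ _ finite_residues_box])
  have q: "int q > 0"
    using ab by (cases q) auto
  let ?r = "\<lambda>k :: (int^'d) \<times> (int^'d). ((\<chi> i. fst k $ i mod int q), (\<chi> i. snd k $ i mod int q))"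
  show "?r ` {k \<in> F. cell a b k = j} \<subseteq> residues_box q"
    using q by (auto simp: residues_box_def)
  show "inj_on ?r {k \<in> F. cell a b k = j}"
  proof (rule inj_onI)
    fix k k'
    assume "k \<in> {k \<in> F. cell a b k = j}" "k' \<in> {k \<in> F. cell a b k = j}"
      and r: "?r k = ?r k'"
    then have c: "cell a b k = cell a b k'"
      by simp
    have "fst k $ i = fst k' $ i" for i
    proof (rule floor_mod_inj[OF _ _ ab(3,1)])
      show "\<lfloor>a * of_int (fst k $ i)\<rfloor> = \<lfloor>a * of_int (fst k' $ i)\<rfloor>"
        using arg_cong[OF c, of "\<lambda>x. fst x $ i"] by (simp add: cell_def)
      show "fst k $ i mod int q = fst k' $ i mod int q"
        using arg_cong[OF r, of "\<lambda>x. fst x $ i"] by simp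
    qed
    moreover have "snd k $ i = snd k' $ i" for i
    proof (rule floor_mod_inj[OF _ _ ab(4,2)])
      show "\<lfloor>b * of_int (snd k $ i)\<rfloor> = \<lfloor>b * of_int (snd k' $ i)\<rfloor>"
        using arg_cong[OF c, of "\<lambda>x. snd x $ i"] by (simp add: cell_def)
      show "snd k $ i mod int q = snd k' $ i mod int q"
        using arg_cong[OF r, of "\<lambda>x. snd x $ i"] by simp
    qed
    ultimately show "k = k'"
      by (simp add: prod_eq_iff vec_eq_iff)
  qed
qed

text \<open>
  Group the lattice points by the unit cube that contains them, and bound \<open>m\<close> on each cube by its
  supremum.
\<close>

lemma lattice_sum_le:
  fixes m :: "(real^'d::finite) \<times> (real^'d) \<Rightarrow> complex" and A :: "((int^'d) \<times> (int^'d)) set"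
  assumes m: "m \<in> wiener_amalgam" and ab: "a > 0" "b > 0" "a * q \<ge> 1" "b * q \<ge> 1"
    and K: "\<And>k. k \<in> K \<Longrightarrow> cell a b k \<in> A"
  defines "N \<equiv> card (residues_box q :: ((int^'d) \<times> (int^'d)) set)"
  shows "(\<lambda>k. cmod (m (lattice_point a b k))) summable_on K"
    and "(\<Sum>\<^sub>\<infinity>k\<in>K. cmod (m (lattice_point a b k))) \<le> N * (\<Sum>\<^sub>\<infinity>j\<in>A. cube_sup m (lattice_point 1 1 j))"
proof -
  let ?f = "\<lambda>k. cmod (m (lattice_point a b k))" and ?c = "\<lambda>j. cube_sup m (lattice_point 1 1 j)"
  note cont = wiener_amalgam_continuous[OF m]
  have c: "?c summable_on A"
    using summable_on_subset_banach[OF has_sum_imp_summable[OF wiener_amalgam_index[OF m]]] by blast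
  have bound: "sum ?f F \<le> N * infsum ?c A" if F: "finite F" "F \<subseteq> K" for F
  proof -
    have "sum ?f F \<le> (\<Sum>k\<in>F. ?c (cell a b k))"
      by (intro sum_mono cube_sup_upper[OF cont] lattice_point_in_cell)
    also have "\<dots> = (\<Sum>j\<in>cell a b ` F. \<Sum>k\<in>{k \<in> F. cell a b k = j}. ?c (cell a b k))"
      by (rule sum.image_gen[OF F(1)])
    also have "\<dots> = (\<Sum>j\<in>cell a b ` F. card {k \<in> F. cell a b k = j} * ?c j)"
      by simp
    also have "\<dots> \<le> (\<Sum>j\<in>cell a b ` F. N * ?c j)"
      unfolding N_def by (intro sum_mono mult_right_mono cube_sup_nonneg[OF cont] of_nat_mono card_cell_le ab)
    also have "\<dots> = N * (\<Sum>j\<in>cell a b ` F. ?c j)"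
      by (simp add: sum_distrib_left)
    also have "\<dots> \<le> N * infsum ?c A"
      using F K by (intro mult_left_mono finite_sum_le_infsum c cube_sup_nonneg[OF cont]) auto
    finally show ?thesis .
  qed
  show s: "?f summable_on K"
    by (rule nonneg_bdd_above_summable_on) (auto intro!: bdd_aboveI2 bound)
  show "infsum ?f K \<le> N * infsum ?c A"
    by (rule infsum_le_finite_sums[OF s bound])
qed

lemma cell_eq_imp_bounded:
  assumes "\<lfloor>a * of_int k\<rfloor> = j" "(a::real) * q \<ge> 1" "a > 0"
  shows "k \<in> {- (int q * (\<bar>j\<bar> + 1))..int q * (\<bar>j\<bar> + 1)}"
proof -
  have "real_of_int j \<le> a * of_int k" "a * of_int k < real_of_int j + 1"
    using assms(1) by linarith+
  then have "\<bar>a * of_int k\<bar> \<le> of_int \<bar>j\<bar> + 1"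
    by simp
  then have "a * of_int \<bar>k\<bar> \<le> of_int (\<bar>j\<bar> + 1)"
    using assms(3) by (simp add: abs_mult)
  also have "\<dots> \<le> (a * q) * of_int (\<bar>j\<bar> + 1)"
    using mult_right_mono[OF assms(2), of "of_int (\<bar>j\<bar> + 1)"] by simp
  finally have "a * of_int \<bar>k\<bar> \<le> a * of_int (int q * (\<bar>j\<bar> + 1))"
    by (simp add: mult.assoc)
  then have "real_of_int \<bar>k\<bar> \<le> of_int (int q * (\<bar>j\<bar> + 1))"
    using assms(3) by (simp only: mult_le_cancel_left_pos)
  then have "\<bar>k\<bar> \<le> int q * (\<bar>j\<bar> + 1)"
    by (simp only: of_int_le_iff)
  then show ?thesis
    unfolding atLeastAtMost_iff by linarith
qed

text \<open>
  Choose finitely many unit cubes \<open>F\<close> that carry almost all of the Wiener norm. An index \<open>k\<close> whose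
  lattice point falls into a cube of \<open>F\<close> is bounded in terms of \<open>F\<close> and \<open>q\<close> alone, because \<open>a\<close> and \<open>b\<close>
  are at least \<open>1 / q\<close>; these indices form the finite set \<open>K\<close>.
\<close>

lemma lattice_sum_uniform_tail:
  fixes m :: "(real^'d::finite) \<times> (real^'d) \<Rightarrow> complex"
  assumes m: "m \<in> wiener_amalgam" and \<epsilon>: "\<epsilon> > 0"
  shows "\<exists>K. finite K \<and> (\<forall>a b. a > 0 \<and> b > 0 \<and> a * real q \<ge> 1 \<and> b * real q \<ge> 1 \<longrightarrow>
    (\<Sum>\<^sub>\<infinity>k\<in>- K. cmod (m (lattice_point a b k))) \<le> \<epsilon>)"
proof -
  define N where "N = card (residues_box q :: ((int^'d) \<times> (int^'d)) set)"
  let ?c = "\<lambda>j. cube_sup m (lattice_point 1 1 j)"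
  obtain F where F: "finite F" "dist (sum ?c F) (wiener_norm m) \<le> \<epsilon> / (N + 1)"
    using has_sum_finite_approximation[OF wiener_amalgam_index[OF m], of "\<epsilon> / (N + 1)"] \<epsilon> by auto
  have "(?c has_sum (wiener_norm m - sum ?c F)) (UNIV - F)"
    by (rule has_sum_Diff[OF wiener_amalgam_index[OF m] has_sum_finite[OF F(1)]]) simp
  then have "infsum ?c (- F) = wiener_norm m - sum ?c F"
    by (simp add: infsumI Compl_eq_Diff_UNIV)
  then have tail: "infsum ?c (- F) \<le> \<epsilon> / (N + 1)"
    using F(2) by (simp add: dist_real_def)
  define K where "K = (\<Union>j\<in>F. {v. \<forall>i. v $ i \<in> {- (int q * (\<bar>fst j $ i\<bar> + 1))..int q * (\<bar>fst j $ i\<bar> + 1)}} \<times>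
      {v. \<forall>i. v $ i \<in> {- (int q * (\<bar>snd j $ i\<bar> + 1))..int q * (\<bar>snd j $ i\<bar> + 1)}})"
  have "finite K"
    unfolding K_def using F(1) by (intro finite_UN_I finite_cartesian_product finite_int_box) auto
  moreover have "(\<Sum>\<^sub>\<infinity>k\<in>- K. cmod (m (lattice_point a b k))) \<le> \<epsilon>"
    if ab: "a > 0" "b > 0" "a * real q \<ge> 1" "b * real q \<ge> 1" for a b
  proof -
    have "cell a b k \<in> - F" if "k \<in> - K" for k
    proof
      assume "cell a b k \<in> F"
      moreover have "fst k $ i \<in> {- (int q * (\<bar>fst (cell a b k) $ i\<bar> + 1))..int q * (\<bar>fst (cell a b k) $ i\<bar> + 1)}"
        "snd k $ i \<in> {- (int q * (\<bar>snd (cell a b k) $ i\<bar> + 1))..int q * (\<bar>snd (cell a b k) $ i\<bar> + 1)}" for i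
        by (rule cell_eq_imp_bounded[OF _ ab(3,1)] cell_eq_imp_bounded[OF _ ab(4,2)], simp add: cell_def)+
      ultimately have "k \<in> K"
        unfolding K_def by (intro UN_I[of "cell a b k"]) (auto simp: mem_Times_iff)
      with that show False
        by simp
    qed
    then have "(\<Sum>\<^sub>\<infinity>k\<in>- K. cmod (m (lattice_point a b k))) \<le> N * infsum ?c (- F)"
      unfolding N_def by (rule lattice_sum_le(2)[OF m ab])
    also have "\<dots> \<le> N * (\<epsilon> / (N + 1))"
      by (rule mult_left_mono[OF tail]) simp
    also have "\<dots> \<le> \<epsilon>"
      using \<epsilon> by (simp add: field_simps)
    finally show ?thesis .
  qed
  ultimately show ?thesis
    by blast
qed

section \<open>Convergence of mixed-state Gabor multipliers\<close>

definition gabor_term ::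
  "'d::finite op \<Rightarrow> ((real^'d) \<times> (real^'d) \<Rightarrow> complex) \<Rightarrow> (real^'d) \<times> (real^'d) \<Rightarrow> 'd op" where
  "gabor_term S m z = cmul (m z) o\<^sub>L conjugated (tf_shift z) S"

text \<open>
  The lattices for different parameters have the same index set, which is what allows the
  termwise comparison.
\<close>

definition gabor_sum ::
  "'d::finite op \<Rightarrow> ((real^'d) \<times> (real^'d) \<Rightarrow> complex) \<Rightarrow> real \<Rightarrow> real \<Rightarrow> 'd op" where
  "gabor_sum S m a b = (\<Sum>\<^sub>\<infinity>k. gabor_term S m (lattice_point a b k))"

lemma mixed_gabor_multiplier_eq:
  fixes S :: "'d::finite op"
  assumes "a > 0" "b > 0"
  shows "mixed_gabor_multiplier S m a b = (a ^ CARD('d) * b ^ CARD('d)) *\<^sub>R gabor_sum S m a b"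
  unfolding mixed_gabor_multiplier_def gabor_sum_def gabor_lattice_eq
  by (subst infsum_reindex[OF inj_lattice_point[OF assms]]) (simp add: o_def gabor_term_def)

lemma norm_gabor_term_le: "norm (gabor_term S m z) \<le> cmod (m z) * norm S"
proof (rule norm_blinfun_bound)
  fix f
  have "norm (gabor_term S m z f) = cmod (m z) * norm (S (((tf_shift z)\<^sup>\<dagger>) f))"
    by (simp add: gabor_term_def norm_scaleC norm_tf_shift)
  also have "\<dots> \<le> cmod (m z) * (norm S * norm f)"
    using norm_blinfun[of S "((tf_shift z)\<^sup>\<dagger>) f"]
    by (intro mult_left_mono) (simp_all add: unitary_op_norm[OF unitary_op_tf_shift])
  finally show "norm (gabor_term S m z f) \<le> cmod (m z) * norm S * norm f"
    by (simp add: mult.assoc)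
qed simp

text \<open>
  Turns the estimates for a fixed \<open>q\<close> into estimates that are uniform along a sequence of lattices
  with parameters bounded away from \<open>0\<close>.
\<close>

lemma ex_density_bound:
  fixes a b :: real
  assumes "a > 0" "b > 0"
  shows "\<exists>q::nat. \<forall>a' b'. a' \<ge> a \<and> b' \<ge> b \<longrightarrow> a' * q \<ge> 1 \<and> b' * q \<ge> 1"
proof -
  obtain q where q: "real q \<ge> max (1 / a) (1 / b)"
    using real_arch_simple by blast
  have "a' * q \<ge> 1 \<and> b' * q \<ge> 1" if "a' \<ge> a" "b' \<ge> b" for a' b'
  proof -
    have "1 \<le> a * q" "1 \<le> b * q"
      using q assms by (auto simp: field_simps)
    moreover have "a * q \<le> a' * q" "b * q \<le> b' * q"
      using that by (auto intro: mult_right_mono)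
    ultimately show ?thesis
      by linarith
  qed
  then show ?thesis
    by blast
qed

lemma summable_lattice:
  fixes m :: "(real^'d::finite) \<times> (real^'d) \<Rightarrow> complex"
  assumes m: "m \<in> wiener_amalgam" and ab: "a > 0" "b > 0"
  shows "(\<lambda>k. cmod (m (lattice_point a b k))) summable_on K"
proof -
  obtain q :: nat where q: "a * q \<ge> 1" "b * q \<ge> 1"
    using ex_density_bound[OF ab] by (metis order_refl)
  show ?thesis
    by (rule lattice_sum_le(1)[OF m ab q UNIV_I])
qed

lemma has_sum_gabor_sum:
  fixes S :: "'d::finite op"
  assumes m: "m \<in> wiener_amalgam" and ab: "a > 0" "b > 0"
  shows "((\<lambda>k. gabor_term S m (lattice_point a b k)) has_sum gabor_sum S m a b) UNIV"
proof -
  have "(\<lambda>k. cmod (m (lattice_point a b k)) * norm S) summable_on UNIV"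
    by (intro summable_on_cmult_left summable_lattice m ab)
  then have "(\<lambda>k. gabor_term S m (lattice_point a b k)) abs_summable_on UNIV"
    by (rule summable_on_comparison_test) (simp_all add: norm_gabor_term_le)
  then show ?thesis
    unfolding gabor_sum_def by (rule has_sum_infsum[OF abs_summable_summable])
qed

lemma clinear_op_has_sum:
  fixes T :: "'j \<Rightarrow> 'd::finite op"
  assumes T: "(T has_sum S) J" and "\<And>j. j \<in> J \<Longrightarrow> clinear_op (T j)"
  shows "clinear_op S"
  unfolding clinear_op_def
proof (intro allI)
  fix c f
  have "((\<lambda>j. T j (c *\<^sub>C f)) has_sum S (c *\<^sub>C f)) J"
    by (rule has_sum_bounded_linear[OF blinfun.bounded_linear_left T])
  moreover have "((\<lambda>j. cmul c (T j f)) has_sum cmul c (S f)) J"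
    by (intro has_sum_bounded_linear[OF blinfun.bounded_linear_right] has_sum_bounded_linear[OF blinfun.bounded_linear_left] T)
  then have "((\<lambda>j. T j (c *\<^sub>C f)) has_sum c *\<^sub>C S f) J"
    using assms(2) by (subst has_sum_cong[where g = "\<lambda>j. cmul c (T j f)"]) (simp_all add: clinear_op_scaleC)
  ultimately show "S (c *\<^sub>C f) = c *\<^sub>C S f"
    by (rule has_sum_unique)
qed

lemma clinear_op_gabor_sum:
  assumes "clinear_op S" "m \<in> wiener_amalgam" "a > 0" "b > 0"
  shows "clinear_op (gabor_sum S m a b)"
  by (rule clinear_op_has_sum[OF has_sum_gabor_sum[OF assms(2-4)]])
    (auto simp: gabor_term_def intro!: clinear_op_compose clinear_op_cmul clinear_op_tf_shift clinear_op_adjoint assms)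

lemma trace_le_gabor_term:
  assumes "trace_le S C"
  shows "trace_le (gabor_term S m z) (cmod (m z) * C)"
  unfolding gabor_term_def by (intro trace_le_cmul trace_le_conjugated assms unitary_op_tf_shift)

lemma trace_le_gabor_sum:
  fixes S :: "'d::finite op"
  assumes S: "trace_le S C" and m: "m \<in> wiener_amalgam" and ab: "a > 0" "b > 0" "a * q \<ge> 1" "b * q \<ge> 1"
  shows "trace_le (gabor_sum S m a b) (card (residues_box q :: ((int^'d) \<times> (int^'d)) set) * wiener_norm m * C)"
proof (rule trace_le_mono)
  let ?f = "\<lambda>k. cmod (m (lattice_point a b k))"
  have s: "?f summable_on UNIV"
    by (rule summable_lattice[OF m ab(1,2)])
  show "trace_le (gabor_sum S m a b) (infsum ?f UNIV * C)"
    by (rule trace_le_has_sum[OF has_sum_gabor_sum[OF m ab(1,2)] has_sum_cmult_left[OF has_sum_infsum[OF s]]])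
      (rule trace_le_gabor_term[OF S])
  show "infsum ?f UNIV * C \<le> card (residues_box q :: ((int^'d) \<times> (int^'d)) set) * wiener_norm m * C"
    using lattice_sum_le(2)[OF m ab, of UNIV UNIV] infsumI[OF wiener_amalgam_index[OF m]]
    by (intro mult_right_mono trace_le_nonneg[OF S]) simp
qed

lemma trace_class_mixed_gabor_multiplier:
  fixes S :: "'d::finite op"
  assumes S: "trace_class S" and m: "m \<in> wiener_amalgam" and ab: "a > 0" "b > 0"
  shows "trace_class (mixed_gabor_multiplier S m a b)"
proof -
  obtain B :: "'d L2 set" where B: "orthonormal_basis B"
    using trace_class_ex_basis[OF S] by blast
  obtain q :: nat where q: "a * q \<ge> 1" "b * q \<ge> 1"
    using ex_density_bound[OF ab] by (metis order_refl)
  show ?thesis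
    using trace_le_scaleR[OF trace_le_gabor_sum[OF trace_le_trace_norm[OF S] m ab q]]
      clinear_op_scaleR[OF clinear_op_gabor_sum[OF trace_class_clinear[OF S] m ab]]
    unfolding trace_class_iff[OF B] mixed_gabor_multiplier_eq[OF ab] by blast
qed

text \<open>
  Convergence in trace norm without reference to an orthonormal basis.
\<close>

definition trace_tendsto :: "(nat \<Rightarrow> 'd::finite op) \<Rightarrow> 'd op \<Rightarrow> bool" where
  "trace_tendsto T T0 \<longleftrightarrow> (\<forall>\<epsilon>>0. \<forall>\<^sub>F n in sequentially. trace_le (T n - T0) \<epsilon>)"

lemma trace_tendstoI:
  assumes "\<forall>\<^sub>F n in sequentially. trace_le (T n - T0) (c n)" "c \<longlonglongrightarrow> 0"
  shows "trace_tendsto T T0"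
  unfolding trace_tendsto_def
proof (intro allI impI)
  fix \<epsilon> :: real
  assume "\<epsilon> > 0"
  then have "\<forall>\<^sub>F n in sequentially. c n < \<epsilon>"
    by (rule order_tendstoD(2)[OF assms(2)])
  with assms(1) show "\<forall>\<^sub>F n in sequentially. trace_le (T n - T0) \<epsilon>"
    by eventually_elim (auto intro: trace_le_mono)
qed

lemma tendsto_S1_if_trace_tendsto:
  fixes T :: "nat \<Rightarrow> 'd::finite op" and B :: "'d L2 set"
  assumes B: "orthonormal_basis B" and T: "\<And>n. trace_class (T n)" "trace_class T0" "trace_tendsto T T0"
  shows "tendsto_S1 T T0"
proof -
  have cl: "clinear_op (T n - T0)" for n
    by (intro clinear_op_diff trace_class_clinear T)
  have "(\<lambda>n. trace_norm (T n - T0)) \<longlonglongrightarrow> 0"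
  proof (rule order_tendstoI)
    fix \<epsilon> :: real
    assume "\<epsilon> > 0"
    then have "\<forall>\<^sub>F n in sequentially. trace_le (T n - T0) (\<epsilon> / 2)"
      using T(3) by (simp add: trace_tendsto_def)
    then show "\<forall>\<^sub>F n in sequentially. trace_norm (T n - T0) < \<epsilon>"
      by eventually_elim (use trace_norm_le[OF B cl] \<open>\<epsilon> > 0\<close> in fastforce)
  next
    fix \<epsilon> :: real
    assume "\<epsilon> < 0"
    then show "\<forall>\<^sub>F n in sequentially. \<epsilon> < trace_norm (T n - T0)"
      by (intro always_eventually allI less_le_trans[OF _ trace_norm_nonneg[OF cl]])
  qed
  then show ?thesis
    using T by (simp add: tendsto_S1_def)
qed

lemma trace_tendsto_add:
  assumes "trace_tendsto S S0" "trace_tendsto T T0"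
  shows "trace_tendsto (\<lambda>n. S n + T n) (S0 + T0)"
  unfolding trace_tendsto_def
proof (intro allI impI)
  fix \<epsilon> :: real
  assume "\<epsilon> > 0"
  then have "\<forall>\<^sub>F n in sequentially. trace_le (S n - S0) (\<epsilon> / 2)" "\<forall>\<^sub>F n in sequentially. trace_le (T n - T0) (\<epsilon> / 2)"
    using assms unfolding trace_tendsto_def by (meson half_gt_zero)+
  then show "\<forall>\<^sub>F n in sequentially. trace_le (S n + T n - (S0 + T0)) \<epsilon>"
  proof eventually_elim
    fix n
    assume "trace_le (S n - S0) (\<epsilon> / 2)" "trace_le (T n - T0) (\<epsilon> / 2)"
    from trace_le_add[OF this] show "trace_le (S n + T n - (S0 + T0)) \<epsilon>"
      by (simp add: algebra_simps)
  qed
qed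

lemma trace_tendsto_const: "trace_tendsto (\<lambda>n. T) T"
  by (rule trace_tendstoI[of _ _ "\<lambda>_. 0"]) (simp_all add: trace_le_zero)

lemma trace_tendsto_sum:
  assumes "finite A" "\<And>x. x \<in> A \<Longrightarrow> trace_tendsto (\<lambda>n. T n x) (T0 x)"
  shows "trace_tendsto (\<lambda>n. \<Sum>x\<in>A. T n x) (\<Sum>x\<in>A. T0 x)"
  using assms by (induction A rule: finite_induct) (auto intro: trace_tendsto_add trace_tendsto_const)

lemma trace_tendsto_scaled:
  fixes c :: "nat \<Rightarrow> complex"
  assumes T: "trace_tendsto T T0" and T0: "trace_le T0 D" and c: "c \<longlonglongrightarrow> c0"
  shows "trace_tendsto (\<lambda>n. cmul (c n) o\<^sub>L T n) (cmul c0 o\<^sub>L T0)"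
  unfolding trace_tendsto_def
proof (intro allI impI)
  fix \<epsilon> :: real
  assume \<epsilon>: "\<epsilon> > 0"
  define \<delta> where "\<delta> = \<epsilon> / (2 * (cmod c0 + 1))"
  have pos: "cmod c0 + 1 > 0"
    by (simp add: add_nonneg_pos)
  then have \<delta>: "\<delta> > 0" "(cmod c0 + 1) * \<delta> = \<epsilon> / 2"
    using \<epsilon> by (auto simp: \<delta>_def field_simps)
  have 1: "\<forall>\<^sub>F n in sequentially. trace_le (T n - T0) \<delta>"
    using T \<delta>(1) by (auto simp: trace_tendsto_def)
  have 2: "\<forall>\<^sub>F n in sequentially. cmod (c n) < cmod c0 + 1"
    by (rule order_tendstoD(2)[OF tendsto_norm[OF c]]) simp
  have "(\<lambda>n. cmod (c n - c0) * D) \<longlonglongrightarrow> 0"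
    by (intro tendsto_mult_left_zero tendsto_norm_zero LIM_zero c)
  then have 3: "\<forall>\<^sub>F n in sequentially. cmod (c n - c0) * D < \<epsilon> / 2"
    by (rule order_tendstoD(2)) (use \<epsilon> in simp)
  from 1 2 3 show "\<forall>\<^sub>F n in sequentially. trace_le ((cmul (c n) o\<^sub>L T n) - (cmul c0 o\<^sub>L T0)) \<epsilon>"
  proof eventually_elim
    fix n
    assume *: "trace_le (T n - T0) \<delta>" "cmod (c n) < cmod c0 + 1" "cmod (c n - c0) * D < \<epsilon> / 2"
    have "(cmul (c n) o\<^sub>L T n) - (cmul c0 o\<^sub>L T0) = (cmul (c n) o\<^sub>L (T n - T0)) + (cmul (c n - c0) o\<^sub>L T0)"
      by (rule blinfun_eqI)
        (simp add: blinfun.diff_left blinfun.add_left scaleC_diff_left scaleC_diff_right)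
    moreover have "trace_le ((cmul (c n) o\<^sub>L (T n - T0)) + (cmul (c n - c0) o\<^sub>L T0)) (cmod (c n) * \<delta> + cmod (c n - c0) * D)"
      by (intro trace_le_add trace_le_cmul * T0)
    moreover have "cmod (c n) * \<delta> \<le> (cmod c0 + 1) * \<delta>"
      using * \<delta> by (intro mult_right_mono) auto
    ultimately show "trace_le ((cmul (c n) o\<^sub>L T n) - (cmul c0 o\<^sub>L T0)) \<epsilon>"
      using * \<delta>(2) by (auto intro: trace_le_mono)
  qed
qed

lemma conjugated_diff: "conjugated W (S - T) = conjugated W S - conjugated W T"
  by (rule blinfun_eqI) (simp add: blinfun.diff_left blinfun.diff_right)

lemma conjugated_sum: "conjugated W (\<Sum>x\<in>A. T x) = (\<Sum>x\<in>A. conjugated W (T x))"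
  by (rule blinfun_eqI) (simp add: blinfun.sum_left blinfun.sum_right)

text \<open>
  Conjugation does not increase the trace norm, so \<open>S\<close> may be replaced by an operator of finite rank;
  for rank one, conjugation just shifts the two vectors.
\<close>

lemma trace_tendsto_conjugated_tf_shift:
  fixes S :: "'d::finite op"
  assumes S: "trace_class S" and z: "z \<longlonglongrightarrow> z0"
  shows "trace_tendsto (\<lambda>n. conjugated (tf_shift (z n)) S) (conjugated (tf_shift z0) S)"
  unfolding trace_tendsto_def
proof (intro allI impI)
  fix \<epsilon> :: real
  assume \<epsilon>: "\<epsilon> > 0"
  obtain F :: "'d L2 set" and a b where F: "finite F" "trace_le (S - (\<Sum>e\<in>F. rank_one (a e) (b e))) (\<epsilon> / 3)"
    using finite_rank_approximation[OF S, of "\<epsilon> / 3"] \<epsilon> by auto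
  define R where "R = (\<Sum>e\<in>F. rank_one (a e) (b e))"
  have conj: "conjugated (tf_shift w) R = (\<Sum>e\<in>F. rank_one (tf_shift w (a e)) (tf_shift w (b e)))" for w
    by (simp add: R_def conjugated_sum conjugated_rank_one unitary_op_tf_shift)
  have "trace_tendsto (\<lambda>n. conjugated (tf_shift (z n)) R) (conjugated (tf_shift z0) R)"
    unfolding conj
  proof (rule trace_tendsto_sum[OF F(1)])
    fix e
    show "trace_tendsto (\<lambda>n. rank_one (tf_shift (z n) (a e)) (tf_shift (z n) (b e)))
        (rank_one (tf_shift z0 (a e)) (tf_shift z0 (b e)))"
    proof (rule trace_tendstoI)
      show "\<forall>\<^sub>F n in sequentially. trace_le
          (rank_one (tf_shift (z n) (a e)) (tf_shift (z n) (b e)) - rank_one (tf_shift z0 (a e)) (tf_shift z0 (b e)))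
          (norm (tf_shift (z n) (a e) - tf_shift z0 (a e)) * norm (b e)
            + norm (a e) * norm (tf_shift (z n) (b e) - tf_shift z0 (b e)))"
        using trace_le_rank_one_diff[of "tf_shift (z _) (a e)" "tf_shift (z _) (b e)" "tf_shift z0 (a e)" "tf_shift z0 (b e)"]
        by (simp add: norm_tf_shift)
      show "(\<lambda>n. norm (tf_shift (z n) (a e) - tf_shift z0 (a e)) * norm (b e)
            + norm (a e) * norm (tf_shift (z n) (b e) - tf_shift z0 (b e))) \<longlonglongrightarrow> 0"
        by (intro tendsto_add_zero tendsto_mult_left_zero tendsto_mult_right_zero tendsto_norm_zero LIM_zero
            tendsto_tf_shift z)
    qed
  qed
  then have "\<forall>\<^sub>F n in sequentially. trace_le (conjugated (tf_shift (z n)) R - conjugated (tf_shift z0) R) (\<epsilon> / 3)"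
    using \<epsilon> by (simp add: trace_tendsto_def)
  then show "\<forall>\<^sub>F n in sequentially. trace_le (conjugated (tf_shift (z n)) S - conjugated (tf_shift z0) S) \<epsilon>"
  proof eventually_elim
    fix n
    assume *: "trace_le (conjugated (tf_shift (z n)) R - conjugated (tf_shift z0) R) (\<epsilon> / 3)"
    have SR: "trace_le (conjugated (tf_shift w) (S - R)) (\<epsilon> / 3)" for w
      using F(2) by (intro trace_le_conjugated unitary_op_tf_shift) (simp add: R_def)
    have "trace_le (conjugated (tf_shift (z n)) (S - R) - conjugated (tf_shift z0) (S - R)
        + (conjugated (tf_shift (z n)) R - conjugated (tf_shift z0) R)) (\<epsilon> / 3 + \<epsilon> / 3 + \<epsilon> / 3)"
      by (intro trace_le_add trace_le_diff SR *)
    then show "trace_le (conjugated (tf_shift (z n)) S - conjugated (tf_shift z0) S) \<epsilon>"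
      by (simp add: conjugated_diff)
  qed
qed

lemma trace_tendsto_gabor_term:
  fixes S :: "'d::finite op"
  assumes S: "trace_class S" and m: "continuous_on UNIV m" and z: "z \<longlonglongrightarrow> z0"
  shows "trace_tendsto (\<lambda>n. gabor_term S m (z n)) (gabor_term S m z0)"
  unfolding gabor_term_def
proof (rule trace_tendsto_scaled)
  show "trace_tendsto (\<lambda>n. conjugated (tf_shift (z n)) S) (conjugated (tf_shift z0) S)"
    by (rule trace_tendsto_conjugated_tf_shift[OF S z])
  show "trace_le (conjugated (tf_shift z0) S) (trace_norm S)"
    by (intro trace_le_conjugated trace_le_trace_norm S unitary_op_tf_shift)
  show "(\<lambda>n. m (z n)) \<longlonglongrightarrow> m z0"
    using continuous_on_tendsto_compose[OF m z] by simp
qed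

lemma tendsto_lattice_point:
  assumes "a \<longlonglongrightarrow> a0" "b \<longlonglongrightarrow> b0"
  shows "(\<lambda>n. lattice_point (a n) (b n) k) \<longlonglongrightarrow> lattice_point a0 b0 k"
  unfolding lattice_point_def by (intro tendsto_intros assms)

text \<open>
  Up to \<open>\<epsilon> / 3\<close>, uniformly in the lattice, the sum is its finite part \<open>H\<close> over the index set \<open>K\<close>.
\<close>

lemma trace_tendsto_gabor_sum_lattice:
  fixes S :: "'d::finite op"
  assumes S: "trace_class S" and m: "m \<in> wiener_amalgam"
    and a: "\<And>n. a n > (0::real)" "a0 > 0" "a \<longlonglongrightarrow> a0"
    and b: "\<And>n. b n > (0::real)" "b0 > 0" "b \<longlonglongrightarrow> b0"
    and q: "a0 * real q \<ge> 1" "b0 * q \<ge> 1" "\<forall>\<^sub>F n in sequentially. a n * q \<ge> 1 \<and> b n * q \<ge> 1"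
  shows "trace_tendsto (\<lambda>n. gabor_sum S m (a n) (b n)) (gabor_sum S m a0 b0)"
  unfolding trace_tendsto_def
proof (intro allI impI)
  fix \<epsilon> :: real
  assume \<epsilon>: "\<epsilon> > 0"
  define C where "C = trace_norm S"
  have C: "trace_le S C" "C \<ge> 0"
    using trace_le_trace_norm[OF S] trace_le_nonneg by (auto simp: C_def)
  \<comment> \<open>\<open>C\<close> may be \<open>0\<close>, hence the \<open>C + 1\<close> in the tolerance for the tail\<close>
  have "\<epsilon> / (3 * (C + 1)) > 0"
    using \<epsilon> C(2) by simp
  then obtain K :: "((int^'d) \<times> (int^'d)) set" where K: "finite K"
    "\<And>a b. a > 0 \<Longrightarrow> b > 0 \<Longrightarrow> a * real q \<ge> 1 \<Longrightarrow> b * real q \<ge> 1 \<Longrightarrow>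
      (\<Sum>\<^sub>\<infinity>k\<in>- K. cmod (m (lattice_point a b k))) \<le> \<epsilon> / (3 * (C + 1))"
    using lattice_sum_uniform_tail[OF m] by meson
  define H where "H a b = (\<Sum>k\<in>K. gabor_term S m (lattice_point a b k))" for a b
  have tail: "trace_le (gabor_sum S m a b - H a b) (\<epsilon> / 3)"
    if ab: "a > 0" "b > 0" "a * real q \<ge> 1" "b * real q \<ge> 1" for a b
  proof (rule trace_le_mono)
    let ?f = "\<lambda>k. cmod (m (lattice_point a b k))"
    have "((\<lambda>k. gabor_term S m (lattice_point a b k)) has_sum (gabor_sum S m a b - H a b)) (UNIV - K)"
      unfolding H_def by (rule has_sum_Diff[OF has_sum_gabor_sum[OF m ab(1,2)] has_sum_finite[OF K(1)]]) simp
    then have "((\<lambda>k. gabor_term S m (lattice_point a b k)) has_sum (gabor_sum S m a b - H a b)) (- K)"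
      by (simp add: Compl_eq_Diff_UNIV)
    then show "trace_le (gabor_sum S m a b - H a b) (infsum ?f (- K) * C)"
      by (rule trace_le_has_sum[OF _ has_sum_cmult_left[OF has_sum_infsum[OF summable_lattice[OF m ab(1,2)]]]])
        (rule trace_le_gabor_term[OF C(1)])
    have "infsum ?f (- K) * C \<le> \<epsilon> / (3 * (C + 1)) * C"
      by (intro mult_right_mono K(2) ab C(2))
    also have "\<dots> \<le> \<epsilon> / 3"
      using \<epsilon> C(2) by (simp add: field_simps)
    finally show "infsum ?f (- K) * C \<le> \<epsilon> / 3" .
  qed
  have "trace_tendsto (\<lambda>n. H (a n) (b n)) (H a0 b0)"
    unfolding H_def
    by (intro trace_tendsto_sum K(1) trace_tendsto_gabor_term S wiener_amalgam_continuous[OF m]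
        tendsto_lattice_point a b)
  then have "\<forall>\<^sub>F n in sequentially. trace_le (H (a n) (b n) - H a0 b0) (\<epsilon> / 3)"
    using \<epsilon> by (simp add: trace_tendsto_def)
  with q(3) show "\<forall>\<^sub>F n in sequentially. trace_le (gabor_sum S m (a n) (b n) - gabor_sum S m a0 b0) \<epsilon>"
  proof eventually_elim
    fix n
    assume n: "a n * real q \<ge> 1 \<and> b n * real q \<ge> 1" "trace_le (H (a n) (b n) - H a0 b0) (\<epsilon> / 3)"
    have "trace_le ((gabor_sum S m (a n) (b n) - H (a n) (b n)) - (gabor_sum S m a0 b0 - H a0 b0)
        + (H (a n) (b n) - H a0 b0)) (\<epsilon> / 3 + \<epsilon> / 3 + \<epsilon> / 3)"
      using n by (intro trace_le_add trace_le_diff tail a b q) auto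
    then show "trace_le (gabor_sum S m (a n) (b n) - gabor_sum S m a0 b0) \<epsilon>"
      by simp
  qed
qed

lemma gabor_sum_diff_operator:
  assumes "m \<in> wiener_amalgam" "a > 0" "b > 0"
  shows "gabor_sum (S - T) m a b = gabor_sum S m a b - gabor_sum T m a b"
proof -
  have "gabor_term (S - T) m z + gabor_term T m z = gabor_term S m z" for z
    by (rule blinfun_eqI)
      (simp add: gabor_term_def blinfun.add_left blinfun.diff_left blinfun.diff_right scaleC_diff_right)
  then have "((\<lambda>k. gabor_term S m (lattice_point a b k)) has_sum (gabor_sum (S - T) m a b + gabor_sum T m a b)) UNIV"
    using has_sum_add[OF has_sum_gabor_sum[OF assms, of "S - T"] has_sum_gabor_sum[OF assms, of T]] by simp
  from has_sum_unique[OF this has_sum_gabor_sum[OF assms]] show ?thesis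
    by (simp add: algebra_simps)
qed

lemma gabor_sum_diff_symbol:
  assumes "m \<in> wiener_amalgam" "m' \<in> wiener_amalgam" "a > 0" "b > 0"
  shows "gabor_sum S (\<lambda>z. m z - m' z) a b = gabor_sum S m a b - gabor_sum S m' a b"
proof -
  have "gabor_term S (\<lambda>z. m z - m' z) z + gabor_term S m' z = gabor_term S m z" for z
    by (rule blinfun_eqI) (simp add: gabor_term_def blinfun.add_left scaleC_diff_left)
  then have "((\<lambda>k. gabor_term S m (lattice_point a b k)) has_sum
      (gabor_sum S (\<lambda>z. m z - m' z) a b + gabor_sum S m' a b)) UNIV"
    using has_sum_add[OF has_sum_gabor_sum[OF wiener_amalgam_diff[OF assms(1,2)] assms(3,4), of S]
        has_sum_gabor_sum[OF assms(2-4), of S]] by simp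
  from has_sum_unique[OF this has_sum_gabor_sum[OF assms(1,3,4)]] show ?thesis
    by (simp add: algebra_simps)
qed

theorem theorem4p20:
  fixes \<alpha>s \<beta>s :: "nat \<Rightarrow> real" and \<alpha> \<beta> :: real
    and ms :: "nat \<Rightarrow> (real^'d::finite) \<times> (real^'d) \<Rightarrow> complex"
    and m :: "(real^'d) \<times> (real^'d) \<Rightarrow> complex"
    and Ss :: "nat \<Rightarrow> 'd op" and S :: "'d op"
  assumes "\<And>n. \<alpha>s n > 0" and "\<alpha> > 0" and "\<alpha>s \<longlonglongrightarrow> \<alpha>"
    and "\<And>n. \<beta>s n > 0" and "\<beta> > 0" and "\<beta>s \<longlonglongrightarrow> \<beta>"
    and "\<And>n. ms n \<in> wiener_amalgam" and "m \<in> wiener_amalgam"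
    and "(\<lambda>n. wiener_norm (\<lambda>z. ms n z - m z)) \<longlonglongrightarrow> 0"
    and "tendsto_S1 Ss S"
  shows "tendsto_S1 (\<lambda>n. mixed_gabor_multiplier (Ss n) (ms n) (\<alpha>s n) (\<beta>s n))
           (mixed_gabor_multiplier S m \<alpha> \<beta>)"
proof -
  note pos = assms(1,2,4,5) and m = assms(7,8)
  have S: "\<And>n. trace_class (Ss n)" "trace_class S" and SS: "(\<lambda>n. trace_norm (Ss n - S)) \<longlonglongrightarrow> 0"
    using assms(10) by (auto simp: tendsto_S1_def)
  obtain B :: "'d L2 set" where B: "orthonormal_basis B"
    using trace_class_ex_basis[OF S(2)] by blast
  define C D where "C = trace_norm S" and "D n = trace_norm (Ss n - S)" for n
  define W W' where "W = wiener_norm m" and "W' n = wiener_norm (\<lambda>z. ms n z - m z)" for n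
  have trS: "trace_le S C" and trD: "trace_le (Ss n - S) (D n)" for n
  proof -
    show "trace_le S C"
      unfolding C_def by (rule trace_le_trace_norm[OF S(2)])
    have "trace_class (Ss n - S)"
      using S trace_le_diff unfolding trace_class_iff[OF B] by (blast intro: clinear_op_diff)
    then show "trace_le (Ss n - S) (D n)"
      unfolding D_def by (rule trace_le_trace_norm)
  qed
  obtain q :: nat where q: "\<And>a b. a \<ge> \<alpha> / 2 \<Longrightarrow> b \<ge> \<beta> / 2 \<Longrightarrow> a * q \<ge> 1 \<and> b * q \<ge> 1"
    using ex_density_bound[of "\<alpha> / 2" "\<beta> / 2"] pos by (metis half_gt_zero)
  define N where "N = real (card (residues_box q :: ((int^'d) \<times> (int^'d)) set))"
  have "\<forall>\<^sub>F n in sequentially. \<alpha>s n > \<alpha> / 2" "\<forall>\<^sub>F n in sequentially. \<beta>s n > \<beta> / 2"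
    using order_tendstoD(1)[OF assms(3), of "\<alpha> / 2"] order_tendstoD(1)[OF assms(6), of "\<beta> / 2"] pos
    by simp_all
  then have ev: "\<forall>\<^sub>F n in sequentially. \<alpha>s n * q \<ge> 1 \<and> \<beta>s n * q \<ge> 1"
    by eventually_elim (rule q; simp)
  define G where "G n = gabor_sum (Ss n) (ms n) (\<alpha>s n) (\<beta>s n)" for n
  define H where "H n = gabor_sum S m (\<alpha>s n) (\<beta>s n)" for n
  define G0 where "G0 = gabor_sum S m \<alpha> \<beta>"
  have "trace_tendsto (\<lambda>n. G n - H n) 0"
  proof (rule trace_tendstoI)
    show "\<forall>\<^sub>F n in sequentially. trace_le (G n - H n - 0)
        (N * W' n * (D n + C) + N * W * D n)"
      using ev
    proof eventually_elim
      fix n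
      assume qn: "\<alpha>s n * q \<ge> 1 \<and> \<beta>s n * q \<ge> 1"
      note md = wiener_amalgam_diff[OF m]
      have "trace_le (Ss n) (D n + C)"
        using trace_le_add[OF trD trS] by simp
      then have "trace_le (gabor_sum (Ss n) (\<lambda>z. ms n z - m z) (\<alpha>s n) (\<beta>s n) + gabor_sum (Ss n - S) m (\<alpha>s n) (\<beta>s n))
          (N * W' n * (D n + C) + N * W * D n)"
        unfolding N_def W_def W'_def using qn
        by (intro trace_le_add trace_le_gabor_sum trD md m pos) auto
      then show "trace_le (G n - H n - 0) (N * W' n * (D n + C) + N * W * D n)"
        by (simp add: G_def H_def gabor_sum_diff_symbol gabor_sum_diff_operator m pos)
    qed
    have "(\<lambda>n. N * W' n * (D n + C) + N * W * D n) \<longlonglongrightarrow> N * 0 * (0 + C) + N * W * 0"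
      unfolding W'_def D_def by (intro tendsto_intros assms(9) SS)
    then show "(\<lambda>n. N * W' n * (D n + C) + N * W * D n) \<longlonglongrightarrow> 0"
      by simp
  qed
  moreover have "trace_tendsto H G0"
    unfolding H_def G0_def
    using q[of \<alpha> \<beta>] pos by (intro trace_tendsto_gabor_sum_lattice[OF _ _ _ _ _ _ _ _ _ _ ev] S m assms) auto
  ultimately have G: "trace_tendsto G G0"
    using trace_tendsto_add by fastforce
  define c c0 where "c n = \<alpha>s n ^ CARD('d) * \<beta>s n ^ CARD('d)" and "c0 = \<alpha> ^ CARD('d) * \<beta> ^ CARD('d)" for n
  have "c \<longlonglongrightarrow> c0"
    unfolding c_def c0_def by (intro tendsto_intros assms(3,6))
  then have "trace_tendsto (\<lambda>n. cmul (complex_of_real (c n)) o\<^sub>L G n) (cmul (complex_of_real c0) o\<^sub>L G0)"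
    using q[of \<alpha> \<beta>] pos
    by (intro trace_tendsto_scaled[OF G trace_le_gabor_sum[OF trS m(2), of \<alpha> \<beta> q, folded G0_def]] tendsto_of_real) auto
  then have "trace_tendsto (\<lambda>n. mixed_gabor_multiplier (Ss n) (ms n) (\<alpha>s n) (\<beta>s n)) (mixed_gabor_multiplier S m \<alpha> \<beta>)"
    by (simp only: cmul_of_real_compose mixed_gabor_multiplier_eq pos c_def c0_def G_def G0_def)
  moreover have "trace_class (mixed_gabor_multiplier (Ss n) (ms n) (\<alpha>s n) (\<beta>s n))"
    "trace_class (mixed_gabor_multiplier S m \<alpha> \<beta>)" for n
    by (intro trace_class_mixed_gabor_multiplier S m pos)+
  ultimately show ?thesis
    by (intro tendsto_S1_if_trace_tendsto[OF B])
qed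

end
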